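(* Let $(X,R)$ be a circularly ordered set with its interval topology $\lambda_R$, and let $G\subseteq H_+(X)$ be a subgroup of the group of all circular order preserving bijections of $X$, equipped with the pointwise topology $\sigma^p_X$ (inherited from $(X,\lambda_R)^X$). Let $\pi_X:G\times X\to X$ be the induced (separately continuous, COP) action. Then: (1) The circular interval uniformity $\mu_{\circ}$ on $X$ is equiuniform under the action of the semitopological group $(G,\sigma^p_X)$. (2) Novák's COP compactification $\nu:(X,\lambda_R)\to(\mathcal X_r,\mathrm{int}_r)$ admits a canonically defined COP action $\pi_r:(G,\sigma^p_X)\times\mathcal X_r\to\mathcal X_r$ which extends the given action $\pi_X$ (i.e. $g\nu(x)=\nu(gx)$) and is continuous. (3) $(G,\sigma^p_X)$ is a topological group and $\pi_X$ is (jointly) continuous. ( * ) Similar results hold for every linearly ordered set $(X,\leq)$ with its interval topology $\lambda_\leq$ and every subgroup $G$ of the group $H_+(X)$ of linear order preserving bijections of $X$ with the pointwise topology: the linear interval uniformity $\mu_\leq$ is $G$-equiuniform; the minimal linearly ordered (Dedekind) compactification of $(X,\leq)$, i.e. the completion of $\mu_\leq$, admits a continuous linear order preserving action of $G$ extending the action on $X$; and $G$ is a topological group whose action on $X$ is continuous.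
   Context: A circular order on a set $X$ is a ternary relation $R\subseteq X^3$ (write $[a,b,c]$ for $(a,b,c)\in R$) satisfying: cyclicity ($[a,b,c]\Rightarrow[b,c,a]$); asymmetry ($[a,b,c]\Rightarrow (c,b,a)\notin R$); transitivity ($[a,b,c]$ and $[a,c,d]$ imply $[a,b,d]$); totality (if $a,b,c$ are distinct then $[a,b,c]$ or $[a,c,b]$). Put $(a,b)_R:=\{x\in X:[a,x,b]\}$ and $[a,b]_R:=(a,b)_R\cup\{a,b\}$. The interval topology $\lambda_R$ is the topology on $X$ with base $\{X\setminus[a,b]_R: a,b\in X\}\cup\{X\}$. A bijection $f$ is circular order preserving (COP) if $[a,b,c]$ implies $[f(a),f(b),f(c)]$; an action is COP if all translations are COP. Circular interval uniformity $\mu_\circ$: the (covering) uniformity on $X$ with base all covers $\mathcal C_F=\{(a_i,a_{i+2})_R:i=1,\dots,n\}$ (indices mod $n$), where $F=[a_1,\dots,a_n]$ runs over finite cycles of $n\geq3$ distinct points ($[a_i,a_j,a_k]$ whenever $i,j,k$ are in cyclic order); if $|X|\leq2$ it is the discrete uniformity. It is compatible with $\lambda_R$. Linear interval uniformity $\mu_\leq$: the uniformity on $X$ with base all covers $\{(a_{i-1},a_{i+1}):i=1,\dots,n\}$, where $a_1<\dots<a_n$ runs over finite chains in $X$ and $a_0=-\infty$, $a_{n+1}=+\infty$. It is compatible with $\lambda_\leq$ (the topology generated by the open rays). Novák's regular completion. A cut on $(X,R)$ is a linear order $\leq$ on $X$ such that $a<b<c$ implies $[a,b,c]$. A gap is a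 cut having neither a least nor a greatest element. The lower point-cut $\leq_x$ is the linear order with least element $x$ and $a<_x b\iff[x,a,b]$ for $a,b\neq x$. $\mathcal X_r$ is the set of all gaps and all lower point-cuts, with circular order: for distinct $L_1,L_2,L_3$, $[L_1,L_2,L_3]_{\mathcal R}$ iff there is a partition $X=A\sqcup B\sqcup D$ into nonempty pieces with $(X,L_1)=A\oplus B\oplus D$, $(X,L_2)=B\oplus D\oplus A$, $(X,L_3)=D\oplus A\oplus B$ (ordinal sums, with the same order on each piece). $\mathrm{int}_r$ is its interval topology (compact), and $\nu(x)=\ \leq_x$ is a dense topological and circular order embedding; $\mathcal X_r$ is the completion of $(X,\mu_\circ)$. A semitopological group is a group with a topology making multiplication separately continuous. For an action of such $G$ on a uniform space $(X,\mathcal U)$: $\mathcal U$ is equiuniform if every translation $x\mapsto gx$ is uniformly continuous (saturated) and for every uniform cover $\varepsilon\in\mathcal U$ there is a neighborhood $V$ of $e$ in $G$ such that $\{Vx:x\in X\}$ refines $\varepsilon$ (bounded). *)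

theory Defs
  imports "HOL-Analysis.Analysis" "HOL-Algebra.Group_Action"
begin

subsection \<open>Covers and covering uniformities\<close>

definition refines :: "'a set set \<Rightarrow> 'a set set \<Rightarrow> bool" where
  "refines \<A> \<B> \<longleftrightarrow> (\<forall>A\<in>\<A>. \<exists>B\<in>\<B>. A \<subseteq> B)"

definition star_refines :: "'a set set \<Rightarrow> 'a set set \<Rightarrow> bool" where
  "star_refines \<A> \<B> \<longleftrightarrow> (\<forall>A\<in>\<A>. \<exists>B\<in>\<B>. \<Union>{A'\<in>\<A>. A' \<inter> A \<noteq> {}} \<subseteq> B)"

definition covering_uniformity :: "'a set \<Rightarrow> 'a set set set \<Rightarrow> bool" where
  "covering_uniformity X \<U> \<longleftrightarrow>
     \<U> \<noteq> {} \<and>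
     (\<forall>\<A>\<in>\<U>. \<Union>\<A> = X) \<and>
     (\<forall>\<A>\<in>\<U>. \<forall>\<B>. \<Union>\<B> = X \<and> refines \<A> \<B> \<longrightarrow> \<B> \<in> \<U>) \<and>
     (\<forall>\<A>\<in>\<U>. \<forall>\<B>\<in>\<U>. \<exists>\<C>\<in>\<U>. star_refines \<C> \<A> \<and> star_refines \<C> \<B>)"

definition uniformity_with_base :: "'a set \<Rightarrow> 'a set set set \<Rightarrow> 'a set set set" where
  "uniformity_with_base X \<B> = {\<C>. \<Union>\<C> = X \<and> (\<exists>\<A>\<in>\<B>. refines \<A> \<C>)}"

definition uniformly_continuous_cov ::
    "'a set \<Rightarrow> 'a set set set \<Rightarrow> 'b set set set \<Rightarrow> ('a \<Rightarrow> 'b) \<Rightarrow> bool" where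
  "uniformly_continuous_cov X \<U> \<V> f \<longleftrightarrow> (\<forall>\<C>\<in>\<V>. {{x\<in>X. f x \<in> C} |C. C \<in> \<C>} \<in> \<U>)"

text \<open>A compact Hausdorff space has exactly one compatible uniformity, consisting of all covers
  refined by open covers, and it is complete. So \<open>j\<close> exhibits the compact Hausdorff space \<open>T\<close> as
  the completion of \<open>(X, \<U>)\<close> iff \<open>j\<close> is injective with dense image and \<open>\<U>\<close> is the uniformity
  induced by \<open>j\<close> from the one of \<open>T\<close>.\<close>

definition compact_completion ::
    "'a set \<Rightarrow> 'a set set set \<Rightarrow> 'b topology \<Rightarrow> ('a \<Rightarrow> 'b) \<Rightarrow> bool" where
  "compact_completion X \<U> T j \<longleftrightarrow>
     compact_space T \<and> Hausdorff_space T \<and>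
     inj_on j X \<and> j ` X \<subseteq> topspace T \<and> Abstract_Topology.closure_of T (j ` X) = topspace T \<and>
     \<U> = uniformity_with_base X
           {{{x\<in>X. j x \<in> W} |W. W \<in> \<W>} |\<W>. (\<forall>W\<in>\<W>. openin T W) \<and> \<Union>\<W> = topspace T}"


subsection \<open>Topologized groups and their actions\<close>

definition semitopological_group :: "('g, 'm) monoid_scheme \<Rightarrow> 'g topology \<Rightarrow> bool" where
  "semitopological_group \<G> \<tau> \<longleftrightarrow>
     group \<G> \<and> topspace \<tau> = carrier \<G> \<and>
     (\<forall>g\<in>carrier \<G>. continuous_map \<tau> \<tau> (\<lambda>h. g \<otimes>\<^bsub>\<G>\<^esub> h) \<and> continuous_map \<tau> \<tau> (\<lambda>h. h \<otimes>\<^bsub>\<G>\<^esub> g))"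

definition topological_group :: "('g, 'm) monoid_scheme \<Rightarrow> 'g topology \<Rightarrow> bool" where
  "topological_group \<G> \<tau> \<longleftrightarrow>
     group \<G> \<and> topspace \<tau> = carrier \<G> \<and>
     continuous_map (prod_topology \<tau> \<tau>) \<tau> (\<lambda>(g, h). g \<otimes>\<^bsub>\<G>\<^esub> h) \<and>
     continuous_map \<tau> \<tau> (\<lambda>g. inv\<^bsub>\<G>\<^esub> g)"

definition continuous_action ::
    "('g, 'm) monoid_scheme \<Rightarrow> 'g topology \<Rightarrow> 'a topology \<Rightarrow> ('g \<Rightarrow> 'a \<Rightarrow> 'a) \<Rightarrow> bool" where
  "continuous_action \<G> \<tau> T \<phi> \<longleftrightarrow>
     group_action \<G> (topspace T) \<phi> \<and>
     continuous_map (prod_topology \<tau> T) T (\<lambda>(g, x). \<phi> g x)"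

definition equiuniform ::
    "('g, 'm) monoid_scheme \<Rightarrow> 'g topology \<Rightarrow> 'a set \<Rightarrow> 'a set set set \<Rightarrow> ('g \<Rightarrow> 'a \<Rightarrow> 'a) \<Rightarrow> bool" where
  "equiuniform \<G> \<tau> X \<U> \<phi> \<longleftrightarrow>
     semitopological_group \<G> \<tau> \<and> group_action \<G> X \<phi> \<and> covering_uniformity X \<U> \<and>
     (\<forall>g\<in>carrier \<G>. uniformly_continuous_cov X \<U> \<U> (\<phi> g)) \<and>
     (\<forall>\<C>\<in>\<U>. \<exists>V. openin \<tau> V \<and> \<one>\<^bsub>\<G>\<^esub> \<in> V \<and> refines {{\<phi> g x |g. g \<in> V} |x. x \<in> X} \<C>)"

text \<open>Self-maps of \<open>X\<close> are extensional functions, both in \<open>BijGroup X\<close> and in the product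
  \<open>T\<^sup>X\<close>.\<close>

definition pointwise_topology :: "'a topology \<Rightarrow> ('a \<Rightarrow> 'a) set \<Rightarrow> ('a \<Rightarrow> 'a) topology" where
  "pointwise_topology T G = subtopology (product_topology (\<lambda>_. T) (topspace T)) G"


subsection \<open>Circular orders\<close>

definition circular_order :: "'a set \<Rightarrow> ('a \<times> 'a \<times> 'a) set \<Rightarrow> bool" where
  "circular_order X R \<longleftrightarrow>
     R \<subseteq> X \<times> X \<times> X \<and>
     (\<forall>a b c. (a, b, c) \<in> R \<longrightarrow> (b, c, a) \<in> R) \<and>
     (\<forall>a b c. (a, b, c) \<in> R \<longrightarrow> (c, b, a) \<notin> R) \<and>
     (\<forall>a b c d. (a, b, c) \<in> R \<and> (a, c, d) \<in> R \<longrightarrow> (a, b, d) \<in> R) \<and>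
     (\<forall>a\<in>X. \<forall>b\<in>X. \<forall>c\<in>X. a \<noteq> b \<and> b \<noteq> c \<and> a \<noteq> c \<longrightarrow> (a, b, c) \<in> R \<or> (a, c, b) \<in> R)"

definition circ_open :: "('a \<times> 'a \<times> 'a) set \<Rightarrow> 'a \<Rightarrow> 'a \<Rightarrow> 'a set" where
  "circ_open R a b = {x. (a, x, b) \<in> R}"

definition circ_closed :: "('a \<times> 'a \<times> 'a) set \<Rightarrow> 'a \<Rightarrow> 'a \<Rightarrow> 'a set" where
  "circ_closed R a b = circ_open R a b \<union> {a, b}"

definition circ_topology :: "'a set \<Rightarrow> ('a \<times> 'a \<times> 'a) set \<Rightarrow> 'a topology" where
  "circ_topology X R =
     topology_generated_by ({X - circ_closed R a b |a b. a \<in> X \<and> b \<in> X} \<union> {X})"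

definition cop :: "'a set \<Rightarrow> ('a \<times> 'a \<times> 'a) set \<Rightarrow> ('a \<Rightarrow> 'a) \<Rightarrow> bool" where
  "cop X R f \<longleftrightarrow>
     bij_betw f X X \<and> (\<forall>a b c. (a, b, c) \<in> R \<longrightarrow> (f a, f b, f c) \<in> R)"

definition cop_group :: "'a set \<Rightarrow> ('a \<times> 'a \<times> 'a) set \<Rightarrow> ('a \<Rightarrow> 'a) monoid" where
  "cop_group X R = BijGroup X\<lparr>carrier := {f \<in> Bij X. cop X R f}\<rparr>"

text \<open>By cyclicity of \<open>R\<close>, index triples \<open>i < j < k\<close> account for all triples in cyclic order.\<close>

definition circ_cycle :: "'a set \<Rightarrow> ('a \<times> 'a \<times> 'a) set \<Rightarrow> 'a list \<Rightarrow> bool" where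
  "circ_cycle X R as \<longleftrightarrow>
     3 \<le> length as \<and> distinct as \<and> set as \<subseteq> X \<and>
     (\<forall>i j k. i < j \<and> j < k \<and> k < length as \<longrightarrow> (as ! i, as ! j, as ! k) \<in> R)"

definition cycle_cover :: "('a \<times> 'a \<times> 'a) set \<Rightarrow> 'a list \<Rightarrow> 'a set set" where
  "cycle_cover R as = {circ_open R (as ! i) (as ! ((i + 2) mod length as)) |i. i < length as}"

definition circ_uniformity :: "'a set \<Rightarrow> ('a \<times> 'a \<times> 'a) set \<Rightarrow> 'a set set set" where
  "circ_uniformity X R =
     (if finite X \<and> card X \<le> 2 then {\<C>. \<Union>\<C> = X}
      else uniformity_with_base X {cycle_cover R as |as. circ_cycle X R as})"


subsection \<open>Novak's regular completion\<close>

definition circ_cut :: "'a set \<Rightarrow> ('a \<times> 'a \<times> 'a) set \<Rightarrow> 'a rel \<Rightarrow> bool" where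
  "circ_cut X R L \<longleftrightarrow>
     linear_order_on X L \<and>
     (\<forall>a b c. (a, b) \<in> L \<and> a \<noteq> b \<and> (b, c) \<in> L \<and> b \<noteq> c \<longrightarrow> (a, b, c) \<in> R)"

definition circ_gap :: "'a set \<Rightarrow> ('a \<times> 'a \<times> 'a) set \<Rightarrow> 'a rel \<Rightarrow> bool" where
  "circ_gap X R L \<longleftrightarrow>
     circ_cut X R L \<and>
     \<not> (\<exists>x\<in>X. \<forall>y\<in>X. (x, y) \<in> L) \<and> \<not> (\<exists>x\<in>X. \<forall>y\<in>X. (y, x) \<in> L)"

definition lower_cut :: "'a set \<Rightarrow> ('a \<times> 'a \<times> 'a) set \<Rightarrow> 'a \<Rightarrow> 'a rel" where
  "lower_cut X R x = {(a, b). a \<in> X \<and> b \<in> X \<and> (a = x \<or> a = b \<or> (x, a, b) \<in> R)}"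

definition novak_points :: "'a set \<Rightarrow> ('a \<times> 'a \<times> 'a) set \<Rightarrow> 'a rel set" where
  "novak_points X R = {L. circ_gap X R L} \<union> lower_cut X R ` X"

definition ordinal_sum3 :: "'a rel \<Rightarrow> 'a rel \<Rightarrow> 'a rel \<Rightarrow> 'a rel" where
  "ordinal_sum3 r s t =
     r \<union> s \<union> t \<union> Field r \<times> Field s \<union> Field r \<times> Field t \<union> Field s \<times> Field t"

definition novak_order ::
    "'a set \<Rightarrow> ('a \<times> 'a \<times> 'a) set \<Rightarrow> ('a rel \<times> 'a rel \<times> 'a rel) set" where
  "novak_order X R =
     {(L1, L2, L3).
        L1 \<in> novak_points X R \<and> L2 \<in> novak_points X R \<and> L3 \<in> novak_points X R \<and>
        L1 \<noteq> L2 \<and> L2 \<noteq> L3 \<and> L1 \<noteq> L3 \<and>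
        (\<exists>A B D r s t.
           A \<noteq> {} \<and> B \<noteq> {} \<and> D \<noteq> {} \<and>
           A \<inter> B = {} \<and> B \<inter> D = {} \<and> A \<inter> D = {} \<and> A \<union> B \<union> D = X \<and>
           linear_order_on A r \<and> linear_order_on B s \<and> linear_order_on D t \<and>
           L1 = ordinal_sum3 r s t \<and> L2 = ordinal_sum3 s t r \<and> L3 = ordinal_sum3 t r s)}"

definition novak_topology :: "'a set \<Rightarrow> ('a \<times> 'a \<times> 'a) set \<Rightarrow> 'a rel topology" where
  "novak_topology X R = circ_topology (novak_points X R) (novak_order X R)"

text \<open>The canonical action: \<open>g\<close> transports a linear order \<open>L\<close> on \<open>X\<close> to the linear order on \<open>X\<close>
  in which \<open>g a\<close> precedes \<open>g b\<close> iff \<open>a\<close> precedes \<open>b\<close> in \<open>L\<close>.\<close>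

definition novak_action ::
    "'a set \<Rightarrow> ('a \<times> 'a \<times> 'a) set \<Rightarrow> ('a \<Rightarrow> 'a) \<Rightarrow> 'a rel \<Rightarrow> 'a rel" where
  "novak_action X R g = (\<lambda>L\<in>novak_points X R. {(g a, g b) |a b. (a, b) \<in> L})"


subsection \<open>Linear orders\<close>

definition lin_less :: "'a rel \<Rightarrow> 'a \<Rightarrow> 'a \<Rightarrow> bool" where
  "lin_less r a b \<longleftrightarrow> (a, b) \<in> r \<and> a \<noteq> b"

text \<open>The whole set is listed because a one-point order has no nonempty open ray.\<close>

definition lin_topology :: "'a set \<Rightarrow> 'a rel \<Rightarrow> 'a topology" where
  "lin_topology X r =
     topology_generated_by
       ({{x\<in>X. lin_less r a x} |a. a \<in> X} \<union> {{x\<in>X. lin_less r x a} |a. a \<in> X} \<union> {X})"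

definition lop :: "'a set \<Rightarrow> 'a rel \<Rightarrow> ('a \<Rightarrow> 'a) \<Rightarrow> bool" where
  "lop X r f \<longleftrightarrow> bij_betw f X X \<and> (\<forall>a b. (a, b) \<in> r \<longrightarrow> (f a, f b) \<in> r)"

definition lop_group :: "'a set \<Rightarrow> 'a rel \<Rightarrow> ('a \<Rightarrow> 'a) monoid" where
  "lop_group X r = BijGroup X\<lparr>carrier := {f \<in> Bij X. lop X r f}\<rparr>"

text \<open>A missing left or right neighbour in the list stands for the end point at infinity.\<close>

definition chain_cover :: "'a set \<Rightarrow> 'a rel \<Rightarrow> 'a list \<Rightarrow> 'a set set" where
  "chain_cover X r as =
     {{x\<in>X. (0 < i \<longrightarrow> lin_less r (as ! (i - 1)) x) \<and>
            (i + 1 < length as \<longrightarrow> lin_less r x (as ! (i + 1)))} |i. i < length as}"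

text \<open>The empty chain gives the empty family, which is a cover only of the empty set.\<close>

definition lin_uniformity :: "'a set \<Rightarrow> 'a rel \<Rightarrow> 'a set set set" where
  "lin_uniformity X r =
     uniformity_with_base X
       {chain_cover X r as |as.
          set as \<subseteq> X \<and> sorted_wrt (lin_less r) as \<and> (as = [] \<longrightarrow> X = {})}"

text \<open>The Dedekind compactification adds to \<open>X\<close> (whose points \<open>x\<close> are represented by the initial
  segments \<open>{y. y \<le> x}\<close>) one point for each gap \<open>(A, X - A)\<close>, including the gaps
  \<open>A = {}\<close> and \<open>A = X\<close> at the ends of a nonempty \<open>X\<close> without least, resp. greatest element.\<close>

definition lin_gap :: "'a set \<Rightarrow> 'a rel \<Rightarrow> 'a set \<Rightarrow> bool" where
  "lin_gap X r A \<longleftrightarrow>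
     X \<noteq> {} \<and> A \<subseteq> X \<and> (\<forall>x\<in>A. \<forall>y. (y, x) \<in> r \<longrightarrow> y \<in> A) \<and>
     \<not> (\<exists>x\<in>A. \<forall>y\<in>A. (y, x) \<in> r) \<and> \<not> (\<exists>x\<in>X - A. \<forall>y\<in>X - A. (x, y) \<in> r)"

definition lin_embed :: "'a rel \<Rightarrow> 'a \<Rightarrow> 'a set" where
  "lin_embed r x = {y. (y, x) \<in> r}"

definition dedekind_points :: "'a set \<Rightarrow> 'a rel \<Rightarrow> 'a set set" where
  "dedekind_points X r = lin_embed r ` X \<union> {A. lin_gap X r A}"

definition dedekind_order :: "'a set \<Rightarrow> 'a rel \<Rightarrow> 'a set rel" where
  "dedekind_order X r =
     {(A, B). A \<in> dedekind_points X r \<and> B \<in> dedekind_points X r \<and> A \<subseteq> B}"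

definition dedekind_topology :: "'a set \<Rightarrow> 'a rel \<Rightarrow> 'a set topology" where
  "dedekind_topology X r = lin_topology (dedekind_points X r) (dedekind_order X r)"

end

theory Submission
  imports Defs
begin

text \<open>The interval uniformities are the traces of the unique uniformities of compact Hausdorff spaces \<open>K\<close>
in which \<open>X\<close> embeds (the Novak completion, resp. the Dedekind compactification), and \<open>G\<close> acts on \<open>K\<close> by
automorphisms. The action on \<open>K\<close> is jointly continuous at every \<open>(e, L)\<close>, hence everywhere: a
neighbourhood of \<open>L\<close> in \<open>K\<close> contains an interval with end points in \<open>X\<close>, and since \<open>G\<close> preserves the
order, controlling the images of finitely many points of \<open>X\<close> controls the image of an interval. The
only delicate points are those isolated on one side; a jump of \<open>K\<close> always has both ends in \<open>X\<close>, so they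
can be controlled by the pointwise topology as well. By compactness, joint continuity makes orbits of
small neighbourhoods of \<open>e\<close> uniformly small. This is the boundedness of the uniformity, and applied to
the point \<open>g\<inverse> x\<close> it gives the continuity of the inversion.\<close>

subsection \<open>Uniformities induced by compact Hausdorff spaces\<close>

text \<open>The detour through a compact space also settles the uniformity axioms: star refinements
  come from regularity and compactness of \<open>K\<close>, not from manipulating chains and cycles
  of points. A jump of \<open>K\<close> has both ends in \<open>X\<close> because a gap has no
  extreme element on either side, so between a gap and any other element of \<open>K\<close> there
  is a point of \<open>X\<close>. A circular completion has no linear order to argue with, so a base
  point is chosen there: cuts become initial segments of one linear order and their circular order
  becomes cyclic inclusion. The order axioms, density and compactness are proved in this form.
  Circles with at most two points have no nonempty open arcs and no cycles, and the empty circle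
  even has a one-point Novak completion; they are treated separately, as finite discrete
  spaces.\<close>

definition open_cover :: "'b topology \<Rightarrow> 'b set set \<Rightarrow> bool" where
  "open_cover T \<W> \<longleftrightarrow> (\<forall>W\<in>\<W>. openin T W) \<and> \<Union>\<W> = topspace T"

definition trace_cover :: "'a set \<Rightarrow> ('a \<Rightarrow> 'b) \<Rightarrow> 'b set set \<Rightarrow> 'a set set" where
  "trace_cover X j \<W> = (\<lambda>W. {x\<in>X. j x \<in> W}) ` \<W>"

definition induced_uniformity :: "'a set \<Rightarrow> 'b topology \<Rightarrow> ('a \<Rightarrow> 'b) \<Rightarrow> 'a set set set" where
  "induced_uniformity X T j = uniformity_with_base X {trace_cover X j \<W> |\<W>. open_cover T \<W>}"

lemma compact_completion_iff:
  "compact_completion X \<U> T j \<longleftrightarrow>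
     compact_space T \<and> Hausdorff_space T \<and> inj_on j X \<and> j ` X \<subseteq> topspace T \<and>
     Abstract_Topology.closure_of T (j ` X) = topspace T \<and> \<U> = induced_uniformity X T j"
  unfolding compact_completion_def induced_uniformity_def trace_cover_def open_cover_def
    Setcompr_eq_image by (rule refl)

lemma refines_refl: "refines \<A> \<A>"
  unfolding refines_def by blast

lemma refines_trans: "refines \<A> \<B> \<Longrightarrow> refines \<B> \<C> \<Longrightarrow> refines \<A> \<C>"
  unfolding refines_def by (meson subset_trans)

lemma star_refines_refines: "star_refines \<A> \<B> \<Longrightarrow> refines \<B> \<C> \<Longrightarrow> star_refines \<A> \<C>"
  unfolding refines_def star_refines_def by (meson subset_trans)

lemma Union_trace_cover:
  assumes "j ` X \<subseteq> topspace T" "open_cover T \<W>"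
  shows "\<Union>(trace_cover X j \<W>) = X"
proof -
  have "\<Union>(trace_cover X j \<W>) = {x\<in>X. j x \<in> \<Union>\<W>}"
    unfolding trace_cover_def by blast
  then show ?thesis using assms unfolding open_cover_def by auto
qed

lemma refines_trace_cover:
  assumes "refines \<V> \<W>"
  shows "refines (trace_cover X j \<V>) (trace_cover X j \<W>)"
  unfolding refines_def trace_cover_def
proof
  fix A assume "A \<in> (\<lambda>W. {x\<in>X. j x \<in> W}) ` \<V>"
  then obtain V where V: "V \<in> \<V>" "A = {x\<in>X. j x \<in> V}" by (rule imageE)
  then obtain W where "W \<in> \<W>" "V \<subseteq> W" using assms unfolding refines_def by auto
  then show "\<exists>B\<in>(\<lambda>W. {x\<in>X. j x \<in> W}) ` \<W>. A \<subseteq> B" using V(2) by auto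
qed

text \<open>If two traces share a point \<open>x\<close>, the sets they come from share
  \<open>j x\<close>; hence the star of a trace lies in the trace of the star.\<close>

lemma star_refines_trace_cover:
  assumes "star_refines \<V> \<W>"
  shows "star_refines (trace_cover X j \<V>) (trace_cover X j \<W>)"
  unfolding star_refines_def
proof
  fix A assume "A \<in> trace_cover X j \<V>"
  then obtain V where V: "V \<in> \<V>" "A = {x\<in>X. j x \<in> V}"
    by (auto simp: trace_cover_def)
  then obtain W where W: "W \<in> \<W>" "\<Union>{V'\<in>\<V>. V' \<inter> V \<noteq> {}} \<subseteq> W"
    using assms by (auto simp: star_refines_def)
  have "\<Union>{A'\<in>trace_cover X j \<V>. A' \<inter> A \<noteq> {}} \<subseteq> {x\<in>X. j x \<in> W}"
    using W(2) by (auto simp: trace_cover_def V(2))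
  then show "\<exists>B\<in>trace_cover X j \<W>. \<Union>{A'\<in>trace_cover X j \<V>. A' \<inter> A \<noteq> {}} \<subseteq> B"
    using W(1) by (auto simp: trace_cover_def)
qed

text \<open>Regularity puts a closed \<open>C z\<close> between a neighbourhood \<open>U z\<close>
  and a member \<open>W z\<close> of the cover, and finitely many \<open>U z\<close> cover the
  space. If \<open>y\<close> lies in \<open>U z\<close>, then every \<open>V y'\<close> containing
  \<open>y\<close> meets \<open>C z\<close>. By the choice of \<open>V\<close> this forces
  \<open>y' \<in> C z\<close> and hence \<open>V y' \<subseteq> W z\<close>.\<close>

lemma compact_Hausdorff_barycentric_refinement:
  assumes "compact_space T" "Hausdorff_space T" "open_cover T \<W>"
  obtains \<V> where "open_cover T \<V>"
    "\<And>y. y \<in> topspace T \<Longrightarrow> \<exists>W\<in>\<W>. \<Union>{V\<in>\<V>. y \<in> V} \<subseteq> W"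
proof -
  have "neighbourhood_base_of (closedin T) T"
    using assms(1,2) compact_Hausdorff_imp_regular_space neighbourhood_base_of_closedin by blast
  then have nb: "\<And>W x. openin T W \<and> x \<in> W \<Longrightarrow>
      \<exists>U C. openin T U \<and> closedin T C \<and> x \<in> U \<and> U \<subseteq> C \<and> C \<subseteq> W"
    unfolding neighbourhood_base_of by blast
  have "\<forall>z\<in>topspace T. \<exists>W U C. W \<in> \<W> \<and> openin T U \<and> closedin T C \<and> z \<in> U \<and> U \<subseteq> C \<and> C \<subseteq> W"
  proof
    fix z assume "z \<in> topspace T"
    then obtain W where "W \<in> \<W>" "z \<in> W" "openin T W"
      using assms(3) unfolding open_cover_def by blast
    then show "\<exists>W U C. W \<in> \<W> \<and> openin T U \<and> closedin T C \<and> z \<in> U \<and> U \<subseteq> C \<and> C \<subseteq> W"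
      using nb[of W z] by blast
  qed
  then obtain W U C where WUC: "\<And>z. z \<in> topspace T \<Longrightarrow>
      W z \<in> \<W> \<and> openin T (U z) \<and> closedin T (C z) \<and> z \<in> U z \<and> U z \<subseteq> C z \<and> C z \<subseteq> W z"
    by metis
  have "\<exists>\<F>. finite \<F> \<and> \<F> \<subseteq> U ` topspace T \<and> topspace T \<subseteq> \<Union>\<F>"
  proof -
    have "compactin T (topspace T)" using assms(1) by (simp add: compact_space_def)
    moreover have "\<forall>U'\<in>U ` topspace T. openin T U'" "topspace T \<subseteq> \<Union>(U ` topspace T)"
      using WUC by auto
    ultimately show ?thesis
      unfolding compactin_def by blast
  qed
  then obtain Z where Z: "finite Z" "Z \<subseteq> topspace T" "topspace T \<subseteq> \<Union>(U ` Z)"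
    by (metis finite_subset_image)
  \<comment> \<open>Finitely many conditions decide, for each closed set \<open>C z\<close>, whether
    \<open>V y\<close> stays inside \<open>W z\<close> or avoids \<open>C z\<close>; the
    intersection with \<open>topspace T\<close> covers the case of an empty
    \<open>Z\<close>.\<close>
  define V where "V y = (\<Inter>z\<in>Z. if y \<in> C z then W z else topspace T - C z) \<inter> topspace T" for y
  have Vopen: "openin T (V y)" for y
    unfolding V_def
    by (rule openin_INT[OF Z(1)]) (use Z(2) WUC assms(3) in \<open>auto simp: open_cover_def\<close>)
  have Vmem: "y \<in> V y" if "y \<in> topspace T" for y
    unfolding V_def using WUC Z(2) that by fastforce
  have bary: "\<exists>W\<in>\<W>. \<Union>{V'\<in>V ` topspace T. y \<in> V'} \<subseteq> W" if "y \<in> topspace T" for y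
  proof -
    \<comment> \<open>This \<open>z\<close> depends on \<open>y\<close> alone, so \<open>W z\<close>
      serves all members containing \<open>y\<close> at once.\<close>
    obtain z where z: "z \<in> Z" "y \<in> U z" using Z(3) \<open>y \<in> topspace T\<close> by auto
    then have "y \<in> C z" "W z \<in> \<W>" using WUC Z(2) by blast+
    have "V y' \<subseteq> W z" if "y \<in> V y'" for y'
    proof -
      have "y' \<in> C z"
      proof (rule ccontr)
        assume "y' \<notin> C z"
        then have "V y' \<subseteq> topspace T - C z" using z(1) by (auto simp: V_def)
        then show False using that \<open>y \<in> C z\<close> by blast
      qed
      then show ?thesis using z(1) by (auto simp: V_def)
    qed
    then show ?thesis using \<open>W z \<in> \<W>\<close> by blast
  qed
  show ?thesis
  proof
    show "open_cover T (V ` topspace T)"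
      unfolding open_cover_def using Vopen Vmem openin_subset by blast
  qed (use bary in blast)
qed

text \<open>Two barycentric refinements in a row: a set \<open>A'\<close> meeting \<open>A\<close>
  in \<open>z\<close> lies with \<open>A\<close> in one member of \<open>\<V>1\<close>. That member
  contains a fixed \<open>y \<in> A\<close>, so it lies in the star of \<open>y\<close> with respect
  to \<open>\<V>1\<close>.\<close>

lemma compact_Hausdorff_star_refinement:
  assumes "compact_space T" "Hausdorff_space T" "open_cover T \<W>"
  obtains \<V> where "open_cover T \<V>" "star_refines \<V> \<W>"
proof -
  obtain \<V>1 where 1: "open_cover T \<V>1"
      "\<And>y. y \<in> topspace T \<Longrightarrow> \<exists>W\<in>\<W>. \<Union>{V\<in>\<V>1. y \<in> V} \<subseteq> W"
    using compact_Hausdorff_barycentric_refinement[OF assms] by metis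
  obtain \<V>2 where 2: "open_cover T \<V>2"
      "\<And>y. y \<in> topspace T \<Longrightarrow> \<exists>W\<in>\<V>1. \<Union>{V\<in>\<V>2. y \<in> V} \<subseteq> W"
    using compact_Hausdorff_barycentric_refinement[OF assms(1,2) 1(1)] by metis
  \<comment> \<open>The empty set is discarded so that every member supplies a point
    \<open>y\<close>; over an empty space \<open>\<W>\<close> may have no member at all to receive
    the star of the empty set.\<close>
  have "open_cover T (\<V>2 - {{}})"
    using 2(1) unfolding open_cover_def by auto
  moreover have "star_refines (\<V>2 - {{}}) \<W>"
    unfolding star_refines_def
  proof
    fix A assume A: "A \<in> \<V>2 - {{}}"
    then obtain y where y: "y \<in> A" by blast
    then have "y \<in> topspace T" using A 2(1) unfolding open_cover_def by blast
    then obtain W where W: "W \<in> \<W>" "\<Union>{V\<in>\<V>1. y \<in> V} \<subseteq> W" using 1(2) by blast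
    have "A' \<subseteq> W" if A': "A' \<in> \<V>2" "A' \<inter> A \<noteq> {}" for A'
    proof -
      obtain z where z: "z \<in> A'" "z \<in> A" using A' by blast
      then have "z \<in> topspace T" using A 2(1) unfolding open_cover_def by blast
      then obtain V where "V \<in> \<V>1" "\<Union>{V\<in>\<V>2. z \<in> V} \<subseteq> V" using 2(2) by blast
      then have "A' \<subseteq> V" "A \<subseteq> V" using z A A' by auto
      then show ?thesis using y W(2) \<open>V \<in> \<V>1\<close> by blast
    qed
    then show "\<exists>B\<in>\<W>. \<Union>{A'\<in>\<V>2 - {{}}. A' \<inter> A \<noteq> {}} \<subseteq> B"
      using W(1) by blast
  qed
  ultimately show ?thesis using that by blast
qed

lemma open_cover_common_refinement:
  assumes "open_cover T \<V>" "open_cover T \<W>"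
  obtains \<Z> where "open_cover T \<Z>" "refines \<Z> \<V>" "refines \<Z> \<W>"
proof
  show "open_cover T {V \<inter> W |V W. V \<in> \<V> \<and> W \<in> \<W>}"
    unfolding open_cover_def
  proof
    show "\<forall>U\<in>{V \<inter> W |V W. V \<in> \<V> \<and> W \<in> \<W>}. openin T U"
      using assms unfolding open_cover_def by blast
    have "\<Union>{V \<inter> W |V W. V \<in> \<V> \<and> W \<in> \<W>} = \<Union>\<V> \<inter> \<Union>\<W>" by blast
    then show "\<Union>{V \<inter> W |V W. V \<in> \<V> \<and> W \<in> \<W>} = topspace T"
      using assms unfolding open_cover_def by auto
  qed
qed (unfold refines_def, blast+)

lemma mem_induced_uniformity_iff:
  "\<A> \<in> induced_uniformity X T j \<longleftrightarrow>
     \<Union>\<A> = X \<and> (\<exists>\<W>. open_cover T \<W> \<and> refines (trace_cover X j \<W>) \<A>)"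
proof -
  have "\<A> \<in> induced_uniformity X T j \<longleftrightarrow>
     \<Union>\<A> = X \<and> (\<exists>\<B>\<in>{trace_cover X j \<W> |\<W>. open_cover T \<W>}. refines \<B> \<A>)"
    unfolding induced_uniformity_def uniformity_with_base_def by (rule mem_Collect_eq)
  then show ?thesis by simp metis
qed

lemma covering_uniformity_induced:
  assumes "compact_space T" "Hausdorff_space T" "j ` X \<subseteq> topspace T"
  shows "covering_uniformity X (induced_uniformity X T j)"
  unfolding covering_uniformity_def
proof (intro conjI ballI allI impI)
  have "open_cover T {topspace T}" by (simp add: open_cover_def)
  then have "trace_cover X j {topspace T} \<in> induced_uniformity X T j"
    unfolding mem_induced_uniformity_iff using Union_trace_cover[OF assms(3)]
    using refines_refl by blast
  then show "induced_uniformity X T j \<noteq> {}" by blast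
next
  fix \<A> assume "\<A> \<in> induced_uniformity X T j"
  then show "\<Union>\<A> = X" by (simp add: mem_induced_uniformity_iff)
next
  fix \<A> \<B> assume A: "\<A> \<in> induced_uniformity X T j" and B: "\<Union>\<B> = X \<and> refines \<A> \<B>"
  obtain \<W> where "open_cover T \<W>" "refines (trace_cover X j \<W>) \<A>"
    using A unfolding mem_induced_uniformity_iff by blast
  moreover have "refines (trace_cover X j \<W>) \<B>"
    using calculation B refines_trans by blast
  ultimately show "\<B> \<in> induced_uniformity X T j"
    using B unfolding mem_induced_uniformity_iff by blast
next
  fix \<A> \<B> assume A: "\<A> \<in> induced_uniformity X T j" and B: "\<B> \<in> induced_uniformity X T j"
  obtain \<V> where V: "open_cover T \<V>" "refines (trace_cover X j \<V>) \<A>"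
    using A unfolding mem_induced_uniformity_iff by blast
  obtain \<W> where W: "open_cover T \<W>" "refines (trace_cover X j \<W>) \<B>"
    using B unfolding mem_induced_uniformity_iff by blast
  obtain \<Z> where Z: "open_cover T \<Z>" "refines \<Z> \<V>" "refines \<Z> \<W>"
    using open_cover_common_refinement[OF V(1) W(1)] by blast
  obtain \<Y> where Y: "open_cover T \<Y>" "star_refines \<Y> \<Z>"
    using compact_Hausdorff_star_refinement[OF assms(1,2) Z(1)] by blast
  have "trace_cover X j \<Y> \<in> induced_uniformity X T j"
    unfolding mem_induced_uniformity_iff using Y(1) Union_trace_cover[OF assms(3)]
    using refines_refl by blast
  moreover have "star_refines (trace_cover X j \<Y>) \<A>"
    by (rule star_refines_refines[OF star_refines_trace_cover[OF Y(2)]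
          refines_trans[OF refines_trace_cover[OF Z(2)] V(2)]])
  moreover have "star_refines (trace_cover X j \<Y>) \<B>"
    by (rule star_refines_refines[OF star_refines_trace_cover[OF Y(2)]
          refines_trans[OF refines_trace_cover[OF Z(3)] W(2)]])
  ultimately show "\<exists>\<C>\<in>induced_uniformity X T j. star_refines \<C> \<A> \<and> star_refines \<C> \<B>"
    by blast
qed

subsection \<open>Group actions on a compactification\<close>

lemma openin_pullback_iff:
  "openin (pullback_topology X j K) U \<longleftrightarrow> (\<exists>W. openin K W \<and> U = {x\<in>X. j x \<in> W})"
proof -
  have "j -` W \<inter> X = {x\<in>X. j x \<in> W}" for W by auto
  then show ?thesis by (simp add: openin_pullback_topology)
qed

lemma continuous_map_into_pullback:
  assumes "continuous_map S K (\<lambda>x. j (f x))" "\<And>x. x \<in> topspace S \<Longrightarrow> f x \<in> X"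
  shows "continuous_map S (pullback_topology X j K) f"
  using assms by (intro continuous_map_pullback') (auto simp: o_def)

section \<open>The topology of pointwise convergence on a set of bijections\<close>

lemma topspace_pointwise:
  assumes "G \<subseteq> Bij (topspace T)"
  shows "topspace (pointwise_topology T G) = G"
  using assms unfolding pointwise_topology_def Bij_def
  by (auto simp: topspace_subtopology PiE_def bij_betw_def)

lemma continuous_map_pointwise_eval:
  assumes "x \<in> topspace T"
  shows "continuous_map (pointwise_topology T G) T (\<lambda>g. g x)"
  unfolding pointwise_topology_def using assms
  by (intro continuous_map_from_subtopology continuous_map_product_projection)

lemma continuous_map_into_pointwise:
  assumes "\<And>x. x \<in> topspace T \<Longrightarrow> continuous_map S T (\<lambda>s. F s x)"
    and "\<And>s. s \<in> topspace S \<Longrightarrow> F s \<in> G" "G \<subseteq> Bij (topspace T)"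
  shows "continuous_map S (pointwise_topology T G) F"
  unfolding pointwise_topology_def continuous_map_in_subtopology
    continuous_map_componentwise
  using assms by (fastforce simp: Bij_def)

text \<open>The common setting of the linear, the circular and the finite case. Order enters only
  through \<open>local\<close>, which is joint continuity of the action at the pair of the identity
  and \<open>y\<close>; everything else is soft.\<close>

locale compactified_action =
  fixes X :: "'a set" and T :: "'a topology" and K :: "'b topology" and j :: "'a \<Rightarrow> 'b"
    and G :: "('a \<Rightarrow> 'a) set" and \<psi> :: "('a \<Rightarrow> 'a) \<Rightarrow> 'b \<Rightarrow> 'b"
  assumes compact: "compact_space K" and Hausdorff: "Hausdorff_space K"
    and j_mem: "x \<in> X \<Longrightarrow> j x \<in> topspace K"
    and T_eq: "T = pullback_topology X j K"
    and subgroup: "subgroup G (BijGroup X)"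
    and action: "group_action (BijGroup X\<lparr>carrier := G\<rparr>) (topspace K) \<psi>"
    and cont: "g \<in> G \<Longrightarrow> continuous_map K K (\<psi> g)"
    and equivariant: "g \<in> G \<Longrightarrow> x \<in> X \<Longrightarrow> \<psi> g (j x) = j (g x)"
    and local: "openin K W \<Longrightarrow> y \<in> W \<Longrightarrow>
       \<exists>V N. openin (pointwise_topology T G) V \<and> (\<lambda>x\<in>X. x) \<in> V \<and> openin K N \<and> y \<in> N \<and>
         (\<forall>g\<in>V. \<forall>z\<in>N. \<psi> g z \<in> W)"
begin

abbreviation "\<G> \<equiv> BijGroup X\<lparr>carrier := G\<rparr>"
abbreviation "\<tau> \<equiv> pointwise_topology T G"

lemma topspace_T: "topspace T = X"
  using j_mem by (auto simp: T_eq topspace_pullback_topology)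

lemma G_Bij: "G \<subseteq> Bij X"
  using subgroup.subset[OF subgroup] by (simp add: BijGroup_def)

lemma G_mem: "g \<in> G \<Longrightarrow> x \<in> X \<Longrightarrow> g x \<in> X"
  using G_Bij Bij_imp_funcset by blast

lemma topspace_tau: "topspace \<tau> = G"
  using topspace_pointwise[of G T] G_Bij by (simp add: topspace_T)

lemma group_G: "group \<G>"
  by (rule group.subgroup_imp_group[OF group_BijGroup subgroup])

lemma mult_eq: "g \<in> G \<Longrightarrow> h \<in> G \<Longrightarrow> g \<otimes>\<^bsub>BijGroup X\<^esub> h = compose X g h"
  using G_Bij by (auto simp: BijGroup_def)

lemma compose_mem: "g \<in> G \<Longrightarrow> h \<in> G \<Longrightarrow> compose X g h \<in> G"
  using subgroup.m_closed[OF subgroup, of g h] mult_eq by simp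

lemma one_eq: "\<one>\<^bsub>\<G>\<^esub> = (\<lambda>x\<in>X. x)"
  by (simp add: BijGroup_def)

lemma one_mem: "(\<lambda>x\<in>X. x) \<in> G"
  using subgroup.one_closed[OF subgroup] by (simp add: BijGroup_def)

lemma inv_eq: "g \<in> G \<Longrightarrow> inv\<^bsub>\<G>\<^esub> g = (\<lambda>x\<in>X. inv_into X g x)"
  using group.m_inv_consistent[OF group_BijGroup subgroup] inv_BijGroup G_Bij by auto

lemma inv_mem: "g \<in> G \<Longrightarrow> (\<lambda>x\<in>X. inv_into X g x) \<in> G"
  using group.inv_closed[OF group_G] inv_eq by simp

lemma inv_apply:
  assumes "g \<in> G" "x \<in> X"
  shows "inv_into X g x \<in> X" "g (inv_into X g x) = x" "inv_into X g (g x) = x"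
proof -
  have "bij_betw g X X" using assms(1) G_Bij by (auto simp: Bij_def)
  then show "inv_into X g x \<in> X" "g (inv_into X g x) = x" "inv_into X g (g x) = x"
    using assms(2) by (auto simp: bij_betw_def inv_into_into f_inv_into_f)
qed

lemma action_mem: "g \<in> G \<Longrightarrow> y \<in> topspace K \<Longrightarrow> \<psi> g y \<in> topspace K"
  using cont continuous_map_funspace by blast

lemma action_compose:
  "g \<in> G \<Longrightarrow> h \<in> G \<Longrightarrow> y \<in> topspace K \<Longrightarrow> \<psi> (compose X g h) y = \<psi> g (\<psi> h y)"
  using group_action.composition_rule[OF action, of y g h] mult_eq by simp

lemma j_cont: "continuous_map T K j"
  using continuous_map_pullback[of K K id X j] by (simp add: T_eq)

lemma translation_cont:
  assumes "g \<in> G"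
  shows "continuous_map T T g"
proof -
  have "continuous_map T K (\<lambda>x. \<psi> g (j x))"
    using continuous_map_compose[OF j_cont cont[OF assms]] by (simp add: o_def)
  then have "continuous_map T K (\<lambda>x. j (g x))"
    by (rule continuous_map_eq) (simp add: topspace_T equivariant assms)
  then show ?thesis
    using continuous_map_into_pullback[of T K j g X] G_mem[OF assms] topspace_T
    unfolding T_eq[symmetric] by blast
qed

lemma eval_cont: "x \<in> X \<Longrightarrow> continuous_map \<tau> T (\<lambda>g. g x)"
  by (rule continuous_map_pointwise_eval) (simp add: topspace_T)

lemma into_tau:
  assumes "\<And>x. x \<in> X \<Longrightarrow> continuous_map S T (\<lambda>s. F s x)" "\<And>s. s \<in> topspace S \<Longrightarrow> F s \<in> G"
  shows "continuous_map S \<tau> F"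
  by (rule continuous_map_into_pointwise) (use assms G_Bij in \<open>simp_all add: topspace_T\<close>)

text \<open>Evaluated at \<open>x\<close> this is evaluation followed by \<open>g\<close>, so it
  rests on continuity of \<open>g\<close> on \<open>T\<close>; the right translation of
  \<open>right_cont\<close> is just evaluation at \<open>g x\<close>.\<close>

lemma left_cont:
  assumes "g \<in> G"
  shows "continuous_map \<tau> \<tau> (\<lambda>h. compose X g h)"
proof (rule into_tau)
  fix x assume x: "x \<in> X"
  show "continuous_map \<tau> T (\<lambda>h. compose X g h x)"
    using continuous_map_compose[OF eval_cont[OF x] translation_cont[OF assms]] x
    by (simp add: compose_def o_def)
qed (use compose_mem assms topspace_tau in auto)

lemma right_cont:
  assumes "g \<in> G"
  shows "continuous_map \<tau> \<tau> (\<lambda>h. compose X h g)"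
proof (rule into_tau)
  fix x assume x: "x \<in> X"
  show "continuous_map \<tau> T (\<lambda>h. compose X h g x)"
    using eval_cont[OF G_mem[OF assms x]] x by (simp add: compose_def)
qed (use compose_mem assms topspace_tau in auto)

lemma semitopological: "semitopological_group \<G> \<tau>"
  unfolding semitopological_group_def
proof (intro conjI ballI)
  fix g assume "g \<in> carrier \<G>"
  then have g: "g \<in> G" by simp
  show "continuous_map \<tau> \<tau> (\<lambda>h. g \<otimes>\<^bsub>\<G>\<^esub> h)"
    by (rule continuous_map_eq[OF left_cont[OF g]]) (simp add: topspace_tau mult_eq g)
  show "continuous_map \<tau> \<tau> (\<lambda>h. h \<otimes>\<^bsub>\<G>\<^esub> g)"
    by (rule continuous_map_eq[OF right_cont[OF g]]) (simp add: topspace_tau mult_eq g)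
qed (simp_all add: group_G topspace_tau)

text \<open>Continuity at \<open>(g, y)\<close> is transported from \<open>local\<close> at
  \<open>\<psi> g y\<close>: write \<open>h\<close> as \<open>h g\<close>-inverse followed by
  \<open>g\<close> on the right. Right translation keeps the first factor near the identity when
  \<open>h\<close> is near \<open>g\<close>, and \<open>\<psi> g z\<close> is near
  \<open>\<psi> g y\<close> when \<open>z\<close> is near \<open>y\<close>.\<close>

lemma action_joint_cont: "continuous_map (prod_topology \<tau> K) K (\<lambda>(g, y). \<psi> g y)"
  unfolding continuous_map_def
proof (intro conjI allI impI)
  show "(\<lambda>(g, y). \<psi> g y) \<in> topspace (prod_topology \<tau> K) \<rightarrow> topspace K"
    using action_mem by (auto simp: topspace_tau)
next
  fix W assume W: "openin K W"
  show "openin (prod_topology \<tau> K) {p \<in> topspace (prod_topology \<tau> K). (\<lambda>(g, y). \<psi> g y) p \<in> W}"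
    unfolding openin_prod_topology_alt
  proof (intro allI impI)
    fix g y
    assume "(g, y) \<in> {p \<in> topspace (prod_topology \<tau> K). (\<lambda>(g, y). \<psi> g y) p \<in> W}"
    then have gy: "g \<in> G" "y \<in> topspace K" "\<psi> g y \<in> W" by (auto simp: topspace_tau)
    obtain V N where VN: "openin \<tau> V" "(\<lambda>x\<in>X. x) \<in> V" "openin K N" "\<psi> g y \<in> N"
        "\<forall>h\<in>V. \<forall>z\<in>N. \<psi> h z \<in> W"
      using local[OF W gy(3)] by blast
    define g' where "g' = (\<lambda>x\<in>X. inv_into X g x)"
    have g': "g' \<in> G" unfolding g'_def by (rule inv_mem[OF gy(1)])
    define V' where "V' = {h \<in> topspace \<tau>. compose X h g' \<in> V}"
    define N' where "N' = {z \<in> topspace K. \<psi> g z \<in> N}"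
    have "openin \<tau> V'"
      unfolding V'_def by (rule openin_continuous_map_preimage[OF right_cont[OF g'] VN(1)])
    moreover have "openin K N'"
      unfolding N'_def by (rule openin_continuous_map_preimage[OF cont[OF gy(1)] VN(3)])
    moreover have "compose X g g' = (\<lambda>x\<in>X. x)"
      using inv_apply[OF gy(1)] by (auto simp: compose_def g'_def)
    then have "g \<in> V'" using gy(1) VN(2) by (simp add: V'_def topspace_tau)
    moreover have "y \<in> N'" using gy(2) VN(4) by (simp add: N'_def)
    moreover have "V' \<times> N' \<subseteq> {p \<in> topspace (prod_topology \<tau> K). (\<lambda>(g, y). \<psi> g y) p \<in> W}"
    proof clarify
      fix h z assume h: "h \<in> V'" and z: "z \<in> N'"
      have hG: "h \<in> G" using h by (simp add: V'_def topspace_tau)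
      have zK: "z \<in> topspace K" using z by (simp add: N'_def)
      \<comment> \<open>The equality must hold off \<open>X\<close> too, where both sides are
        \<open>undefined\<close> because members of \<open>G\<close> are extensional.\<close>
      have "compose X (compose X h g') g = h"
      proof
        fix x
        show "compose X (compose X h g') g x = h x"
          using inv_apply(3)[OF gy(1)] G_mem[OF gy(1)] hG G_Bij extensional_arb[of h X x]
          by (cases "x \<in> X") (auto simp: compose_def g'_def Bij_def)
      qed
      then have "\<psi> h z = \<psi> (compose X h g') (\<psi> g z)"
        using action_compose[OF compose_mem[OF hG g'] gy(1) zK] by simp
      then have "\<psi> h z \<in> W" using VN(5) h z by (simp add: V'_def N'_def)
      then show "(h, z) \<in> topspace (prod_topology \<tau> K) \<and> \<psi> h z \<in> W"
        using hG zK by (simp add: topspace_tau)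
    qed
    ultimately show "\<exists>U V. openin \<tau> U \<and> openin K V \<and> g \<in> U \<and> y \<in> V \<and>
        U \<times> V \<subseteq> {p \<in> topspace (prod_topology \<tau> K). (\<lambda>(g, y). \<psi> g y) p \<in> W}"
      by blast
  qed
qed

text \<open>A Lebesgue number argument: the neighbourhoods \<open>N y\<close> given by
  \<open>local\<close> have a finite subcover, and the intersection of the corresponding
  \<open>V z\<close> works for all points at once.\<close>

lemma uniformly_small_orbits:
  assumes "open_cover K \<W>"
  obtains V where "openin \<tau> V" "(\<lambda>x\<in>X. x) \<in> V"
    "\<And>y. y \<in> topspace K \<Longrightarrow> \<exists>W\<in>\<W>. \<forall>g\<in>V. \<psi> g y \<in> W"
proof -
  \<comment> \<open>Triples \<open>(V, N, W)\<close> are coded as nested pairs so that one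
    application of choice selects all three.\<close>
  have "\<forall>y\<in>topspace K. \<exists>p. snd (snd p) \<in> \<W> \<and> openin \<tau> (fst p) \<and> (\<lambda>x\<in>X. x) \<in> fst p \<and>
       openin K (fst (snd p)) \<and> y \<in> fst (snd p) \<and>
       (\<forall>g\<in>fst p. \<forall>z\<in>fst (snd p). \<psi> g z \<in> snd (snd p))"
  proof
    fix y assume "y \<in> topspace K"
    then obtain W where W: "W \<in> \<W>" "y \<in> W" "openin K W"
      using assms unfolding open_cover_def by blast
    obtain V N where "openin \<tau> V \<and> (\<lambda>x\<in>X. x) \<in> V \<and> openin K N \<and> y \<in> N \<and>
         (\<forall>g\<in>V. \<forall>z\<in>N. \<psi> g z \<in> W)"
      using local[OF W(3,2)] by blast
    then show "\<exists>p. snd (snd p) \<in> \<W> \<and> openin \<tau> (fst p) \<and> (\<lambda>x\<in>X. x) \<in> fst p \<and>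
       openin K (fst (snd p)) \<and> y \<in> fst (snd p) \<and>
       (\<forall>g\<in>fst p. \<forall>z\<in>fst (snd p). \<psi> g z \<in> snd (snd p))"
      using W(1) by (intro exI[of _ "(V, N, W)"]) simp
  qed
  from bchoice[OF this] obtain p where p: "\<forall>y\<in>topspace K. snd (snd (p y)) \<in> \<W> \<and>
       openin \<tau> (fst (p y)) \<and> (\<lambda>x\<in>X. x) \<in> fst (p y) \<and>
       openin K (fst (snd (p y))) \<and> y \<in> fst (snd (p y)) \<and>
       (\<forall>g\<in>fst (p y). \<forall>z\<in>fst (snd (p y)). \<psi> g z \<in> snd (snd (p y)))"
    by blast
  define V N W where "V = fst \<circ> p" and "N = fst \<circ> snd \<circ> p" and "W = snd \<circ> snd \<circ> p"
  have VNW: "W y \<in> \<W> \<and> openin \<tau> (V y) \<and> (\<lambda>x\<in>X. x) \<in> V y \<and> openin K (N y) \<and> y \<in> N y \<and>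
       (\<forall>g\<in>V y. \<forall>z\<in>N y. \<psi> g z \<in> W y)" if "y \<in> topspace K" for y
    using p that by (simp add: V_def N_def W_def)
  have "compactin K (topspace K)" using compact by (simp add: compact_space_def)
  moreover have "\<forall>U\<in>N ` topspace K. openin K U" "topspace K \<subseteq> \<Union>(N ` topspace K)"
    using VNW by auto
  ultimately have "\<exists>\<F>. finite \<F> \<and> \<F> \<subseteq> N ` topspace K \<and> topspace K \<subseteq> \<Union>\<F>"
    unfolding compactin_def by blast
  then obtain Z where Z: "finite Z" "Z \<subseteq> topspace K" "topspace K \<subseteq> \<Union>(N ` Z)"
    by (metis finite_subset_image)
  show ?thesis
  proof
    show "openin \<tau> ((\<Inter>z\<in>Z. V z) \<inter> topspace \<tau>)"
      by (rule openin_INT[OF Z(1)]) (use VNW Z(2) in blast)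
    show "(\<lambda>x\<in>X. x) \<in> (\<Inter>z\<in>Z. V z) \<inter> topspace \<tau>"
      using VNW Z(2) one_mem topspace_tau by blast
  next
    fix y assume "y \<in> topspace K"
    then obtain z where "z \<in> Z" "y \<in> N z" using Z(3) by blast
    then show "\<exists>W\<in>\<W>. \<forall>g\<in>(\<Inter>z\<in>Z. V z) \<inter> topspace \<tau>. \<psi> g y \<in> W"
      using VNW[of z] Z(2) by blast
  qed
qed

lemma action_X: "group_action \<G> X (\<lambda>g. g)"
proof -
  have "(\<lambda>g. g) \<in> hom \<G> (BijGroup X)"
    using G_Bij by (auto simp: hom_def BijGroup_def)
  then show ?thesis
    unfolding group_action_def group_hom_def group_hom_axioms_def
    using group_G group_BijGroup by blast
qed

text \<open>Saturation: preimages of an open cover of \<open>K\<close> under \<open>\<psi> g\<close>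
  form an open cover. Boundedness: \<open>uniformly_small_orbits\<close> at the points
  \<open>j x\<close>, whose orbits are the images of orbits in \<open>X\<close> by
  equivariance.\<close>

theorem equiuniform_induced: "equiuniform \<G> \<tau> X (induced_uniformity X K j) (\<lambda>g. g)"
  unfolding equiuniform_def
proof (intro conjI ballI)
  show "covering_uniformity X (induced_uniformity X K j)"
    by (rule covering_uniformity_induced[OF compact Hausdorff]) (use j_mem in blast)
next
  fix g assume "g \<in> carrier \<G>"
  then have g: "g \<in> G" by simp
  show "uniformly_continuous_cov X (induced_uniformity X K j) (induced_uniformity X K j) g"
    unfolding uniformly_continuous_cov_def
  proof
    fix \<C> assume "\<C> \<in> induced_uniformity X K j"
    then obtain \<W> where W: "\<Union>\<C> = X" "open_cover K \<W>" "refines (trace_cover X j \<W>) \<C>"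
      unfolding mem_induced_uniformity_iff by blast
    let ?\<W> = "(\<lambda>W. {y \<in> topspace K. \<psi> g y \<in> W}) ` \<W>"
    have "\<Union>?\<W> = {y \<in> topspace K. \<psi> g y \<in> \<Union>\<W>}" by blast
    then have "\<Union>?\<W> = topspace K"
      using W(2) action_mem[OF g] unfolding open_cover_def by auto
    moreover have "openin K W'" if "W' \<in> ?\<W>" for W'
      using that W(2) openin_continuous_map_preimage[OF cont[OF g]] unfolding open_cover_def by blast
    ultimately have "open_cover K ?\<W>" unfolding open_cover_def by blast
    moreover have "refines (trace_cover X j ?\<W>) {{x\<in>X. g x \<in> C} |C. C \<in> \<C>}"
      unfolding refines_def
    proof
      fix A assume "A \<in> trace_cover X j ?\<W>"
      then obtain W where W': "W \<in> \<W>" "A = {x\<in>X. j x \<in> {y \<in> topspace K. \<psi> g y \<in> W}}"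
        unfolding trace_cover_def by auto
      then have "{x\<in>X. j x \<in> W} \<in> trace_cover X j \<W>" unfolding trace_cover_def by auto
      then obtain C where "C \<in> \<C>" "{x\<in>X. j x \<in> W} \<subseteq> C"
        using W(3) unfolding refines_def by blast
      moreover have "A \<subseteq> {x\<in>X. g x \<in> C}"
        using calculation(2) W'(2) equivariant[OF g] G_mem[OF g] by auto
      ultimately show "\<exists>B\<in>{{x\<in>X. g x \<in> C} |C. C \<in> \<C>}. A \<subseteq> B" by blast
    qed
    moreover have "\<Union>{{x\<in>X. g x \<in> C} |C. C \<in> \<C>} = X"
    proof
      show "X \<subseteq> \<Union>{{x\<in>X. g x \<in> C} |C. C \<in> \<C>}"
      proof
        fix x assume x: "x \<in> X"
        then have "g x \<in> \<Union>\<C>" unfolding W(1) by (rule G_mem[OF g])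
        then obtain C where "C \<in> \<C>" "g x \<in> C" by (rule UnionE)
        then show "x \<in> \<Union>{{x\<in>X. g x \<in> C} |C. C \<in> \<C>}" using x by auto
      qed
    qed auto
    ultimately show "{{x\<in>X. g x \<in> C} |C. C \<in> \<C>} \<in> induced_uniformity X K j"
      unfolding mem_induced_uniformity_iff by blast
  qed
next
  fix \<C> assume "\<C> \<in> induced_uniformity X K j"
  then obtain \<W> where W: "open_cover K \<W>" "refines (trace_cover X j \<W>) \<C>"
    unfolding mem_induced_uniformity_iff by blast
  obtain V where V: "openin \<tau> V" "(\<lambda>x\<in>X. x) \<in> V"
    "\<And>y. y \<in> topspace K \<Longrightarrow> \<exists>W\<in>\<W>. \<forall>g\<in>V. \<psi> g y \<in> W"
    using uniformly_small_orbits[OF W(1)] by blast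
  have VG: "V \<subseteq> G" using openin_subset[OF V(1)] topspace_tau by simp
  have "refines {{g x |g. g \<in> V} |x. x \<in> X} \<C>"
    unfolding refines_def
  proof
    fix A assume "A \<in> {{g x |g. g \<in> V} |x. x \<in> X}"
    then obtain x where x: "x \<in> X" "A = {g x |g. g \<in> V}" by blast
    obtain W' where W': "W' \<in> \<W>" "\<forall>g\<in>V. \<psi> g (j x) \<in> W'" using V(3) j_mem[OF x(1)] by blast
    then have "{x\<in>X. j x \<in> W'} \<in> trace_cover X j \<W>" unfolding trace_cover_def by auto
    then obtain C where "C \<in> \<C>" "{x\<in>X. j x \<in> W'} \<subseteq> C"
      using W(2) unfolding refines_def by blast
    moreover have "A \<subseteq> {x\<in>X. j x \<in> W'}"
    proof
      fix a assume "a \<in> A"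
      then obtain g where g: "g \<in> V" "a = g x" using x(2) by blast
      then have "g \<in> G" using VG by blast
      then show "a \<in> {x\<in>X. j x \<in> W'}"
        using W'(2) g equivariant[of g x] G_mem[of g x] x(1) by auto
    qed
    ultimately show "\<exists>B\<in>\<C>. A \<subseteq> B" by blast
  qed
  with V(1,2) show "\<exists>V. openin \<tau> V \<and> \<one>\<^bsub>\<G>\<^esub> \<in> V \<and> refines {{g x |g. g \<in> V} |x. x \<in> X} \<C>"
    unfolding one_eq by (intro exI[of _ V] conjI)
qed (rule semitopological action_X)+

theorem continuous_action_compactification: "continuous_action \<G> \<tau> K \<psi>"
  unfolding continuous_action_def using action action_joint_cont by blast

text \<open>The map \<open>(g, x)\<close> to \<open>j (g x) = \<psi> g (j x)\<close> is continuous
  into \<open>K\<close>, and the topology of \<open>X\<close> is the pullback along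
  \<open>j\<close>.\<close>

lemma action_X_joint_cont: "continuous_map (prod_topology \<tau> T) T (\<lambda>(g, x). g x)"
proof -
  have "continuous_map (prod_topology \<tau> T) (prod_topology \<tau> K) (\<lambda>p. (fst p, j (snd p)))"
    by (intro continuous_map_pairedI continuous_map_fst
        continuous_map_compose[OF continuous_map_snd j_cont, unfolded o_def])
  from continuous_map_compose[OF this action_joint_cont]
  have "continuous_map (prod_topology \<tau> T) K (\<lambda>p. \<psi> (fst p) (j (snd p)))"
    by (simp add: o_def)
  then have "continuous_map (prod_topology \<tau> T) K (\<lambda>p. j (case p of (g, x) \<Rightarrow> g x))"
    by (rule continuous_map_eq) (auto simp: topspace_tau topspace_T equivariant)
  moreover have "(case p of (g, x) \<Rightarrow> g x) \<in> X" if "p \<in> topspace (prod_topology \<tau> T)" for p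
    using that G_mem by (auto simp: topspace_tau topspace_T)
  ultimately have "continuous_map (prod_topology \<tau> T) (pullback_topology X j K) (\<lambda>(g, x). g x)"
    by (rule continuous_map_into_pullback)
  then show ?thesis by (simp only: T_eq)
qed

theorem continuous_action_X: "continuous_action \<G> \<tau> T (\<lambda>g. g)"
  unfolding continuous_action_def using action_X action_X_joint_cont topspace_T by auto

text \<open>Evaluated at \<open>x\<close>, the product is the joint action applied to
  \<open>(g, h x)\<close>, so joint continuity on \<open>X\<close> gives joint continuity of
  multiplication.\<close>

lemma mult_joint_cont: "continuous_map (prod_topology \<tau> \<tau>) \<tau> (\<lambda>(g, h). g \<otimes>\<^bsub>\<G>\<^esub> h)"
proof (rule into_tau)
  fix x assume x: "x \<in> X"
  have "continuous_map (prod_topology \<tau> \<tau>) (prod_topology \<tau> T) (\<lambda>p. (fst p, snd p x))"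
    by (intro continuous_map_pairedI continuous_map_fst
        continuous_map_compose[OF continuous_map_snd eval_cont[OF x], unfolded o_def])
  from continuous_map_compose[OF this action_X_joint_cont]
  have "continuous_map (prod_topology \<tau> \<tau>) T (\<lambda>p. fst p (snd p x))"
    by (simp add: o_def)
  then show "continuous_map (prod_topology \<tau> \<tau>) T (\<lambda>p. (case p of (g, h) \<Rightarrow> g \<otimes>\<^bsub>\<G>\<^esub> h) x)"
    by (rule continuous_map_eq) (use x in \<open>auto simp: topspace_tau mult_eq compose_def\<close>)
next
  fix p assume "p \<in> topspace (prod_topology \<tau> \<tau>)"
  then show "(case p of (g, h) \<Rightarrow> g \<otimes>\<^bsub>\<G>\<^esub> h) \<in> G"
    using compose_mem by (auto simp: topspace_tau mult_eq)
qed

text \<open>Near the identity, \<open>h\<inverse> y\<close> lies in \<open>W \<ni> y\<close>: a member of the cover \<open>{W, K - {y}}\<close> that contains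
  the orbit of \<open>h\<inverse> y\<close> under a small neighbourhood contains \<open>h (h\<inverse> y) = y\<close>, so it is \<open>W\<close>.\<close>

lemma inverse_cont_eval:
  assumes x: "x \<in> X"
  shows "continuous_map \<tau> T (\<lambda>g. inv_into X g x)"
  unfolding continuous_map_def
proof (intro conjI allI impI)
  show "(\<lambda>g. inv_into X g x) \<in> topspace \<tau> \<rightarrow> topspace T"
    using inv_apply(1) x by (auto simp: topspace_tau topspace_T)
next
  fix U assume "openin T U"
  then obtain W where W: "openin K W" "U = {x\<in>X. j x \<in> W}"
    unfolding T_eq openin_pullback_iff by blast
  show "openin \<tau> {g \<in> topspace \<tau>. inv_into X g x \<in> U}"
  proof (subst openin_subopen, intro ballI)
    fix g assume "g \<in> {g \<in> topspace \<tau>. inv_into X g x \<in> U}"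
    then have g: "g \<in> G" "inv_into X g x \<in> U" by (auto simp: topspace_tau)
    define y where "y = inv_into X g x"
    have y: "y \<in> X" "g y = x" "j y \<in> W" using inv_apply[OF g(1) x] g(2) W(2) by (auto simp: y_def)
    have "closedin K {j y}"
      using closedin_Hausdorff_singleton[OF Hausdorff] j_mem[OF y(1)] by blast
    then have "open_cover K {W, topspace K - {j y}}"
      unfolding open_cover_def using W(1) openin_subset[OF W(1)] y(3) by auto
    then obtain V where V: "openin \<tau> V" "(\<lambda>x\<in>X. x) \<in> V"
        "\<And>z. z \<in> topspace K \<Longrightarrow> \<exists>W'\<in>{W, topspace K - {j y}}. \<forall>g\<in>V. \<psi> g z \<in> W'"
      using uniformly_small_orbits by blast
    define g' where "g' = (\<lambda>x\<in>X. inv_into X g x)"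
    have g': "g' \<in> G" unfolding g'_def by (rule inv_mem[OF g(1)])
    \<comment> \<open>Left translation by the inverse of \<open>g\<close> moves the situation to the
      identity: with \<open>z\<close> the preimage of \<open>x\<close> under \<open>h\<close>, the
      element \<open>compose X g' h\<close> of \<open>V\<close> sends \<open>z\<close> to
      \<open>g' x = y\<close>.\<close>
    define V' where "V' = {h \<in> topspace \<tau>. compose X g' h \<in> V}"
    have "openin \<tau> V'"
      unfolding V'_def by (rule openin_continuous_map_preimage[OF left_cont[OF g'] V(1)])
    moreover have "compose X g' g = (\<lambda>x\<in>X. x)"
      using inv_apply[OF g(1)] G_mem[OF g(1)] by (auto simp: compose_def g'_def)
    then have "g \<in> V'" using g(1) V(2) by (simp add: V'_def topspace_tau)
    moreover have "V' \<subseteq> {g \<in> topspace \<tau>. inv_into X g x \<in> U}"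
    proof
      fix h assume h: "h \<in> V'"
      then have hG: "h \<in> G" by (simp add: V'_def topspace_tau)
      define z where "z = inv_into X h x"
      have z: "z \<in> X" "h z = x" using inv_apply[OF hG x] by (auto simp: z_def)
      have hV: "compose X g' h \<in> V" using h by (simp add: V'_def)
      then have "\<psi> (compose X g' h) (j z) = j (compose X g' h z)"
        using equivariant[of _ z] z(1) openin_subset[OF V(1)] topspace_tau by blast
      also have "compose X g' h z = y" using z x by (simp add: compose_def g'_def y_def)
      finally have 1: "\<psi> (compose X g' h) (j z) = j y" .
      have "\<psi> (\<lambda>x\<in>X. x) (j z) = j z"
        using equivariant[OF one_mem z(1)] z(1) by simp
      moreover obtain W' where "W' \<in> {W, topspace K - {j y}}" "\<forall>g\<in>V. \<psi> g (j z) \<in> W'"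
        using V(3)[OF j_mem[OF z(1)]] by blast
      ultimately have "j z \<in> W" using 1 hV V(2) by force
      then show "h \<in> {g \<in> topspace \<tau>. inv_into X g x \<in> U}"
        using hG z(1) W(2) by (simp add: topspace_tau z_def)
    qed
    ultimately show "\<exists>T. openin \<tau> T \<and> g \<in> T \<and> T \<subseteq> {g \<in> topspace \<tau>. inv_into X g x \<in> U}"
      by blast
  qed
qed

theorem topological: "topological_group \<G> \<tau>"
proof -
  have "continuous_map \<tau> \<tau> (\<lambda>g. inv\<^bsub>\<G>\<^esub> g)"
  proof (rule into_tau)
    fix x assume x: "x \<in> X"
    show "continuous_map \<tau> T (\<lambda>g. (inv\<^bsub>\<G>\<^esub> g) x)"
      by (rule continuous_map_eq[OF inverse_cont_eval[OF x]]) (simp add: topspace_tau inv_eq x)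
  next
    fix g assume "g \<in> topspace \<tau>"
    then show "inv\<^bsub>\<G>\<^esub> g \<in> G" using inv_mem inv_eq by (simp add: topspace_tau)
  qed
  then show ?thesis
    unfolding topological_group_def using group_G topspace_tau mult_joint_cont by simp
qed

end

subsection \<open>Linear orders\<close>

text \<open>The left side is the form of the generated topology in Alexander's subbase theorem, the
  right side the form in which interval topologies are defined. Each contains the subbase and is
  closed under the operations building the other.\<close>

lemma subbase_topology_eq_generated:
  "topology (arbitrary union_of (finite intersection_of (\<lambda>x. x \<in> \<B>) relative_to \<Union>\<B>)) =
     topology_generated_by \<B>" (is "?T = _")
proof -
  have openT: "openin ?T = arbitrary union_of (finite intersection_of (\<lambda>x. x \<in> \<B>) relative_to \<Union>\<B>)"
    by (rule topology_inverse'[OF istopology_subbase])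
  have "openin ?T U" if "generate_topology_on \<B> U" for U
    using that
  proof induction
    case (Basis s)
    have "(finite intersection_of (\<lambda>x. x \<in> \<B>)) s"
      using Basis by (rule finite_intersection_of_inc)
    then have "(finite intersection_of (\<lambda>x. x \<in> \<B>) relative_to \<Union>\<B>) s"
      using Basis by (metis Union_upper relative_to_subset_inc)
    then show ?case unfolding openT by (rule arbitrary_union_of_inc)
  qed auto
  moreover have "openin (topology_generated_by \<B>) U"
    if "(arbitrary union_of (finite intersection_of (\<lambda>x. x \<in> \<B>) relative_to \<Union>\<B>)) U" for U
  proof -
    have *: "openin (topology_generated_by \<B>) S"
      if "(finite intersection_of (\<lambda>x. x \<in> \<B>) relative_to \<Union>\<B>) S" for S
    proof -
      have "\<exists>\<F>. finite \<F> \<and> \<F> \<subseteq> \<B> \<and> S = \<Union>\<B> \<inter> \<Inter>\<F>"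
        using that unfolding relative_to_def intersection_of_def Collect_mem_eq by blast
      then obtain \<F> where F: "finite \<F>" "\<F> \<subseteq> \<B>" "S = \<Union>\<B> \<inter> \<Inter>\<F>"
        by blast
      have "openin (topology_generated_by \<B>) ((\<Inter>s\<in>\<F>. s) \<inter> topspace (topology_generated_by \<B>))"
        by (rule openin_INT[OF F(1)]) (use F(2) topology_generated_by_Basis in blast)
      then show ?thesis
        unfolding F(3) topology_generated_by_topspace by (simp add: Int_commute)
    qed
    obtain \<U> where U: "\<And>S. S \<in> \<U> \<Longrightarrow> (finite intersection_of (\<lambda>x. x \<in> \<B>) relative_to \<Union>\<B>) S" "U = \<Union>\<U>"
      using \<open>(arbitrary union_of (finite intersection_of (\<lambda>x. x \<in> \<B>) relative_to \<Union>\<B>)) U\<close>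
      unfolding union_of_def by auto
    show ?thesis unfolding U(2) by (rule openin_Union) (rule *, erule U(1))
  qed
  ultimately show ?thesis
    unfolding topology_eq openin_topology_generated_by_iff openT by blast
qed

lemma compact_topology_generated_by:
  assumes "\<And>\<C>. \<C> \<subseteq> \<B> \<Longrightarrow> \<Union>\<C> = \<Union>\<B> \<Longrightarrow> \<exists>\<C>'. finite \<C>' \<and> \<C>' \<subseteq> \<C> \<and> \<Union>\<C>' = \<Union>\<B>"
  shows "compact_space (topology_generated_by \<B>)"
  by (rule Alexander_subbase[OF subbase_topology_eq_generated])
    (use assms in \<open>simp add: topology_generated_by_topspace\<close>)

text \<open>Induction over the generation of \<open>W\<close>. With \<open>P\<close> read as being a
  neighbourhood of \<open>y\<close> in some prescribed sense, it reduces interval bases and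
  continuity at the identity to subbasic sets.\<close>

lemma openin_generated_local:
  assumes "openin (topology_generated_by \<B>) W" "y \<in> W"
    and basis: "\<And>W. W \<in> \<B> \<Longrightarrow> y \<in> W \<Longrightarrow> P W"
    and inter: "\<And>A B. P A \<Longrightarrow> P B \<Longrightarrow> P (A \<inter> B)"
    and mono: "\<And>A B. P A \<Longrightarrow> A \<subseteq> B \<Longrightarrow> P B"
  shows "P W"
proof -
  have "generate_topology_on \<B> W" using assms(1) by (rule openin_topology_generated_by)
  then have "y \<in> W \<longrightarrow> P W"
  proof induction
    case (UN K)
    show ?case
    proof
      assume "y \<in> \<Union>K"
      then obtain k where "k \<in> K" "y \<in> k" by blast
      then show "P (\<Union>K)" using UN mono[of k "\<Union>K"] by blast
    qed
  qed (use basis inter in auto)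
  then show ?thesis using assms(2) by blast
qed

text \<open>Insertion of \<open>x\<close> into a sorted list: what does not precede \<open>x\<close>
  follows it by totality, and transitivity through \<open>x\<close> orders the two halves.\<close>

lemma finite_sorted_list_exists:
  assumes "finite F"
    and "\<And>x y z. x \<in> F \<Longrightarrow> y \<in> F \<Longrightarrow> z \<in> F \<Longrightarrow> P x y \<Longrightarrow> P y z \<Longrightarrow> P x z"
    and "\<And>x y. x \<in> F \<Longrightarrow> y \<in> F \<Longrightarrow> x \<noteq> y \<Longrightarrow> P x y \<or> P y x"
  shows "\<exists>as. set as = F \<and> sorted_wrt P as"
  using assms
proof (induction F rule: finite_induct)
  case (insert x F)
  then have "\<exists>as. set as = F \<and> sorted_wrt P as" by blast
  then obtain as where as: "set as = F" "sorted_wrt P as" by blast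
  let ?bs = "filter (\<lambda>y. P y x) as @ [x] @ filter (\<lambda>y. \<not> P y x) as"
  have ge: "P x y" if "y \<in> F" "\<not> P y x" for y
    using that insert.hyps(2) insert.prems(2)[of x y] by auto
  have "P y z" if "y \<in> F" "z \<in> F" "P y x" "\<not> P z x" for y z
    using that ge insert.prems(1)[of y x z] by blast
  then have "sorted_wrt P ?bs"
    using as ge by (auto simp: sorted_wrt_append sorted_wrt_filter)
  moreover have "set ?bs = insert x F" using as(1) by auto
  ultimately show ?case by blast
qed simp

section \<open>Linear orders given as relations, and their interval topologies\<close>

locale linear_order_set =
  fixes Z :: "'c set" and s :: "'c rel"
  assumes lin: "linear_order_on Z s"
begin

abbreviation lt (infix "\<sqsubset>" 50) where "a \<sqsubset> b \<equiv> lin_less s a b"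

lemma s_mem: "(a, b) \<in> s \<Longrightarrow> a \<in> Z" "(a, b) \<in> s \<Longrightarrow> b \<in> Z"
  using lin by (auto simp: order_on_defs)

lemma s_refl: "a \<in> Z \<Longrightarrow> (a, a) \<in> s"
  using lin by (auto simp: order_on_defs refl_on_def)

lemma s_trans: "(a, b) \<in> s \<Longrightarrow> (b, c) \<in> s \<Longrightarrow> (a, c) \<in> s"
  using lin unfolding order_on_defs by (meson transD)

lemma s_antisym: "(a, b) \<in> s \<Longrightarrow> (b, a) \<in> s \<Longrightarrow> a = b"
  using lin unfolding order_on_defs by (meson antisymD)

lemma s_total: "a \<in> Z \<Longrightarrow> b \<in> Z \<Longrightarrow> (a, b) \<in> s \<or> (b, a) \<in> s"
  using lin unfolding order_on_defs total_on_def refl_on_def by metis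

lemma lt_mem: "a \<sqsubset> b \<Longrightarrow> a \<in> Z" "a \<sqsubset> b \<Longrightarrow> b \<in> Z"
  using s_mem by (auto simp: lin_less_def)

lemma lt_irrefl: "\<not> a \<sqsubset> a"
  by (simp add: lin_less_def)

lemma lt_trans: "a \<sqsubset> b \<Longrightarrow> b \<sqsubset> c \<Longrightarrow> a \<sqsubset> c"
  unfolding lin_less_def using s_trans s_antisym by metis

lemma le_lt_trans: "(a, b) \<in> s \<Longrightarrow> b \<sqsubset> c \<Longrightarrow> a \<sqsubset> c"
  unfolding lin_less_def using s_trans s_antisym by metis

lemma lt_le_trans: "a \<sqsubset> b \<Longrightarrow> (b, c) \<in> s \<Longrightarrow> a \<sqsubset> c"
  unfolding lin_less_def using s_trans s_antisym by metis

lemma not_lt: "a \<in> Z \<Longrightarrow> b \<in> Z \<Longrightarrow> \<not> a \<sqsubset> b \<longleftrightarrow> (b, a) \<in> s"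
  unfolding lin_less_def using s_total s_antisym s_refl by metis

lemma lt_total: "a \<in> Z \<Longrightarrow> b \<in> Z \<Longrightarrow> a \<noteq> b \<Longrightarrow> a \<sqsubset> b \<or> b \<sqsubset> a"
  unfolding lin_less_def using s_total by metis

lemma topspace_lin: "topspace (lin_topology Z s) = Z"
  unfolding lin_topology_def topology_generated_by_topspace by auto

lemma openin_upper_ray: "a \<in> Z \<Longrightarrow> openin (lin_topology Z s) {x\<in>Z. a \<sqsubset> x}"
  unfolding lin_topology_def by (rule topology_generated_by_Basis) blast

lemma openin_lower_ray: "a \<in> Z \<Longrightarrow> openin (lin_topology Z s) {x\<in>Z. x \<sqsubset> a}"
  unfolding lin_topology_def by (rule topology_generated_by_Basis) blast

text \<open>A point strictly between \<open>a\<close> and \<open>b\<close> separates them by its two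
  rays; if there is none, the ray below \<open>b\<close> and the ray above \<open>a\<close> are
  already disjoint.\<close>

lemma Hausdorff_lin: "Hausdorff_space (lin_topology Z s)"
proof -
  have sep: "\<exists>U V. openin (lin_topology Z s) U \<and> openin (lin_topology Z s) V \<and>
      a \<in> U \<and> b \<in> V \<and> disjnt U V" if ab: "a \<sqsubset> b" for a b
  proof (cases "\<exists>c. a \<sqsubset> c \<and> c \<sqsubset> b")
    case True
    then obtain c where c: "a \<sqsubset> c" "c \<sqsubset> b" by blast
    have "disjnt {x\<in>Z. x \<sqsubset> c} {x\<in>Z. c \<sqsubset> x}"
      using lt_trans lt_irrefl unfolding disjnt_iff by blast
    then show ?thesis
      using c lt_mem openin_lower_ray[of c] openin_upper_ray[of c] by blast
  next
    case False
    have "disjnt {x\<in>Z. x \<sqsubset> b} {x\<in>Z. a \<sqsubset> x}"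
      using False unfolding disjnt_iff by blast
    then show ?thesis
      using ab lt_mem openin_lower_ray[of b] openin_upper_ray[of a] by blast
  qed
  show ?thesis
    unfolding Hausdorff_space_def topspace_lin
  proof (intro allI impI)
    fix a b assume "a \<in> Z \<and> b \<in> Z \<and> a \<noteq> b"
    then consider "a \<sqsubset> b" | "b \<sqsubset> a" using lt_total by blast
    then show "\<exists>U V. openin (lin_topology Z s) U \<and> openin (lin_topology Z s) V \<and>
      a \<in> U \<and> b \<in> V \<and> disjnt U V"
      using sep[of a b] sep[of b a] disjnt_sym by cases blast+
  qed
qed

text \<open>By Alexander's theorem only covers by rays matter. Let \<open>u\<close> be the supremum
  of the end points \<open>b\<close> of the lower rays in the cover. A lower ray cannot contain
  \<open>u\<close>, so unless the whole of \<open>Z\<close> is a member, \<open>u\<close> lies in a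
  ray above some \<open>a \<sqsubset> u\<close>; some \<open>b\<close> exceeds \<open>a\<close>, and
  two rays suffice.\<close>

lemma compact_lin:
  assumes "\<And>S. S \<subseteq> Z \<Longrightarrow> \<exists>u\<in>Z. (\<forall>x\<in>S. (x, u) \<in> s) \<and> (\<forall>v\<in>Z. (\<forall>x\<in>S. (x, v) \<in> s) \<longrightarrow> (u, v) \<in> s)"
  shows "compact_space (lin_topology Z s)"
  unfolding lin_topology_def
proof (rule compact_topology_generated_by)
  let ?B = "{{x\<in>Z. a \<sqsubset> x} |a. a \<in> Z} \<union> {{x\<in>Z. x \<sqsubset> a} |a. a \<in> Z} \<union> {Z}"
  fix \<C> assume C: "\<C> \<subseteq> ?B" "\<Union>\<C> = \<Union>?B"
  have UB: "\<Union>?B = Z" by auto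
  define S where "S = {b\<in>Z. {x\<in>Z. x \<sqsubset> b} \<in> \<C>}"
  obtain u where u: "u \<in> Z" "\<And>x. x \<in> S \<Longrightarrow> (x, u) \<in> s"
      "\<And>v. v \<in> Z \<Longrightarrow> (\<And>x. x \<in> S \<Longrightarrow> (x, v) \<in> s) \<Longrightarrow> (u, v) \<in> s"
    using assms[of S] unfolding S_def by blast
  obtain W where W: "W \<in> \<C>" "u \<in> W" using C(2) UB u(1) by blast
  then consider a where "a \<in> Z" "W = {x\<in>Z. a \<sqsubset> x}" | b where "b \<in> Z" "W = {x\<in>Z. x \<sqsubset> b}" | "W = Z"
    using C(1) by blast
  then show "\<exists>\<C>'. finite \<C>' \<and> \<C>' \<subseteq> \<C> \<and> \<Union>\<C>' = \<Union>?B"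
  proof cases
    case 1
    then have au: "a \<sqsubset> u" using W by simp
    then have "\<not> (u, a) \<in> s" using 1 u(1) not_lt by blast
    then obtain b where b: "b \<in> S" "\<not> (b, a) \<in> s" using u(3)[of a] 1 by blast
    then have "a \<sqsubset> b" using 1 not_lt unfolding S_def by blast
    then have "x \<sqsubset> b \<or> a \<sqsubset> x" if "x \<in> Z" for x
      using that 1 b not_lt le_lt_trans unfolding S_def by blast
    then have "\<Union>{W, {x\<in>Z. x \<sqsubset> b}} = Z" using 1 by auto
    moreover have "{W, {x\<in>Z. x \<sqsubset> b}} \<subseteq> \<C>" using W b unfolding S_def by auto
    ultimately show ?thesis unfolding UB by (intro exI[of _ "{W, {x\<in>Z. x \<sqsubset> b}}"]) simp
  next
    case 2
    then have "b \<in> S" using W unfolding S_def by auto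
    then have "(b, u) \<in> s" by (rule u(2))
    moreover have "u \<sqsubset> b" using W 2 by simp
    ultimately show ?thesis using not_lt 2 u(1) by blast
  next
    case 3
    then show ?thesis unfolding UB using W(1) by (intro exI[of _ "{W}"]) simp
  qed
qed

section \<open>Automorphisms of a linear order\<close>

lemma lop_iff:
  assumes "lop Z s f" "a \<in> Z" "b \<in> Z"
  shows "(f a, f b) \<in> s \<longleftrightarrow> (a, b) \<in> s"
proof
  assume "(f a, f b) \<in> s"
  show "(a, b) \<in> s"
  proof (rule ccontr)
    assume "(a, b) \<notin> s"
    then have "(b, a) \<in> s" "a \<noteq> b" using s_total s_refl assms by blast+
    then have "(f b, f a) \<in> s" using assms(1) unfolding lop_def by blast
    then have "f a = f b" using \<open>(f a, f b) \<in> s\<close> s_antisym by blast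
    then show False
      using assms \<open>a \<noteq> b\<close> unfolding lop_def bij_betw_def inj_on_def by blast
  qed
qed (use assms(1) in \<open>auto simp: lop_def\<close>)

lemma lop_lt_iff:
  assumes "lop Z s f" "a \<in> Z" "b \<in> Z"
  shows "f a \<sqsubset> f b \<longleftrightarrow> a \<sqsubset> b"
proof -
  have "f a = f b \<longleftrightarrow> a = b"
    using assms unfolding lop_def bij_betw_def inj_on_def by blast
  then show ?thesis using lop_iff[OF assms] unfolding lin_less_def by blast
qed

lemma lop_continuous:
  assumes "lop Z s f"
  shows "continuous_map (lin_topology Z s) (lin_topology Z s) f"
proof -
  have bij: "bij_betw f Z Z" using assms by (simp add: lop_def)
  show ?thesis
    unfolding lin_topology_def[of Z s] continuous_on_generated_topo_iff
    unfolding lin_topology_def[of Z s, symmetric] topspace_lin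
  proof (intro conjI allI impI)
    fix U assume "U \<in> {{x\<in>Z. a \<sqsubset> x} |a. a \<in> Z} \<union> {{x\<in>Z. x \<sqsubset> a} |a. a \<in> Z} \<union> {Z}"
    then consider a where "a \<in> Z" "U = {x\<in>Z. a \<sqsubset> x}" | a where "a \<in> Z" "U = {x\<in>Z. x \<sqsubset> a}" | "U = Z"
      by blast
    then show "openin (lin_topology Z s) (f -` U \<inter> Z)"
    proof cases
      case 1
      then obtain b where b: "b \<in> Z" "a = f b" using bij unfolding bij_betw_def by blast
      have "f -` U \<inter> Z = {x\<in>Z. b \<sqsubset> x}"
        using 1 b lop_lt_iff[OF assms b(1)] bij unfolding bij_betw_def by auto
      then show ?thesis using openin_upper_ray[OF b(1)] by simp
    next
      case 2
      then obtain b where b: "b \<in> Z" "a = f b" using bij unfolding bij_betw_def by blast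
      have "f -` U \<inter> Z = {x\<in>Z. x \<sqsubset> b}"
        using 2 b lop_lt_iff[OF assms _ b(1)] bij unfolding bij_betw_def by auto
      then show ?thesis using openin_lower_ray[OF b(1)] by simp
    next
      case 3
      have "f -` Z \<inter> Z = topspace (lin_topology Z s)"
        using bij unfolding topspace_lin bij_betw_def by auto
      then show ?thesis unfolding 3 by (metis openin_topspace)
    qed
  next
    show "f ` Z \<subseteq> \<Union>({{x\<in>Z. a \<sqsubset> x} |a. a \<in> Z} \<union> {{x\<in>Z. x \<sqsubset> a} |a. a \<in> Z} \<union> {Z})"
      using bij unfolding bij_betw_def by auto
  qed
qed

lemma lop_inverse:
  assumes "f \<in> Bij Z" "lop Z s f"
  shows "lop Z s (\<lambda>x\<in>Z. inv_into Z f x)"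
proof -
  have bij: "bij_betw f Z Z" using assms by (simp add: lop_def)
  have inv: "((\<lambda>x\<in>Z. inv_into Z f x) a, (\<lambda>x\<in>Z. inv_into Z f x) b) \<in> s" if ab: "(a, b) \<in> s" for a b
  proof -
    have "a \<in> Z" "b \<in> Z" using s_mem[OF ab] by auto
    moreover from this have "inv_into Z f a \<in> Z" "inv_into Z f b \<in> Z" "f (inv_into Z f a) = a" "f (inv_into Z f b) = b"
      using bij by (auto simp: bij_betw_def inv_into_into f_inv_into_f)
    ultimately show ?thesis
      using lop_iff[OF assms(2), of "inv_into Z f a" "inv_into Z f b"] ab by simp
  qed
  have "bij_betw (\<lambda>x\<in>Z. inv_into Z f x) Z Z"
    using restrict_inv_into_Bij[OF assms(1)] by (simp add: Bij_def)
  with inv show ?thesis unfolding lop_def by blast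
qed

lemma subgroup_lop: "subgroup {f \<in> Bij Z. lop Z s f} (BijGroup Z)"
proof (rule group.subgroupI[OF group_BijGroup])
  show "{f \<in> Bij Z. lop Z s f} \<noteq> {}"
  proof -
    have "lop Z s (\<lambda>x\<in>Z. x)"
      using id_Bij[of Z] s_mem unfolding lop_def Bij_def by auto
    then show ?thesis using id_Bij by blast
  qed
  fix f assume f: "f \<in> {f \<in> Bij Z. lop Z s f}"
  then show "inv\<^bsub>BijGroup Z\<^esub> f \<in> {f \<in> Bij Z. lop Z s f}"
    using lop_inverse[of f] restrict_inv_into_Bij[of f Z] inv_BijGroup[of f Z] by auto
  fix g assume g: "g \<in> {f \<in> Bij Z. lop Z s f}"
  have "compose Z f g \<in> Bij Z" using f g compose_Bij by blast
  moreover have "(compose Z f g a, compose Z f g b) \<in> s" if "(a, b) \<in> s" for a b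
    using f g that s_mem[OF that] by (simp add: compose_def lop_def)
  ultimately show "f \<otimes>\<^bsub>BijGroup Z\<^esub> g \<in> {f \<in> Bij Z. lop Z s f}"
    using f g by (simp add: BijGroup_def lop_def Bij_def)
qed (auto simp: BijGroup_def)

lemma subgroup_BijGroup:
  assumes "subgroup H (lop_group Z s)"
  shows "subgroup H (BijGroup Z)"
  by (rule group.incl_subgroup[OF group_BijGroup subgroup_lop])
    (use assms in \<open>simp add: lop_group_def\<close>)

end

subsection \<open>The Dedekind compactification\<close>

context linear_order_set
begin

abbreviation "j \<equiv> lin_embed s"
abbreviation "D \<equiv> dedekind_points Z s"
abbreviation "K \<equiv> dedekind_topology Z s"

lemma mem_embed_iff: "y \<in> j x \<longleftrightarrow> (y, x) \<in> s"
  by (simp add: lin_embed_def)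

lemma embed_mem: "x \<in> Z \<Longrightarrow> j x \<in> D"
  by (simp add: dedekind_points_def)

lemma embed_subset_iff: "x \<in> Z \<Longrightarrow> j x \<subseteq> j y \<longleftrightarrow> (x, y) \<in> s"
  using s_refl s_trans unfolding lin_embed_def by blast

lemma embed_psubset_iff: "x \<in> Z \<Longrightarrow> y \<in> Z \<Longrightarrow> j x \<subset> j y \<longleftrightarrow> x \<sqsubset> y"
  unfolding psubset_eq using embed_subset_iff s_antisym s_refl unfolding lin_less_def by blast

lemma inj_embed: "inj_on j Z"
  using embed_subset_iff s_antisym by (metis inj_onI order_refl)

lemma dedekind_subset: "A \<in> D \<Longrightarrow> A \<subseteq> Z"
  using s_mem unfolding dedekind_points_def lin_gap_def lin_embed_def by blast

lemma dedekind_down: "A \<in> D \<Longrightarrow> x \<in> A \<Longrightarrow> (y, x) \<in> s \<Longrightarrow> y \<in> A"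
  using s_trans unfolding dedekind_points_def lin_gap_def lin_embed_def by blast

lemma dedekind_cases:
  assumes "A \<in> D"
  obtains x where "x \<in> Z" "A = j x" | "lin_gap Z s A"
  using assms unfolding dedekind_points_def by blast

lemma dedekind_total:
  assumes "A \<in> D" "B \<in> D"
  shows "A \<subseteq> B \<or> B \<subseteq> A"
proof (rule ccontr)
  assume "\<not> (A \<subseteq> B \<or> B \<subseteq> A)"
  then obtain x y where xy: "x \<in> A" "x \<notin> B" "y \<in> B" "y \<notin> A" by blast
  then have "(x, y) \<in> s \<or> (y, x) \<in> s" using assms dedekind_subset s_total by blast
  then show False
    using xy dedekind_down[OF assms(1) xy(1)] dedekind_down[OF assms(2) xy(3)] by blast
qed

lemma mem_dedekind_iff: "A \<in> D \<Longrightarrow> x \<in> Z \<Longrightarrow> x \<in> A \<longleftrightarrow> j x \<subseteq> A"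
  using dedekind_down s_refl unfolding lin_embed_def by blast

lemma linear_dedekind: "linear_order_on D (dedekind_order Z s)"
  unfolding linear_order_on_def partial_order_on_def preorder_on_def
proof (intro conjI)
  show "trans (dedekind_order Z s)"
    unfolding dedekind_order_def by (rule transI) auto
  show "antisym (dedekind_order Z s)"
    unfolding dedekind_order_def by (rule antisymI) auto
  show "total_on D (dedekind_order Z s)"
    unfolding dedekind_order_def total_on_def using dedekind_total by simp
  show "refl_on D (dedekind_order Z s)"
    unfolding dedekind_order_def by (rule refl_onI) simp
qed (auto simp: dedekind_order_def)

lemma dedekind_less_iff:
  "lin_less (dedekind_order Z s) A B \<longleftrightarrow> A \<in> D \<and> B \<in> D \<and> A \<subset> B"
  unfolding lin_less_def dedekind_order_def by auto

section \<open>The interval topology of the Dedekind compactification\<close>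

interpretation D: linear_order_set D "dedekind_order Z s"
  by unfold_locales (rule linear_dedekind)

lemma topspace_dedekind: "topspace K = D"
  unfolding dedekind_topology_def by (rule D.topspace_lin)

lemma openin_dedekind_above: "P \<in> D \<Longrightarrow> openin K {L\<in>D. P \<subset> L}"
  using D.openin_upper_ray[of P] unfolding dedekind_topology_def dedekind_less_iff by simp

lemma openin_dedekind_below: "P \<in> D \<Longrightarrow> openin K {L\<in>D. L \<subset> P}"
  using D.openin_lower_ray[of P] unfolding dedekind_topology_def dedekind_less_iff by simp

lemma dedekind_topology_eq:
  "K = topology_generated_by ({{L\<in>D. P \<subset> L} |P. P \<in> D} \<union> {{L\<in>D. L \<subset> P} |P. P \<in> D} \<union> {D})"
proof -
  have "{x\<in>D. lin_less (dedekind_order Z s) P x} = {L\<in>D. P \<subset> L}"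
      "{x\<in>D. lin_less (dedekind_order Z s) x P} = {L\<in>D. L \<subset> P}" if "P \<in> D" for P
    using that unfolding dedekind_less_iff by auto
  then have "{{x\<in>D. lin_less (dedekind_order Z s) P x} |P. P \<in> D} = {{L\<in>D. P \<subset> L} |P. P \<in> D}"
      "{{x\<in>D. lin_less (dedekind_order Z s) x P} |P. P \<in> D} = {{L\<in>D. L \<subset> P} |P. P \<in> D}"
    by (metis (lifting))+
  then show ?thesis unfolding dedekind_topology_def lin_topology_def by simp
qed

text \<open>Any \<open>y\<close> in \<open>L - P\<close> works: \<open>y \<notin> P\<close> gives
  \<open>P \<subset> j y\<close>, and a gap has no greatest element, so \<open>L\<close> is not
  \<open>j y\<close>.\<close>

lemma gap_between_right:
  assumes "P \<in> D" "L \<in> D" "P \<subset> L" "lin_gap Z s L"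
  obtains c where "c \<in> Z" "P \<subset> j c" "j c \<subset> L"
proof -
  obtain y where y: "y \<in> L" "y \<notin> P" using assms(3) by blast
  have yZ: "y \<in> Z" using y assms(2) dedekind_subset by blast
  have "P \<subseteq> j y"
  proof
    fix x assume x: "x \<in> P"
    then have "x \<in> Z" using assms(1) dedekind_subset by blast
    then have "(x, y) \<in> s \<or> (y, x) \<in> s" using yZ s_total by blast
    then show "x \<in> j y" using dedekind_down[OF assms(1) x, of y] y(2) mem_embed_iff by blast
  qed
  moreover have "y \<in> j y" using yZ s_refl mem_embed_iff by blast
  ultimately have "P \<subset> j y" using y(2) by blast
  moreover have "j y \<subseteq> L" using mem_dedekind_iff[OF assms(2) yZ] y(1) by blast
  moreover have "j y \<noteq> L"
    using assms(4) y(1) mem_embed_iff unfolding lin_gap_def by blast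
  ultimately show ?thesis using that yZ by blast
qed

text \<open>Here \<open>y\<close> in \<open>L - P\<close> may be the first point of \<open>L\<close>
  in disguise, so a smaller \<open>y'\<close> outside \<open>P\<close> is taken, which exists
  because the complement of a gap has no least element; then \<open>y\<close> witnesses that
  \<open>j y'\<close> is strictly below \<open>L\<close>.\<close>

lemma gap_between_left:
  assumes "P \<in> D" "L \<in> D" "P \<subset> L" "lin_gap Z s P"
  obtains c where "c \<in> Z" "P \<subset> j c" "j c \<subset> L"
proof -
  obtain y where y: "y \<in> L" "y \<notin> P" using assms(3) by blast
  have yZ: "y \<in> Z" using y assms(2) dedekind_subset by blast
  obtain y' where y': "y' \<in> Z" "y' \<notin> P" "(y, y') \<notin> s"
    using assms(4) yZ y(2) unfolding lin_gap_def by blast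
  have "(y', y) \<in> s" using y' yZ s_total by blast
  have "P \<subseteq> j y'"
  proof
    fix x assume x: "x \<in> P"
    then have "x \<in> Z" using assms(1) dedekind_subset by blast
    then have "(x, y') \<in> s \<or> (y', x) \<in> s" using y'(1) s_total by blast
    then show "x \<in> j y'" using dedekind_down[OF assms(1) x, of y'] y'(2) mem_embed_iff by blast
  qed
  moreover have "y' \<in> j y'" using y'(1) s_refl mem_embed_iff by blast
  ultimately have "P \<subset> j y'" using y'(2) by blast
  moreover have "j y' \<subseteq> L"
    using mem_dedekind_iff[OF assms(2) y'(1)] dedekind_down[OF assms(2) y(1) \<open>(y', y) \<in> s\<close>] by blast
  moreover have "y \<notin> j y'" using y'(3) mem_embed_iff by blast
  ultimately show ?thesis using that y'(1) y(1) by blast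
qed

text \<open>Moves the end of a ray into \<open>Z\<close> without losing \<open>L\<close>: the end
  point stays if it is a point, and is replaced by a point in between if it is a gap. The next lemma
  is the dual.\<close>

lemma dedekind_bound_above:
  assumes "P \<in> D" "L \<in> D" "P \<subset> L"
  obtains c where "c \<in> Z" "P \<subseteq> j c" "j c \<subset> L"
  using assms(1)
proof (cases rule: dedekind_cases)
  case (1 x)
  then show ?thesis using that[of x] assms by blast
next
  case 2
  show ?thesis by (rule gap_between_left[OF assms 2], rule that) auto
qed

lemma dedekind_bound_below:
  assumes "P \<in> D" "L \<in> D" "P \<subset> L"
  obtains c where "c \<in> Z" "P \<subset> j c" "j c \<subseteq> L"
  using assms(2)
proof (cases rule: dedekind_cases)
  case (1 x)
  then show ?thesis using that[of x] assms by blast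
next
  case 2
  show ?thesis by (rule gap_between_right[OF assms 2], rule that) auto
qed

text \<open>Suppose the intersection \<open>A\<close> is not in \<open>S\<close>. If it has a
  greatest element \<open>x\<close>, it is \<open>j x\<close>. Otherwise it is a gap: a least
  element of the complement would be omitted by some \<open>B \<in> S\<close>, whence
  \<open>B \<subseteq> A\<close> and \<open>A = B\<close>. Intersecting with \<open>Z\<close> gives
  the empty family the top element \<open>Z\<close>.\<close>

lemma dedekind_Inter:
  assumes "S \<subseteq> D" "Z \<noteq> {}"
  shows "Z \<inter> \<Inter>S \<in> D"
proof (cases "Z \<inter> \<Inter>S \<in> S")
  case True
  then show ?thesis using assms(1) by blast
next
  case notin: False
  define A where "A = Z \<inter> \<Inter>S"
  have down: "\<forall>x\<in>A. \<forall>y. (y, x) \<in> s \<longrightarrow> y \<in> A"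
    unfolding A_def using dedekind_down assms(1) s_mem by blast
  show ?thesis
  proof (cases "\<exists>x\<in>A. \<forall>y\<in>A. (y, x) \<in> s")
    case True
    then obtain x where x: "x \<in> A" "\<forall>y\<in>A. (y, x) \<in> s" by blast
    then have "A = j x" using down unfolding lin_embed_def by blast
    then show ?thesis using embed_mem x(1) unfolding A_def by auto
  next
    case False
    have "\<not> (\<exists>x\<in>Z - A. \<forall>y\<in>Z - A. (x, y) \<in> s)"
    proof
      assume "\<exists>x\<in>Z - A. \<forall>y\<in>Z - A. (x, y) \<in> s"
      then obtain x where x: "x \<in> Z" "x \<notin> A" "\<forall>y\<in>Z - A. (x, y) \<in> s" by blast
      then obtain B where B: "B \<in> S" "x \<notin> B" unfolding A_def by blast
      have "B \<subseteq> A"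
      proof
        fix y assume y: "y \<in> B"
        then have "y \<in> Z" using B(1) assms(1) dedekind_subset by blast
        moreover have "(x, y) \<notin> s" using B y dedekind_down assms(1) by blast
        ultimately show "y \<in> A" using x(3) by blast
      qed
      then have "A = B" using B(1) assms(1) dedekind_subset unfolding A_def by blast
      then show False using notin B(1) unfolding A_def by blast
    qed
    then have "lin_gap Z s A"
      unfolding lin_gap_def using assms(2) down False unfolding A_def by blast
    then show ?thesis unfolding A_def dedekind_points_def by blast
  qed
qed

lemma compact_dedekind: "compact_space K"
\<comment> \<open>\<open>compact_lin\<close> demands a supremum of the empty set as well, hence at
  least one point.\<close>
proof (cases "Z = {}")
  case True
  then have "topspace K = {}"
    unfolding topspace_dedekind dedekind_points_def lin_gap_def by blast
  then show ?thesis by (simp add: compact_space_def)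
next
  case False
  show ?thesis
    unfolding dedekind_topology_def
  proof (rule D.compact_lin)
    fix S assume S: "S \<subseteq> D"
    \<comment> \<open>The union of \<open>S\<close> need not be a point, for instance when its
      complement has a least element; the intersection of all upper bounds always is one.\<close>
    let ?u = "Z \<inter> \<Inter>{B\<in>D. \<forall>A\<in>S. A \<subseteq> B}"
    have "?u \<in> D" by (rule dedekind_Inter[OF _ False]) blast
    moreover have "\<forall>A\<in>S. A \<subseteq> ?u" using S dedekind_subset by blast
    ultimately show "\<exists>u\<in>D. (\<forall>x\<in>S. (x, u) \<in> dedekind_order Z s) \<and>
        (\<forall>v\<in>D. (\<forall>x\<in>S. (x, v) \<in> dedekind_order Z s) \<longrightarrow> (u, v) \<in> dedekind_order Z s)"
      unfolding dedekind_order_def using S by (intro bexI[of _ ?u]) auto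
  qed
qed

lemma Hausdorff_dedekind: "Hausdorff_space K"
  unfolding dedekind_topology_def by (rule D.Hausdorff_lin)

text \<open>Intervals with ends in \<open>Z\<close>; \<open>None\<close> is a missing end, so that
  rays and the whole of \<open>D\<close> are treated together with bounded intervals.\<close>

definition dint :: "'c option \<Rightarrow> 'c option \<Rightarrow> 'c set set" where
  "dint a b = {L\<in>D. (\<forall>x. a = Some x \<longrightarrow> j x \<subset> L) \<and> (\<forall>x. b = Some x \<longrightarrow> L \<subset> j x)}"

text \<open>Ends of subbasic rays can be moved into \<open>Z\<close> by the two bounding lemmas, and
  such intervals around \<open>L\<close> are stable under finite intersections.\<close>

lemma dedekind_interval_base:
  assumes "openin K W" "L \<in> W"
  obtains a b where "set_option a \<subseteq> Z" "set_option b \<subseteq> Z" "L \<in> dint a b" "dint a b \<subseteq> W"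
proof -
  have LD: "L \<in> D" using openin_subset[OF assms(1)] assms(2) topspace_dedekind by blast
  define Q where "Q W \<longleftrightarrow> (\<exists>a b. set_option a \<subseteq> Z \<and> set_option b \<subseteq> Z \<and> L \<in> dint a b \<and> dint a b \<subseteq> W)" for W
  have "Q W"
  proof (rule openin_generated_local[of _ W L Q, OF assms(1)[unfolded dedekind_topology_eq] assms(2)])
    fix W assume "W \<in> {{L\<in>D. P \<subset> L} |P. P \<in> D} \<union> {{L\<in>D. L \<subset> P} |P. P \<in> D} \<union> {D}" and LW: "L \<in> W"
    then consider P where "P \<in> D" "W = {L\<in>D. P \<subset> L}" | P where "P \<in> D" "W = {L\<in>D. L \<subset> P}" | "W = D"
      by blast
    then show "Q W"
    proof cases
      case 1
      obtain c where c: "c \<in> Z" "P \<subseteq> j c" "j c \<subset> L" using dedekind_bound_above[of P L] 1 LW by blast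
      then have "L \<in> dint (Some c) None" "dint (Some c) None \<subseteq> W"
        using LD 1 by (auto simp: dint_def)
      then show ?thesis unfolding Q_def using c by (intro exI[of _ "Some c"] exI[of _ None]) simp
    next
      case 2
      obtain c where c: "c \<in> Z" "L \<subset> j c" "j c \<subseteq> P" using dedekind_bound_below[of L P] 2 LW by blast
      then have "L \<in> dint None (Some c)" "dint None (Some c) \<subseteq> W"
        using LD 2 by (auto simp: dint_def)
      then show ?thesis unfolding Q_def using c by (intro exI[of _ None] exI[of _ "Some c"]) simp
    next
      case 3
      then show ?thesis unfolding Q_def using LD
        by (intro exI[of _ None]) (simp add: dint_def)
    qed
  next
    fix A B assume "Q A" "Q B"
    then obtain a b a' b' where ab: "set_option a \<subseteq> Z" "set_option b \<subseteq> Z" "L \<in> dint a b" "dint a b \<subseteq> A"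
      "set_option a' \<subseteq> Z" "set_option b' \<subseteq> Z" "L \<in> dint a' b'" "dint a' b' \<subseteq> B"
      unfolding Q_def by blast
    \<comment> \<open>The left end of the intersection is the larger of the two left ends; below,
      its right end is the smaller of the two right ends.\<close>
    have "\<exists>a''. set_option a'' \<subseteq> Z \<and> (\<forall>M\<in>D. (\<forall>x. a'' = Some x \<longrightarrow> j x \<subset> M) \<longleftrightarrow>
        (\<forall>x. a = Some x \<longrightarrow> j x \<subset> M) \<and> (\<forall>x. a' = Some x \<longrightarrow> j x \<subset> M))"
    proof (cases a; cases a')
      fix x x' assume a: "a = Some x" "a' = Some x'"
      then have "j x \<subseteq> j x' \<or> j x' \<subseteq> j x" using ab dedekind_total embed_mem by simp
      then show ?thesis
        using a ab(1,5) by (elim disjE) (intro exI[of _ a'] exI[of _ a]; auto)+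
    qed (intro exI[of _ a'] exI[of _ a]; use ab in auto)+
    moreover have "\<exists>b''. set_option b'' \<subseteq> Z \<and> (\<forall>M\<in>D. (\<forall>x. b'' = Some x \<longrightarrow> M \<subset> j x) \<longleftrightarrow>
        (\<forall>x. b = Some x \<longrightarrow> M \<subset> j x) \<and> (\<forall>x. b' = Some x \<longrightarrow> M \<subset> j x))"
    proof (cases b; cases b')
      fix x x' assume a: "b = Some x" "b' = Some x'"
      then have "j x \<subseteq> j x' \<or> j x' \<subseteq> j x" using ab dedekind_total embed_mem by simp
      then show ?thesis
        using a ab(2,6) by (elim disjE) (intro exI[of _ b] exI[of _ b']; auto)+
    qed (intro exI[of _ b'] exI[of _ b]; use ab in auto)+
    ultimately obtain a'' b'' where ab'': "set_option a'' \<subseteq> Z" "set_option b'' \<subseteq> Z"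
        "\<forall>M\<in>D. (\<forall>x. a'' = Some x \<longrightarrow> j x \<subset> M) \<longleftrightarrow>
          (\<forall>x. a = Some x \<longrightarrow> j x \<subset> M) \<and> (\<forall>x. a' = Some x \<longrightarrow> j x \<subset> M)"
        "\<forall>M\<in>D. (\<forall>x. b'' = Some x \<longrightarrow> M \<subset> j x) \<longleftrightarrow>
          (\<forall>x. b = Some x \<longrightarrow> M \<subset> j x) \<and> (\<forall>x. b' = Some x \<longrightarrow> M \<subset> j x)"
      by (elim exE conjE) rule
    have "M \<in> dint a'' b'' \<longleftrightarrow> M \<in> dint a b \<inter> dint a' b'" for M
    proof (cases "M \<in> D")
      case True
      show ?thesis
        unfolding dint_def Int_iff mem_Collect_eq ab''(3)[rule_format, OF True]
          ab''(4)[rule_format, OF True] by blast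
    qed (simp add: dint_def)
    then have "dint a'' b'' = dint a b \<inter> dint a' b'" by blast
    with ab''(1,2) show "Q (A \<inter> B)" unfolding Q_def using ab by blast
  next
    fix A B assume "Q A" "A \<subseteq> B"
    then show "Q B" unfolding Q_def by blast
  qed
  then show ?thesis using that unfolding Q_def by blast
qed

lemma openin_dint:
  assumes "set_option a \<subseteq> Z" "set_option b \<subseteq> Z"
  shows "openin K (dint a b)"
proof -
  have "openin K {L\<in>D. \<forall>x. a = Some x \<longrightarrow> j x \<subset> L}"
    using assms openin_dedekind_above embed_mem openin_topspace[of K] unfolding topspace_dedekind
    by (cases a) auto
  moreover have "openin K {L\<in>D. \<forall>x. b = Some x \<longrightarrow> L \<subset> j x}"
    using assms openin_dedekind_below embed_mem openin_topspace[of K] unfolding topspace_dedekind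
    by (cases b) auto
  moreover have "dint a b = {L\<in>D. \<forall>x. a = Some x \<longrightarrow> j x \<subset> L} \<inter> {L\<in>D. \<forall>x. b = Some x \<longrightarrow> L \<subset> j x}"
    unfolding dint_def by blast
  ultimately show ?thesis by (simp add: openin_Int)
qed

text \<open>Only a gap \<open>L\<close> needs an argument. If it is nonempty it has no greatest
  element, so points beyond the left end of the interval lie just below it; being below
  \<open>L\<close> they also respect the right end.\<close>

lemma dense_dedekind: "Abstract_Topology.closure_of K (j ` Z) = topspace K"
  unfolding dense_intersects_open
proof (intro allI impI)
  fix W assume "openin K W \<and> W \<noteq> {}"
  then obtain L where W: "openin K W" "L \<in> W" by blast
  then have LD: "L \<in> D" using openin_subset topspace_dedekind by blast
  obtain a b where ab: "set_option a \<subseteq> Z" "set_option b \<subseteq> Z" "L \<in> dint a b" "dint a b \<subseteq> W"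
    using dedekind_interval_base[OF W] by blast
  have "\<exists>c\<in>Z. j c \<in> dint a b"
    using LD
  proof (cases rule: dedekind_cases)
    case (1 x)
    then show ?thesis using ab by blast
  next
    case gap: 2
    then have "Z \<noteq> {}" unfolding lin_gap_def by blast
    show ?thesis
    \<comment> \<open>The gap at the left end of \<open>Z\<close> has nothing below it and is
      approached from above; no interval around it has a left end.\<close>
    proof (cases "L = {}")
      case False
      have "\<exists>c\<in>Z. j c \<subset> L \<and> (\<forall>x. a = Some x \<longrightarrow> j x \<subset> j c)"
      proof (cases a)
        case None
        obtain y where y: "y \<in> L" using False by blast
        then have yZ: "y \<in> Z" using LD dedekind_subset by blast
        have "j y \<subseteq> L" using mem_dedekind_iff[OF LD yZ] y by blast
        moreover have "j y \<noteq> L" using gap y mem_embed_iff unfolding lin_gap_def by blast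
        ultimately show ?thesis using None yZ by blast
      next
        case (Some x)
        then have "x \<in> Z" "j x \<subset> L" using ab by (auto simp: dint_def)
        then obtain c where "c \<in> Z" "j x \<subset> j c" "j c \<subset> L"
          using gap_between_right[OF embed_mem LD _ gap] by blast
        then show ?thesis using Some by blast
      qed
      then obtain c where c: "c \<in> Z" "j c \<subset> L" "\<forall>x. a = Some x \<longrightarrow> j x \<subset> j c" by blast
      then have "j c \<in> dint a b" using ab(3) embed_mem unfolding dint_def by blast
      then show ?thesis using c by blast
    next
      case True
      have a: "a = None" using ab(3) True by (cases a) (auto simp: dint_def)
      show ?thesis
      proof (cases b)
        case None
        then show ?thesis using a \<open>Z \<noteq> {}\<close> embed_mem unfolding dint_def by auto
      next
        case (Some x)
        then have "x \<in> Z" "L \<subset> j x" using ab by (auto simp: dint_def)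
        then obtain c where "c \<in> Z" "L \<subset> j c" "j c \<subset> j x"
          using gap_between_left[OF LD embed_mem _ gap] by blast
        then show ?thesis using Some a embed_mem unfolding dint_def by auto
      qed
    qed
  qed
  then show "j ` Z \<inter> W \<noteq> {}" using ab(4) by blast
qed

text \<open>For a gap \<open>P\<close> the complement has no least element, so the trace is the
  union of the open rays above the points outside \<open>P\<close>. Dually,
  \<open>openin_trace_below\<close> uses that a gap has no greatest element.\<close>

lemma openin_trace_above:
  assumes "P \<in> D"
  shows "openin (lin_topology Z s) {x\<in>Z. P \<subset> j x}"
  using assms
proof (cases rule: dedekind_cases)
  case (1 p)
  then show ?thesis using openin_upper_ray embed_psubset_iff by (simp cong: conj_cong)
next
  case 2
  have eq: "{x\<in>Z. P \<subset> j x} = \<Union>((\<lambda>c. {x\<in>Z. c \<sqsubset> x}) ` (Z - P))" (is "?l = ?r")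
  proof
    show "?l \<subseteq> ?r"
    proof
      fix x assume "x \<in> ?l"
      then obtain c where "c \<in> Z" "P \<subset> j c" "j c \<subset> j x" "x \<in> Z"
        using gap_between_left[OF assms embed_mem _ 2] by blast
      moreover have "c \<notin> P" using calculation mem_dedekind_iff[OF assms] by blast
      ultimately show "x \<in> ?r" using embed_psubset_iff by blast
    qed
    show "?r \<subseteq> ?l"
    proof
      fix x assume "x \<in> ?r"
      then obtain c where c: "c \<in> Z" "c \<notin> P" "x \<in> Z" "c \<sqsubset> x" by blast
      have "P \<subseteq> j c" using dedekind_total[OF assms embed_mem[OF c(1)]]
        mem_dedekind_iff[OF assms c(1)] c(2) by blast
      then show "x \<in> ?l" using c embed_psubset_iff by blast
    qed
  qed
  show ?thesis unfolding eq by (rule openin_Union) (use openin_upper_ray in blast)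
qed

lemma openin_trace_below:
  assumes "P \<in> D"
  shows "openin (lin_topology Z s) {x\<in>Z. j x \<subset> P}"
  using assms
proof (cases rule: dedekind_cases)
  case (1 p)
  then show ?thesis using openin_lower_ray embed_psubset_iff by (simp cong: conj_cong)
next
  case 2
  have PZ: "P \<subseteq> Z" using assms by (rule dedekind_subset)
  have eq: "{x\<in>Z. j x \<subset> P} = \<Union>((\<lambda>c. {x\<in>Z. x \<sqsubset> c}) ` P)" (is "?l = ?r")
  proof
    show "?l \<subseteq> ?r"
    proof
      fix x assume "x \<in> ?l"
      then obtain c where "c \<in> Z" "j x \<subset> j c" "j c \<subset> P" "x \<in> Z"
        using gap_between_right[OF embed_mem assms _ 2] by blast
      moreover have "c \<in> P" using calculation mem_dedekind_iff[OF assms] by blast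
      ultimately show "x \<in> ?r" using embed_psubset_iff by blast
    qed
    show "?r \<subseteq> ?l"
    proof
      fix x assume "x \<in> ?r"
      then obtain c where c: "c \<in> P" "x \<in> Z" "x \<sqsubset> c" by blast
      have "j c \<subseteq> P" using mem_dedekind_iff[OF assms] c(1) PZ by blast
      then show "x \<in> ?l" using c embed_psubset_iff PZ by blast
    qed
  qed
  show ?thesis unfolding eq by (rule openin_Union) (use openin_lower_ray PZ in blast)
qed

text \<open>The rays of \<open>Z\<close> are the traces of the rays of \<open>D\<close> with the
  same end. The other inclusion is the continuity of \<open>j\<close>, where rays of
  \<open>D\<close> ending at gaps must also have open traces.\<close>

lemma lin_topology_eq_pullback: "lin_topology Z s = pullback_topology Z j K"
proof -
  have "continuous_map (lin_topology Z s) K j"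
    unfolding dedekind_topology_eq
  proof (rule continuous_on_generated_topo)
    fix U assume "U \<in> {{L\<in>D. P \<subset> L} |P. P \<in> D} \<union> {{L\<in>D. L \<subset> P} |P. P \<in> D} \<union> {D}"
    then consider P where "P \<in> D" "U = {L\<in>D. P \<subset> L}" | P where "P \<in> D" "U = {L\<in>D. L \<subset> P}" | "U = D"
      by blast
    then show "openin (lin_topology Z s) (j -` U \<inter> topspace (lin_topology Z s))"
    proof cases
      case 1
      then have "j -` U \<inter> topspace (lin_topology Z s) = {x\<in>Z. P \<subset> j x}"
        using embed_mem topspace_lin by auto
      then show ?thesis using openin_trace_above[OF 1(1)] by simp
    next
      case 2
      then have "j -` U \<inter> topspace (lin_topology Z s) = {x\<in>Z. j x \<subset> P}"
        using embed_mem topspace_lin by auto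
      then show ?thesis using openin_trace_below[OF 2(1)] by simp
    next
      case 3
      then have "j -` U \<inter> topspace (lin_topology Z s) = topspace (lin_topology Z s)"
        using embed_mem topspace_lin by auto
      then show ?thesis by simp
    qed
  qed (use embed_mem topspace_lin in auto)
  then have 1: "openin (lin_topology Z s) U" if "openin (pullback_topology Z j K) U" for U
  proof -
    obtain W where "openin K W" "U = {x\<in>Z. j x \<in> W}"
      using \<open>openin (pullback_topology Z j K) U\<close> unfolding openin_pullback_iff by blast
    then show ?thesis
      using openin_continuous_map_preimage[OF \<open>continuous_map (lin_topology Z s) K j\<close>] topspace_lin
      by metis
  qed
  have 2: "openin (pullback_topology Z j K) U" if "openin (lin_topology Z s) U" for U
  proof -
    have "generate_topology_on ({{x\<in>Z. a \<sqsubset> x} |a. a \<in> Z} \<union> {{x\<in>Z. x \<sqsubset> a} |a. a \<in> Z} \<union> {Z}) U"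
      using that unfolding lin_topology_def by (rule openin_topology_generated_by)
    then show ?thesis
    proof induction
      case (Basis U)
      then consider a where "a \<in> Z" "U = {x\<in>Z. a \<sqsubset> x}" | a where "a \<in> Z" "U = {x\<in>Z. x \<sqsubset> a}" | "U = Z"
        by blast
      then show ?case
        unfolding openin_pullback_iff
      proof cases
        case 1
        then have "U = {x\<in>Z. j x \<in> {L\<in>D. j a \<subset> L}}"
          by (simp add: embed_mem embed_psubset_iff cong: conj_cong)
        then show "\<exists>W. openin K W \<and> U = {x\<in>Z. j x \<in> W}"
          using openin_dedekind_above embed_mem 1(1) by blast
      next
        case 2
        then have "U = {x\<in>Z. j x \<in> {L\<in>D. L \<subset> j a}}"
          by (simp add: embed_mem embed_psubset_iff cong: conj_cong)
        then show "\<exists>W. openin K W \<and> U = {x\<in>Z. j x \<in> W}"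
          using openin_dedekind_below embed_mem 2(1) by blast
      next
        case 3
        then have "U = {x\<in>Z. j x \<in> topspace K}" using embed_mem topspace_dedekind by auto
        then show "\<exists>W. openin K W \<and> U = {x\<in>Z. j x \<in> W}" using openin_topspace by blast
      qed
    qed auto
  qed
  show ?thesis unfolding topology_eq using 1 2 by blast
qed

end

subsection \<open>The linear interval uniformity\<close>

context linear_order_set
begin

lemma openin_chain_interval:
  assumes "set as \<subseteq> Z" "i < length as"
  shows "openin K {L\<in>D. (0 < i \<longrightarrow> j (as ! (i - 1)) \<subset> L) \<and> (i + 1 < length as \<longrightarrow> L \<subset> j (as ! (i + 1)))}"
proof -
  define a b where "a = (if 0 < i then Some (as ! (i - 1)) else None)"
    and "b = (if i + 1 < length as then Some (as ! (i + 1)) else None)"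
  have "set_option a \<subseteq> Z" "set_option b \<subseteq> Z"
    using assms nth_mem[of "i - 1" as] nth_mem[of "i + 1" as] by (auto simp: a_def b_def)
  then have "openin K (dint a b)" by (rule openin_dint)
  moreover have "dint a b =
     {L\<in>D. (0 < i \<longrightarrow> j (as ! (i - 1)) \<subset> L) \<and> (i + 1 < length as \<longrightarrow> L \<subset> j (as ! (i + 1)))}"
    unfolding dint_def a_def b_def by auto
  ultimately show ?thesis by simp
qed

lemma chain_cover_eq_trace:
  assumes "set as \<subseteq> Z"
  shows "chain_cover Z s as = trace_cover Z j
     {{L\<in>D. (0 < i \<longrightarrow> j (as ! (i - 1)) \<subset> L) \<and> (i + 1 < length as \<longrightarrow> L \<subset> j (as ! (i + 1)))} |i. i < length as}"
proof -
  let ?C = "\<lambda>i. {x\<in>Z. (0 < i \<longrightarrow> as ! (i - 1) \<sqsubset> x) \<and> (i + 1 < length as \<longrightarrow> x \<sqsubset> as ! (i + 1))}"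
  let ?E = "\<lambda>i. {L\<in>D. (0 < i \<longrightarrow> j (as ! (i - 1)) \<subset> L) \<and> (i + 1 < length as \<longrightarrow> L \<subset> j (as ! (i + 1)))}"
  have "?C i = {x\<in>Z. j x \<in> ?E i}" if i: "i < length as" for i
  proof -
    have "as ! (i - 1) \<in> Z" "i + 1 < length as \<Longrightarrow> as ! (i + 1) \<in> Z"
      using i assms nth_mem[of "i - 1" as] nth_mem[of "i + 1" as] by auto
    then show ?thesis
      by (simp add: embed_mem embed_psubset_iff cong: conj_cong imp_cong)
  qed
  then have "?C ` {i. i < length as} = (\<lambda>W. {x\<in>Z. j x \<in> W}) ` ?E ` {i. i < length as}"
    unfolding image_image by (intro image_cong) auto
  moreover have "chain_cover Z s as = ?C ` {i. i < length as}"
    unfolding chain_cover_def by (rule setcompr_eq_image)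
  moreover have "{?E i |i. i < length as} = ?E ` {i. i < length as}"
    by (rule setcompr_eq_image)
  ultimately show ?thesis
    unfolding trace_cover_def by (simp only:)
qed

lemma sorted_nth_less:
  "sorted_wrt (lin_less s) as \<Longrightarrow> m < n \<Longrightarrow> n < length as \<Longrightarrow> as ! m \<sqsubset> as ! n"
  using sorted_wrt_nth_less by blast

text \<open>For \<open>L\<close> in \<open>D\<close> take the least \<open>k\<close> with
  \<open>L \<subseteq> j (as ! k)\<close>: then \<open>L\<close> is strictly above the predecessor
  and strictly below the successor of \<open>as ! k\<close>. If there is no such \<open>k\<close>,
  the last member contains \<open>L\<close>.\<close>

lemma open_cover_chain:
  assumes "set as \<subseteq> Z" "sorted_wrt (lin_less s) as" "as = [] \<longrightarrow> Z = {}"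
  shows "open_cover K
     {{L\<in>D. (0 < i \<longrightarrow> j (as ! (i - 1)) \<subset> L) \<and> (i + 1 < length as \<longrightarrow> L \<subset> j (as ! (i + 1)))} |i. i < length as}"
    (is "open_cover K ?\<W>")
  unfolding open_cover_def
proof
  show "\<forall>W\<in>?\<W>. openin K W" using openin_chain_interval[OF assms(1)] by blast
  have cov: "\<exists>W\<in>?\<W>. L \<in> W" if L: "L \<in> D" for L
  proof -
    have ne: "as \<noteq> []"
    proof
      assume "as = []"
      then have "Z = {}" using assms(3) by simp
      then show False using L unfolding dedekind_points_def lin_gap_def by blast
    qed
    have asD: "j (as ! k) \<in> D" "as ! k \<in> Z" if "k < length as" for k
      using that assms(1) nth_mem embed_mem by blast+
    have "\<exists>i<length as. (0 < i \<longrightarrow> j (as ! (i - 1)) \<subset> L) \<and> (i + 1 < length as \<longrightarrow> L \<subset> j (as ! (i + 1)))"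
    proof (cases "\<exists>k<length as. L \<subseteq> j (as ! k)")
      case True
      define k where "k = (LEAST k. k < length as \<and> L \<subseteq> j (as ! k))"
      have k: "k < length as" "L \<subseteq> j (as ! k)"
        using LeastI_ex[OF True] unfolding k_def by auto
      have "j (as ! (k - 1)) \<subset> L" if "0 < k"
      proof -
        have "\<not> L \<subseteq> j (as ! (k - 1))"
          using not_less_Least[of "k - 1" "\<lambda>k. k < length as \<and> L \<subseteq> j (as ! k)"] that k(1)
          unfolding k_def[symmetric] by auto
        moreover have "k - 1 < length as" using k(1) by simp
        ultimately show ?thesis using dedekind_total[OF L asD(1)[of "k - 1"]] by blast
      qed
      moreover have "L \<subset> j (as ! (k + 1))" if "k + 1 < length as"
      proof -
        have "j (as ! k) \<subset> j (as ! (k + 1))"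
          using embed_psubset_iff asD that k(1) sorted_nth_less[OF assms(2), of k "k + 1"] by simp
        then show ?thesis using k(2) by blast
      qed
      ultimately show ?thesis using k(1) by blast
    next
      case False
      then have gt: "j (as ! k) \<subset> L" if "k < length as" for k
        using that dedekind_total[OF L asD(1)] by blast
      show ?thesis
        using ne gt by (intro exI[of _ "length as - 1"]) auto
    qed
    then obtain i where i: "i < length as"
        "(0 < i \<longrightarrow> j (as ! (i - 1)) \<subset> L) \<and> (i + 1 < length as \<longrightarrow> L \<subset> j (as ! (i + 1)))"
      by (elim exE conjE) (rule that, assumption, rule conjI)
    show ?thesis
      by (rule bexI[of _ "{L\<in>D. (0 < i \<longrightarrow> j (as ! (i - 1)) \<subset> L) \<and>
            (i + 1 < length as \<longrightarrow> L \<subset> j (as ! (i + 1)))}"])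
        (use L i in \<open>simp_all\<close>, blast)
  qed
  show "\<Union>?\<W> = topspace K"
    unfolding topspace_dedekind
  proof
    show "D \<subseteq> \<Union>?\<W>"
    proof
      fix L assume "L \<in> D"
      from cov[OF this] show "L \<in> \<Union>?\<W>" by (rule bexE) (rule UnionI)
    qed
  qed blast
qed

text \<open>Compactness yields finitely many intervals \<open>I L\<close> with ends in
  \<open>Z\<close> that refine \<open>\<W>\<close>, and the chain consists of all their ends. The
  middle point of a chain interval lies in some \<open>I L\<close>. The ends of that
  \<open>I L\<close> belong to the chain and differ from the middle point, so they are at or beyond
  its neighbours, and the chain interval lies in \<open>I L\<close>.\<close>

lemma chain_cover_refines_trace:
  assumes W: "open_cover K \<W>"
  obtains as where "set as \<subseteq> Z" "sorted_wrt (lin_less s) as" "as = [] \<longrightarrow> Z = {}"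
    "refines (chain_cover Z s as) (trace_cover Z j \<W>)"
proof (cases "Z = {}")
  case True
  then show ?thesis using that[of "[]"] by (simp add: chain_cover_def refines_def)
next
  case False
  then obtain z0 where z0: "z0 \<in> Z" by blast
  have "\<forall>L\<in>D. \<exists>p. set_option (fst p) \<subseteq> Z \<and> set_option (snd p) \<subseteq> Z \<and> L \<in> dint (fst p) (snd p) \<and>
      (\<exists>W\<in>\<W>. dint (fst p) (snd p) \<subseteq> W)"
  proof
    fix L assume "L \<in> D"
    then obtain W where W': "W \<in> \<W>" "openin K W" "L \<in> W"
      using W topspace_dedekind unfolding open_cover_def by blast
    obtain a b where "set_option a \<subseteq> Z" "set_option b \<subseteq> Z" "L \<in> dint a b" "dint a b \<subseteq> W"
      using dedekind_interval_base[OF W'(2,3)] by blast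
    then show "\<exists>p. set_option (fst p) \<subseteq> Z \<and> set_option (snd p) \<subseteq> Z \<and> L \<in> dint (fst p) (snd p) \<and>
      (\<exists>W\<in>\<W>. dint (fst p) (snd p) \<subseteq> W)"
      using W'(1) by (intro exI[of _ "(a, b)"]) auto
  qed
  from bchoice[OF this] obtain p where p: "\<And>L. L \<in> D \<Longrightarrow> set_option (fst (p L)) \<subseteq> Z \<and>
      set_option (snd (p L)) \<subseteq> Z \<and> L \<in> dint (fst (p L)) (snd (p L)) \<and>
      (\<exists>W\<in>\<W>. dint (fst (p L)) (snd (p L)) \<subseteq> W)"
    by blast
  define I where "I L = dint (fst (p L)) (snd (p L))" for L
  note p = p[folded I_def]
  have "compactin K D" using compact_dedekind by (simp add: compact_space_def topspace_dedekind)
  moreover have "\<forall>U\<in>I ` D. openin K U" "D \<subseteq> \<Union>(I ` D)"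
    using p openin_dint unfolding I_def by auto
  ultimately have "\<exists>\<F>. finite \<F> \<and> \<F> \<subseteq> I ` D \<and> D \<subseteq> \<Union>\<F>"
    unfolding compactin_def by blast
  then obtain E where E: "finite E" "E \<subseteq> D" "D \<subseteq> \<Union>(I ` E)"
    by (metis finite_subset_image)
  \<comment> \<open>\<open>z0\<close> keeps the chain nonempty when all chosen intervals are
    unbounded on both sides.\<close>
  define F where "F = insert z0 (\<Union>L\<in>E. set_option (fst (p L)) \<union> set_option (snd (p L)))"
  have F: "finite F" "F \<subseteq> Z"
  proof -
    have "set_option (fst (p L)) \<union> set_option (snd (p L)) \<subseteq> Z" if "L \<in> E" for L
      using p[of L] that E(2) by blast
    then show "finite F" "F \<subseteq> Z" unfolding F_def using E(1) z0 by auto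
  qed
  have "\<exists>as. set as = F \<and> sorted_wrt (lin_less s) as"
    by (rule finite_sorted_list_exists[OF F(1)]) (use F(2) lt_trans lt_total in blast)+
  then obtain as where as: "set as = F" "sorted_wrt (lin_less s) as" by blast
  have mono: "(as ! m, as ! n) \<in> s" if "m \<le> n" "n < length as" for m n
  proof (cases "m = n")
    case True
    then show ?thesis using that as(1) F(2) s_refl nth_mem by blast
  next
    case False
    then show ?thesis using that sorted_nth_less[OF as(2), of m n] by (simp add: lin_less_def)
  qed
  have asZ: "as ! k \<in> Z" if "k < length as" for k using that as(1) F(2) nth_mem by blast
  have "refines (chain_cover Z s as) (trace_cover Z j \<W>)"
    unfolding refines_def
  proof
    fix A assume "A \<in> chain_cover Z s as"
    then obtain i where i: "i < length as"
        "A = {x\<in>Z. (0 < i \<longrightarrow> as ! (i - 1) \<sqsubset> x) \<and> (i + 1 < length as \<longrightarrow> x \<sqsubset> as ! (i + 1))}"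
      unfolding chain_cover_def by blast
    obtain L where L: "L \<in> E" "j (as ! i) \<in> I L"
      using E(3) embed_mem[OF asZ[OF i(1)]] by blast
    have LD: "L \<in> D" using L(1) E(2) by blast
    obtain W where W': "W \<in> \<W>" "I L \<subseteq> W" using p[OF LD] by blast
    have "A \<subseteq> {x\<in>Z. j x \<in> W}"
    proof
      fix x assume xA: "x \<in> A"
      then have xZ: "x \<in> Z" using i(2) by simp
      have "j y \<subset> j x" if y: "fst (p L) = Some y" for y
      proof -
        have "y \<in> F" unfolding F_def using L(1) y by auto
        then obtain m where m: "m < length as" "y = as ! m" using as(1) by (metis in_set_conv_nth)
        have "j y \<subset> j (as ! i)" using L(2) y unfolding I_def dint_def by simp
        then have "y \<sqsubset> as ! i" using embed_psubset_iff m asZ i(1) by blast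
        then have "m < i" using mono[of i m] m not_lt asZ i(1) by (metis not_less)
        then have "(y, as ! (i - 1)) \<in> s" "as ! (i - 1) \<sqsubset> x"
          using mono[of m "i - 1"] m xA i by auto
        then have "y \<sqsubset> x" by (rule le_lt_trans)
        then show ?thesis using embed_psubset_iff lt_mem by blast
      qed
      moreover have "j x \<subset> j y" if y: "snd (p L) = Some y" for y
      proof -
        have "y \<in> F" unfolding F_def using L(1) y by auto
        then obtain m where m: "m < length as" "y = as ! m" using as(1) by (metis in_set_conv_nth)
        have "j (as ! i) \<subset> j y" using L(2) y unfolding I_def dint_def by simp
        then have "as ! i \<sqsubset> y" using embed_psubset_iff m asZ i(1) by blast
        then have "i < m" using mono[of m i] m not_lt asZ i(1) by (metis not_less)
        then have "(as ! (i + 1), y) \<in> s" "x \<sqsubset> as ! (i + 1)"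
          using mono[of "i + 1" m] m xA i by auto
        then have "x \<sqsubset> y" using lt_le_trans by blast
        then show ?thesis using embed_psubset_iff lt_mem by blast
      qed
      ultimately have "j x \<in> I L" using embed_mem[OF xZ] unfolding I_def dint_def by blast
      then show "x \<in> {x\<in>Z. j x \<in> W}" using W'(2) xZ by blast
    qed
    then show "\<exists>B\<in>trace_cover Z j \<W>. A \<subseteq> B" using W'(1) unfolding trace_cover_def by blast
  qed
  moreover have "set as \<subseteq> Z" using as(1) F(2) by simp
  moreover have "as \<noteq> []" using as(1) unfolding F_def by auto
  ultimately show ?thesis using that as(2) by blast
qed

lemma lin_uniformity_eq_induced: "lin_uniformity Z s = induced_uniformity Z K j"
proof (intro Set.set_eqI iffI)
  fix \<C> assume "\<C> \<in> lin_uniformity Z s"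
  then obtain as where as: "\<Union>\<C> = Z" "set as \<subseteq> Z" "sorted_wrt (lin_less s) as" "as = [] \<longrightarrow> Z = {}"
      "refines (chain_cover Z s as) \<C>"
    unfolding lin_uniformity_def uniformity_with_base_def by blast
  then show "\<C> \<in> induced_uniformity Z K j"
    unfolding mem_induced_uniformity_iff chain_cover_eq_trace[OF as(2)]
    using open_cover_chain[OF as(2-4)] by blast
next
  fix \<C> assume "\<C> \<in> induced_uniformity Z K j"
  then obtain \<W> where W: "\<Union>\<C> = Z" "open_cover K \<W>" "refines (trace_cover Z j \<W>) \<C>"
    unfolding mem_induced_uniformity_iff by blast
  obtain as where as: "set as \<subseteq> Z" "sorted_wrt (lin_less s) as" "as = [] \<longrightarrow> Z = {}"
    "refines (chain_cover Z s as) (trace_cover Z j \<W>)"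
    using chain_cover_refines_trace[OF W(2)] by blast
  have "refines (chain_cover Z s as) \<C>" by (rule refines_trans[OF as(4) W(3)])
  then show "\<C> \<in> lin_uniformity Z s"
    unfolding lin_uniformity_def uniformity_with_base_def using W(1) as(1-3) by blast
qed

lemma compact_completion_dedekind: "compact_completion Z (lin_uniformity Z s) K j"
  unfolding compact_completion_iff
  using compact_dedekind Hausdorff_dedekind inj_embed embed_mem topspace_dedekind dense_dedekind
    lin_uniformity_eq_induced by auto

section \<open>Automorphisms acting on the Dedekind compactification by direct images\<close>

lemma lop_image_embed:
  assumes "lop Z s g" "x \<in> Z"
  shows "g ` j x = j (g x)"
proof
  show "g ` j x \<subseteq> j (g x)" using assms(1) unfolding lin_embed_def lop_def by blast
  show "j (g x) \<subseteq> g ` j x"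
  proof
    fix y assume "y \<in> j (g x)"
    then have y: "(y, g x) \<in> s" by (simp add: lin_embed_def)
    then obtain z where z: "z \<in> Z" "y = g z"
      using assms(1) s_mem unfolding lop_def bij_betw_def by blast
    then have "(z, x) \<in> s" using y lop_iff[OF assms(1) z(1) assms(2)] by simp
    then show "y \<in> g ` j x" using z(2) by (auto simp: lin_embed_def)
  qed
qed

lemma lop_image_gap:
  assumes g: "lop Z s g" and A: "lin_gap Z s A"
  shows "lin_gap Z s (g ` A)"
proof -
  have bij: "inj_on g Z" "g ` Z = Z" using g by (auto simp: lop_def bij_betw_def)
  have AZ: "A \<subseteq> Z" using A by (simp add: lin_gap_def)
  have mem: "g z \<in> g ` A \<longleftrightarrow> z \<in> A" if "z \<in> Z" for z
    using inj_on_image_mem_iff[OF bij(1) that AZ] .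
  note iff = lop_iff[OF g]
  show ?thesis
    unfolding lin_gap_def
  proof (intro conjI ballI allI impI notI)
    show "Z = {} \<Longrightarrow> False" using A by (simp add: lin_gap_def)
    show "g ` A \<subseteq> Z" using AZ bij(2) by blast
  next
    fix x y assume x: "x \<in> g ` A" and yx: "(y, x) \<in> s"
    obtain a where a: "a \<in> A" "x = g a" using x by blast
    obtain b where b: "b \<in> Z" "y = g b" using s_mem(1)[OF yx] bij(2) by blast
    have "(b, a) \<in> s" using yx a b iff[of b a] AZ by blast
    then show "y \<in> g ` A" using A a b unfolding lin_gap_def by blast
  next
    assume "\<exists>x\<in>g ` A. \<forall>y\<in>g ` A. (y, x) \<in> s"
    then obtain a where "a \<in> A" "\<forall>y\<in>A. (g y, g a) \<in> s" by blast
    then have "\<forall>y\<in>A. (y, a) \<in> s" using iff AZ by blast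
    then show False using A \<open>a \<in> A\<close> unfolding lin_gap_def by blast
  next
    assume "\<exists>x\<in>Z - g ` A. \<forall>y\<in>Z - g ` A. (x, y) \<in> s"
    then obtain x where x: "x \<in> Z" "x \<notin> g ` A" "\<forall>y\<in>Z - g ` A. (x, y) \<in> s" by blast
    then obtain a where a: "a \<in> Z" "x = g a" using bij(2) by blast
    have "a \<notin> A" using a x(2) by blast
    moreover have "\<forall>y\<in>Z - A. (a, y) \<in> s"
    proof
      fix y assume y: "y \<in> Z - A"
      then have "g y \<in> Z - g ` A" using mem bij(2) by blast
      then show "(a, y) \<in> s" using x(3) a iff[of a y] y by blast
    qed
    ultimately show False using A a(1) unfolding lin_gap_def by blast
  qed
qed

lemma lop_image_mem: "lop Z s g \<Longrightarrow> A \<in> D \<Longrightarrow> g ` A \<in> D"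
proof (erule dedekind_cases)
  fix x assume "lop Z s g" "x \<in> Z" "A = j x"
  moreover from this have "g x \<in> Z" unfolding lop_def bij_betw_def by blast
  ultimately show "g ` A \<in> D"
    using lop_image_embed[of g x] embed_mem[of "g x"] by simp
next
  assume "lop Z s g" "lin_gap Z s A"
  then show "g ` A \<in> D" using lop_image_gap unfolding dedekind_points_def by blast
qed

text \<open>Restricted to \<open>D\<close> because the members of \<open>BijGroup D\<close> are
  extensional.\<close>

definition dedekind_action :: "('c \<Rightarrow> 'c) \<Rightarrow> 'c set \<Rightarrow> 'c set" where
  "dedekind_action g = (\<lambda>A\<in>D. g ` A)"

lemma dedekind_action_apply: "A \<in> D \<Longrightarrow> dedekind_action g A = g ` A"
  by (simp add: dedekind_action_def)

lemma dedekind_action_bij: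
  assumes "g \<in> Bij Z" "lop Z s g"
  shows "bij_betw (dedekind_action g) D D"
proof (rule bij_betw_byWitness[of _ "dedekind_action (\<lambda>x\<in>Z. inv_into Z g x)"])
  have bij: "inj_on g Z" "g ` Z = Z" using assms(2) by (auto simp: lop_def bij_betw_def)
  note inv = lop_inverse[OF assms]
  show "dedekind_action g ` D \<subseteq> D" "dedekind_action (\<lambda>x\<in>Z. inv_into Z g x) ` D \<subseteq> D"
    using lop_image_mem[OF assms(2)] lop_image_mem[OF inv] dedekind_action_apply by auto
  show "\<forall>A\<in>D. dedekind_action (\<lambda>x\<in>Z. inv_into Z g x) (dedekind_action g A) = A"
  proof
    fix A assume A: "A \<in> D"
    have "(\<lambda>x\<in>Z. inv_into Z g x) (g x) = x" if "x \<in> A" for x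
      using that dedekind_subset[OF A] bij inv_into_f_f[of g Z x] by auto
    then have "(\<lambda>x\<in>Z. inv_into Z g x) ` g ` A = A" unfolding image_image by simp
    then show "dedekind_action (\<lambda>x\<in>Z. inv_into Z g x) (dedekind_action g A) = A"
      using A lop_image_mem[OF assms(2)] by (simp add: dedekind_action_apply)
  qed
  show "\<forall>A\<in>D. dedekind_action g (dedekind_action (\<lambda>x\<in>Z. inv_into Z g x) A) = A"
  proof
    fix A assume A: "A \<in> D"
    have "g ((\<lambda>x\<in>Z. inv_into Z g x) x) = x" if "x \<in> A" for x
      using that dedekind_subset[OF A] bij f_inv_into_f[of x g Z] by auto
    then have "g ` (\<lambda>x\<in>Z. inv_into Z g x) ` A = A" unfolding image_image by simp
    then show "dedekind_action g (dedekind_action (\<lambda>x\<in>Z. inv_into Z g x) A) = A"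
      using A lop_image_mem[OF inv] by (simp add: dedekind_action_apply)
  qed
qed

lemma dedekind_action_lop:
  assumes "g \<in> Bij Z" "lop Z s g"
  shows "lop D (dedekind_order Z s) (dedekind_action g)"
  unfolding lop_def
proof (intro conjI allI impI)
  show "bij_betw (dedekind_action g) D D" by (rule dedekind_action_bij[OF assms])
  fix A B assume "(A, B) \<in> dedekind_order Z s"
  then have "A \<in> D" "B \<in> D" "A \<subseteq> B" unfolding dedekind_order_def by auto
  then show "(dedekind_action g A, dedekind_action g B) \<in> dedekind_order Z s"
    unfolding dedekind_order_def using lop_image_mem[OF assms(2)]
    by (simp add: dedekind_action_apply image_mono)
qed

end

section \<open>Continuity of the action on the Dedekind compactification\<close>

locale lop_subgroup = linear_order_set Z s for Z :: "'c set" and s :: "'c rel" +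
  fixes H :: "('c \<Rightarrow> 'c) set"
  assumes H: "subgroup H (lop_group Z s)"
begin

lemma H_lop: "g \<in> H \<Longrightarrow> g \<in> Bij Z \<and> lop Z s g"
  using subgroup.subset[OF H] by (auto simp: lop_group_def)

lemma H_BijGroup: "subgroup H (BijGroup Z)"
  by (rule subgroup_BijGroup[OF H])

lemma one_mem_H: "(\<lambda>x\<in>Z. x) \<in> H"
  using subgroup.one_closed[OF H_BijGroup] by (simp add: BijGroup_def)

lemma action_dedekind: "group_action (BijGroup Z\<lparr>carrier := H\<rparr>) D dedekind_action"
proof -
  have Bij: "dedekind_action g \<in> Bij D" if "g \<in> H" for g
    using dedekind_action_bij H_lop[OF that] unfolding Bij_def dedekind_action_def by auto
  have "dedekind_action (compose Z g h) = compose D (dedekind_action g) (dedekind_action h)"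
    if "g \<in> H" "h \<in> H" for g h
  proof
    fix A
    show "dedekind_action (compose Z g h) A = compose D (dedekind_action g) (dedekind_action h) A"
    proof (cases "A \<in> D")
      case True
      have "compose Z g h ` A = g ` h ` A"
        using dedekind_subset[OF True] by (auto simp: compose_def image_image)
      then show ?thesis
        using True lop_image_mem H_lop[OF that(2)] by (simp add: dedekind_action_apply compose_def)
    qed (simp add: dedekind_action_def compose_def)
  qed
  then have "dedekind_action \<in> hom (BijGroup Z\<lparr>carrier := H\<rparr>) (BijGroup D)"
    using Bij H_lop by (simp add: hom_def BijGroup_def)
  then show ?thesis
    unfolding group_action_def group_hom_def group_hom_axioms_def
    using group.subgroup_imp_group[OF group_BijGroup H_BijGroup] group_BijGroup by blast
qed

abbreviation "H_topology \<equiv> pointwise_topology (lin_topology Z s) H"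

lemma openin_tau_eval:
  assumes "q \<in> Z" "openin (lin_topology Z s) U"
  shows "openin H_topology {g\<in>H. g q \<in> U}"
proof -
  have "topspace H_topology = H"
    using topspace_pointwise[of H "lin_topology Z s"] H_lop unfolding topspace_lin by blast
  then show ?thesis
    using openin_continuous_map_preimage[OF continuous_map_pointwise_eval assms(2), of q H]
      assms(1) topspace_lin by simp
qed

text \<open>For the ray above \<open>P\<close> one point \<open>q\<close> suffices: if
  \<open>P \<subset> j q\<close> and every \<open>M\<close> in \<open>N\<close> contains
  \<open>j q\<close>, then \<open>g\<close> M\<open>contains\<close>j (g
  q)\<open>, so keeping\<close>g q\<open>above\<close>P\<open>keeps all of\<close>g \<open>M\<close>
  there. Rays below are dual.\<close>

lemma local_dedekind:
  assumes "openin K W" "L \<in> W"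
  shows "\<exists>V N. openin H_topology V \<and> (\<lambda>x\<in>Z. x) \<in> V \<and> openin K N \<and> L \<in> N \<and>
         (\<forall>g\<in>V. \<forall>M\<in>N. dedekind_action g M \<in> W)"
proof -
  have LD: "L \<in> D" using openin_subset[OF assms(1)] assms(2) topspace_dedekind by blast
  define Q where "Q W \<longleftrightarrow> (\<exists>V N. openin H_topology V \<and> (\<lambda>x\<in>Z. x) \<in> V \<and> openin K N \<and> L \<in> N \<and>
         (\<forall>g\<in>V. \<forall>M\<in>N. dedekind_action g M \<in> W))" for W
  have "Q W"
  proof (rule openin_generated_local[of _ W L Q, OF assms(1)[unfolded dedekind_topology_eq] assms(2)])
    fix W assume "W \<in> {{L\<in>D. P \<subset> L} |P. P \<in> D} \<union> {{L\<in>D. L \<subset> P} |P. P \<in> D} \<union> {D}" and LW: "L \<in> W"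
    then consider P where "P \<in> D" "W = {L\<in>D. P \<subset> L}" | P where "P \<in> D" "W = {L\<in>D. L \<subset> P}" | "W = D"
      by blast
    then show "Q W"
    proof cases
      case 1
      then have PL: "P \<subset> L" using LW by blast
      have "\<exists>q N. q \<in> Z \<and> P \<subset> j q \<and> openin K N \<and> L \<in> N \<and> (\<forall>M\<in>N. M \<in> D \<and> j q \<subseteq> M)"
      proof (cases "\<exists>c\<in>Z. P \<subset> j c \<and> j c \<subset> L")
        case True
        then obtain c where "c \<in> Z" "P \<subset> j c" "j c \<subset> L" by blast
        then show ?thesis
          using openin_dedekind_above[OF embed_mem] LD
          by (intro exI[of _ c] exI[of _ "{M\<in>D. j c \<subset> M}"]) auto
      next
        case False
        \<comment> \<open>With no point strictly between \<open>P\<close> and \<open>L\<close>,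
          \<open>L\<close> is not a gap and is the least element of \<open>D\<close> above
          \<open>P\<close>, so \<open>N\<close> can be the whole ray above \<open>P\<close>.\<close>
        then obtain q where q: "q \<in> Z" "L = j q"
          using gap_between_right[OF 1(1) LD PL] dedekind_cases[OF LD] by metis
        have "j q \<subseteq> M" if M: "M \<in> D" "P \<subset> M" for M
        proof (rule ccontr)
          assume "\<not> j q \<subseteq> M"
          then have "M \<subset> j q" using dedekind_total[OF M(1) embed_mem[OF q(1)]] by blast
          then obtain c where "c \<in> Z" "P \<subset> j c" "j c \<subseteq> M"
            using dedekind_bound_below[OF 1(1) M] by blast
          then show False using False q \<open>M \<subset> j q\<close> by blast
        qed
        then show ?thesis
          using openin_dedekind_above[OF 1(1)] LD PL q
          by (intro exI[of _ q] exI[of _ "{M\<in>D. P \<subset> M}"]) auto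
      qed
      then obtain q N where qN: "q \<in> Z" "P \<subset> j q" "openin K N" "L \<in> N" "\<And>M. M \<in> N \<Longrightarrow> M \<in> D \<and> j q \<subseteq> M"
        by blast
      let ?V = "{g\<in>H. g q \<in> {x\<in>Z. P \<subset> j x}}"
      have "dedekind_action g M \<in> W" if "g \<in> ?V" "M \<in> N" for g M
      proof -
        have g: "lop Z s g" "P \<subset> j (g q)" using that H_lop by auto
        have M: "M \<in> D" "j q \<subseteq> M" using qN(5) that by auto
        have "j (g q) \<subseteq> g ` M" using lop_image_embed[OF g(1) qN(1)] M(2) by blast
        then show ?thesis
          using 1 g M lop_image_mem[OF g(1) M(1)] by (auto simp: dedekind_action_apply)
      qed
      moreover have "openin H_topology ?V"
        using openin_tau_eval[OF qN(1) openin_trace_above[OF 1(1)]] .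
      moreover have "(\<lambda>x\<in>Z. x) \<in> ?V" using one_mem_H qN by simp
      ultimately show ?thesis unfolding Q_def using qN(3,4) by blast
    next
      case 2
      then have PL: "L \<subset> P" using LW by blast
      have "\<exists>q N. q \<in> Z \<and> j q \<subset> P \<and> openin K N \<and> L \<in> N \<and> (\<forall>M\<in>N. M \<in> D \<and> M \<subseteq> j q)"
      proof (cases "\<exists>c\<in>Z. L \<subset> j c \<and> j c \<subset> P")
        case True
        then obtain c where "c \<in> Z" "L \<subset> j c" "j c \<subset> P" by blast
        then show ?thesis
          using openin_dedekind_below[OF embed_mem] LD
          by (intro exI[of _ c] exI[of _ "{M\<in>D. M \<subset> j c}"]) auto
      next
        case False
        then obtain q where q: "q \<in> Z" "L = j q"
          using gap_between_left[OF LD 2(1) PL] dedekind_cases[OF LD] by metis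
        have "M \<subseteq> j q" if M: "M \<in> D" "M \<subset> P" for M
        proof (rule ccontr)
          assume "\<not> M \<subseteq> j q"
          then have "j q \<subset> M" using dedekind_total[OF M(1) embed_mem[OF q(1)]] by blast
          then obtain c where "c \<in> Z" "M \<subseteq> j c" "j c \<subset> P"
            using dedekind_bound_above[OF M(1) 2(1) M(2)] by blast
          then show False using False q \<open>j q \<subset> M\<close> by blast
        qed
        then show ?thesis
          using openin_dedekind_below[OF 2(1)] LD PL q
          by (intro exI[of _ q] exI[of _ "{M\<in>D. M \<subset> P}"]) auto
      qed
      then obtain q N where qN: "q \<in> Z" "j q \<subset> P" "openin K N" "L \<in> N" "\<And>M. M \<in> N \<Longrightarrow> M \<in> D \<and> M \<subseteq> j q"
        by blast
      let ?V = "{g\<in>H. g q \<in> {x\<in>Z. j x \<subset> P}}"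
      have "dedekind_action g M \<in> W" if "g \<in> ?V" "M \<in> N" for g M
      proof -
        have g: "lop Z s g" "j (g q) \<subset> P" using that H_lop by auto
        have M: "M \<in> D" "M \<subseteq> j q" using qN(5) that by auto
        have "g ` M \<subseteq> j (g q)" using lop_image_embed[OF g(1) qN(1)] M(2) by blast
        then show ?thesis
          using 2 g M lop_image_mem[OF g(1) M(1)] by (auto simp: dedekind_action_apply)
      qed
      moreover have "openin H_topology ?V"
        using openin_tau_eval[OF qN(1) openin_trace_below[OF 2(1)]] .
      moreover have "(\<lambda>x\<in>Z. x) \<in> ?V" using one_mem_H qN by simp
      ultimately show ?thesis unfolding Q_def using qN(3,4) by blast
    next
      case 3
      have "topspace H_topology = H"
        using topspace_pointwise[of H "lin_topology Z s"] H_lop unfolding topspace_lin by blast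
      moreover have "\<forall>g\<in>H. \<forall>M\<in>D. dedekind_action g M \<in> W"
        using 3 lop_image_mem H_lop by (simp add: dedekind_action_apply)
      ultimately show ?thesis
        unfolding Q_def using one_mem_H LD openin_topspace[of H_topology] openin_topspace[of K]
        by (intro exI[of _ "topspace H_topology"] exI[of _ "topspace K"])
          (simp add: topspace_dedekind)
    qed
  next
    fix A B assume "Q A" "Q B"
    then obtain V N V' N' where VN: "openin H_topology V" "(\<lambda>x\<in>Z. x) \<in> V" "openin K N" "L \<in> N"
         "\<forall>g\<in>V. \<forall>M\<in>N. dedekind_action g M \<in> A"
         "openin H_topology V'" "(\<lambda>x\<in>Z. x) \<in> V'" "openin K N'" "L \<in> N'"
         "\<forall>g\<in>V'. \<forall>M\<in>N'. dedekind_action g M \<in> B"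
      unfolding Q_def by (elim exE conjE) (rule that)
    have "openin H_topology (V \<inter> V')" "openin K (N \<inter> N')" using VN by (simp_all add: openin_Int)
    then show "Q (A \<inter> B)"
      unfolding Q_def using VN by (intro exI[of _ "V \<inter> V'"] exI[of _ "N \<inter> N'"]) simp
  next
    fix A B assume "Q A" "A \<subseteq> B"
    then show "Q B" unfolding Q_def by blast
  qed
  then show ?thesis unfolding Q_def .
qed

sublocale compactified_action Z "lin_topology Z s" K j H dedekind_action
proof (rule compactified_action.intro)
  show "compact_space K" "Hausdorff_space K" by (rule compact_dedekind Hausdorff_dedekind)+
  show "x \<in> Z \<Longrightarrow> j x \<in> topspace K" for x using embed_mem topspace_dedekind by simp
  show "lin_topology Z s = pullback_topology Z j K" by (rule lin_topology_eq_pullback)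
  show "subgroup H (BijGroup Z)" by (rule H_BijGroup)
  show "group_action (BijGroup Z\<lparr>carrier := H\<rparr>) (topspace K) dedekind_action"
    unfolding topspace_dedekind by (rule action_dedekind)
  show "continuous_map K K (dedekind_action g)" if "g \<in> H" for g
    unfolding dedekind_topology_def
    by (rule linear_order_set.lop_continuous[OF _ dedekind_action_lop])
      (use linear_dedekind H_lop[OF that] in \<open>auto simp: linear_order_set_def\<close>)
  show "dedekind_action g (j x) = j (g x)" if "g \<in> H" "x \<in> Z" for g x
    using that lop_image_embed H_lop embed_mem by (simp add: dedekind_action_apply)
qed (rule local_dedekind)

theorem lop_group_actions:
  "equiuniform (lop_group Z s\<lparr>carrier := H\<rparr>) (pointwise_topology (lin_topology Z s) H)
     Z (lin_uniformity Z s) (\<lambda>g. g) \<and>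
   compact_completion Z (lin_uniformity Z s) (dedekind_topology Z s) (lin_embed s) \<and>
   (\<exists>\<psi>. continuous_action (lop_group Z s\<lparr>carrier := H\<rparr>)
          (pointwise_topology (lin_topology Z s) H) (dedekind_topology Z s) \<psi> \<and>
        (\<forall>g\<in>H. lop (dedekind_points Z s) (dedekind_order Z s) (\<psi> g)) \<and>
        (\<forall>g\<in>H. \<forall>y\<in>Z. \<psi> g (lin_embed s y) = lin_embed s (g y))) \<and>
   topological_group (lop_group Z s\<lparr>carrier := H\<rparr>) (pointwise_topology (lin_topology Z s) H) \<and>
   continuous_action (lop_group Z s\<lparr>carrier := H\<rparr>) (pointwise_topology (lin_topology Z s) H)
     (lin_topology Z s) (\<lambda>g. g)"
proof -
  have grp: "lop_group Z s\<lparr>carrier := H\<rparr> = BijGroup Z\<lparr>carrier := H\<rparr>"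
    by (simp add: lop_group_def)
  have "continuous_action (BijGroup Z\<lparr>carrier := H\<rparr>) H_topology K dedekind_action \<and>
        (\<forall>g\<in>H. lop D (dedekind_order Z s) (dedekind_action g)) \<and>
        (\<forall>g\<in>H. \<forall>y\<in>Z. dedekind_action g (j y) = j (g y))"
    using continuous_action_compactification dedekind_action_lop H_lop equivariant by blast
  then show ?thesis
    unfolding grp
    using equiuniform_induced[folded lin_uniformity_eq_induced] compact_completion_dedekind
      topological continuous_action_X by blast
qed

end

subsection \<open>Circular orders\<close>

text \<open>The standard circular order of the integers, the model for positions in a cycle.\<close>

definition cyc_lt :: "int \<Rightarrow> int \<Rightarrow> int \<Rightarrow> bool" where
  "cyc_lt a b c \<longleftrightarrow> a < b \<and> b < c \<or> b < c \<and> c < a \<or> c < a \<and> a < b"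

locale circular_order_set =
  fixes C :: "'c set" and R :: "('c \<times> 'c \<times> 'c) set"
  assumes circ: "circular_order C R"
begin

lemma R_mem: "(a, b, c) \<in> R \<Longrightarrow> a \<in> C" "(a, b, c) \<in> R \<Longrightarrow> b \<in> C" "(a, b, c) \<in> R \<Longrightarrow> c \<in> C"
proof -
  have "R \<subseteq> C \<times> C \<times> C" using circ unfolding circular_order_def by (rule conjunct1)
  then show "(a, b, c) \<in> R \<Longrightarrow> a \<in> C" "(a, b, c) \<in> R \<Longrightarrow> b \<in> C" "(a, b, c) \<in> R \<Longrightarrow> c \<in> C"
    by auto
qed

lemma R_cyc: "(a, b, c) \<in> R \<Longrightarrow> (b, c, a) \<in> R"
  using circ[unfolded circular_order_def, THEN conjunct2, THEN conjunct1] by blast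

lemma R_asym: "(a, b, c) \<in> R \<Longrightarrow> (c, b, a) \<notin> R"
  using circ[unfolded circular_order_def, THEN conjunct2, THEN conjunct2, THEN conjunct1] by blast

lemma R_trans: "(a, b, c) \<in> R \<Longrightarrow> (a, c, d) \<in> R \<Longrightarrow> (a, b, d) \<in> R"
  using circ[unfolded circular_order_def, THEN conjunct2, THEN conjunct2, THEN conjunct2, THEN conjunct1] by blast

lemma R_total: "a \<in> C \<Longrightarrow> b \<in> C \<Longrightarrow> c \<in> C \<Longrightarrow> a \<noteq> b \<Longrightarrow> b \<noteq> c \<Longrightarrow> a \<noteq> c \<Longrightarrow> (a, b, c) \<in> R \<or> (a, c, b) \<in> R"
  using circ[unfolded circular_order_def, THEN conjunct2, THEN conjunct2, THEN conjunct2, THEN conjunct2] by blast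

lemma R_distinct: "(a, b, c) \<in> R \<Longrightarrow> a \<noteq> b \<and> b \<noteq> c \<and> a \<noteq> c"
  using R_cyc R_asym by metis

lemma R_cyc_iff: "(b, c, a) \<in> R \<longleftrightarrow> (a, b, c) \<in> R"
  using R_cyc by metis

section \<open>Point-cuts, and the circular order read off from a cut\<close>

lemma lower_cut_less_iff:
  "p \<in> C \<Longrightarrow> lin_less (lower_cut C R p) a b \<longleftrightarrow> b \<in> C \<and> a \<noteq> b \<and> (a = p \<or> (p, a, b) \<in> R)"
  unfolding lin_less_def lower_cut_def using R_mem by auto

lemma linear_lower_cut:
  assumes p: "p \<in> C"
  shows "linear_order_on C (lower_cut C R p)"
  unfolding linear_order_on_def partial_order_on_def preorder_on_def
proof (intro conjI)
  show "lower_cut C R p \<subseteq> C \<times> C" unfolding lower_cut_def by blast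
  show "refl_on C (lower_cut C R p)" unfolding lower_cut_def by (rule refl_onI) simp
  show "trans (lower_cut C R p)"
  proof (rule transI)
    fix a b c assume "(a, b) \<in> lower_cut C R p" "(b, c) \<in> lower_cut C R p"
    then show "(a, c) \<in> lower_cut C R p"
      unfolding lower_cut_def using R_trans[of p a b c] R_distinct[of p a b] by auto
  qed
  show "antisym (lower_cut C R p)"
  proof (rule antisymI)
    fix a b assume "(a, b) \<in> lower_cut C R p" "(b, a) \<in> lower_cut C R p"
    then show "a = b"
      unfolding lower_cut_def
      using R_distinct[of p a b] R_distinct[of p b a] R_asym[of p a b] R_cyc[of p b a] R_cyc[of b a p]
        R_cyc[of a p b]
      by auto
  qed
  show "total_on C (lower_cut C R p)"
    unfolding total_on_def lower_cut_def using R_total[OF p] by blast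
qed

text \<open>For \<open>a\<close> different from \<open>p\<close>, rotate \<open>[p,a,b]\<close> to
  \<open>[b,p,a]\<close> and \<open>[p,b,c]\<close> to \<open>[b,c,p]\<close>; transitivity at
  \<open>b\<close> gives \<open>[b,c,a]\<close>.\<close>

lemma circ_cut_lower_cut:
  assumes p: "p \<in> C"
  shows "circ_cut C R (lower_cut C R p)"
  unfolding circ_cut_def
proof (intro conjI allI impI)
  show "linear_order_on C (lower_cut C R p)" by (rule linear_lower_cut[OF p])
  fix a b c
  assume *: "(a, b) \<in> lower_cut C R p \<and> a \<noteq> b \<and> (b, c) \<in> lower_cut C R p \<and> b \<noteq> c"
  then have ab: "a = p \<or> (p, a, b) \<in> R" and bc: "b = p \<or> (p, b, c) \<in> R"
    unfolding lower_cut_def by auto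
  have "b \<noteq> p" using ab * R_distinct by blast
  then have bc: "(p, b, c) \<in> R" using bc by blast
  show "(a, b, c) \<in> R"
  proof (cases "a = p")
    case True
    then show ?thesis using bc by simp
  next
    case False
    then have "(p, a, b) \<in> R" using ab by blast
    have "(b, p, a) \<in> R" using \<open>(p, a, b) \<in> R\<close> R_cyc by blast
    have "(b, c, p) \<in> R" using bc R_cyc by blast
    then have "(b, c, a) \<in> R" using R_trans[OF _ \<open>(b, p, a) \<in> R\<close>] by blast
    then show ?thesis using R_cyc by blast
  qed
qed

text \<open>The three rotations of an increasing triple are in \<open>R\<close> by the cut property;
  the three decreasing arrangements put the reversed triple in \<open>R\<close> and are excluded by
  asymmetry. Thus statements about finitely many points of the circle become statements about one
  linear order.\<close>

lemma R_iff_cut: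
  assumes "circ_cut C R L" "a \<in> C" "b \<in> C" "c \<in> C"
  shows "(a, b, c) \<in> R \<longleftrightarrow> lin_less L a b \<and> lin_less L b c \<or> lin_less L b c \<and> lin_less L c a \<or>
     lin_less L c a \<and> lin_less L a b"
proof -
  interpret L: linear_order_set C L
    using assms(1) by unfold_locales (simp add: circ_cut_def)
  have cut: "(x, y, z) \<in> R" if "lin_less L x y" "lin_less L y z" for x y z
    using assms(1) that unfolding circ_cut_def lin_less_def by blast
  show ?thesis
  proof
    assume R: "(a, b, c) \<in> R"
    then have ne: "a \<noteq> b" "b \<noteq> c" "a \<noteq> c" using R_distinct by auto
    have no: "\<not> (lin_less L c b \<and> lin_less L b a)" "\<not> (lin_less L b a \<and> lin_less L a c)"
        "\<not> (lin_less L a c \<and> lin_less L c b)"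
      using R cut R_asym R_cyc by metis+
    then show "lin_less L a b \<and> lin_less L b c \<or> lin_less L b c \<and> lin_less L c a \<or>
       lin_less L c a \<and> lin_less L a b"
      using L.lt_total ne assms(2-4) by metis
  next
    assume "lin_less L a b \<and> lin_less L b c \<or> lin_less L b c \<and> lin_less L c a \<or>
       lin_less L c a \<and> lin_less L a b"
    then show "(a, b, c) \<in> R" using cut R_cyc by metis
  qed
qed

text \<open>Sort \<open>F\<close> along any point-cut; by \<open>R_iff_cut\<close> the circular
  order of the entries is then that of their positions.\<close>

lemma finite_cyclic_list:
  assumes "finite F" "F \<subseteq> C"
  obtains as where "set as = F" "distinct as"
    "\<And>i k l. i < length as \<Longrightarrow> k < length as \<Longrightarrow> l < length as \<Longrightarrow>
       (as ! i, as ! k, as ! l) \<in> R \<longleftrightarrow> cyc_lt (int i) (int k) (int l)"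
proof (cases "F = {}")
  case True
  then show ?thesis using that[of "[]"] by simp
next
  case False
  then obtain p where p: "p \<in> C" using assms(2) by blast
  interpret L: linear_order_set C "lower_cut C R p"
    using linear_lower_cut[OF p] by unfold_locales
  have "\<exists>as. set as = F \<and> sorted_wrt (lin_less (lower_cut C R p)) as"
    by (rule finite_sorted_list_exists[OF assms(1)]) (use assms(2) L.lt_trans L.lt_total in blast)+
  then obtain as where as: "set as = F" "sorted_wrt (lin_less (lower_cut C R p)) as" by blast
  have lt: "lin_less (lower_cut C R p) (as ! i) (as ! k) \<longleftrightarrow> i < k"
    if "i < length as" "k < length as" for i k
  proof
    assume *: "lin_less (lower_cut C R p) (as ! i) (as ! k)"
    show "i < k"
    proof (rule ccontr)
      assume "\<not> i < k"
      then consider "i = k" | "k < i" by linarith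
      then show False
        using * L.sorted_nth_less[OF as(2), of k i] that L.lt_trans L.lt_irrefl by cases blast+
    qed
  qed (use L.sorted_nth_less[OF as(2)] that in blast)
  have "distinct as"
    unfolding distinct_conv_nth using lt L.lt_irrefl by (metis nat_neq_iff)
  moreover have "(as ! i, as ! k, as ! l) \<in> R \<longleftrightarrow> cyc_lt (int i) (int k) (int l)"
    if "i < length as" "k < length as" "l < length as" for i k l
  proof -
    have "as ! i \<in> C" "as ! k \<in> C" "as ! l \<in> C" using that as(1) assms(2) nth_mem by blast+
    then show ?thesis
      using R_iff_cut[OF circ_cut_lower_cut[OF p]] lt that by (simp add: cyc_lt_def)
  qed
  ultimately show ?thesis using that as(1) by blast
qed

section \<open>The interval topology of a circular order\<close>

lemma topspace_circ: "topspace (circ_topology C R) = C"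
  unfolding circ_topology_def topology_generated_by_topspace by auto

lemma openin_compl_closed:
  "a \<in> C \<Longrightarrow> b \<in> C \<Longrightarrow> openin (circ_topology C R) (C - circ_closed R a b)"
  unfolding circ_topology_def by (rule topology_generated_by_Basis) blast

lemma circ_open_subset: "circ_open R a b \<subseteq> C"
  unfolding circ_open_def using R_mem by blast

text \<open>By totality and asymmetry a third point lies on exactly one of the two arcs between
  \<open>a\<close> and \<open>b\<close>. Hence the basic open sets are open arcs, complements of
  single points (for equal ends) and the whole circle.\<close>

lemma circ_open_eq_compl:
  assumes "a \<in> C" "b \<in> C" "a \<noteq> b"
  shows "circ_open R a b = C - circ_closed R b a"
proof -
  have "(a, x, b) \<in> R \<longleftrightarrow> x \<in> C \<and> x \<noteq> a \<and> x \<noteq> b \<and> (b, x, a) \<notin> R" for x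
    using R_total[of a x b] assms R_mem(2)[of a x b] R_distinct[of a x b] R_asym[of a x b]
      R_cyc_iff[of b x a] R_cyc_iff[of x a b] by blast
  then show ?thesis unfolding circ_open_def circ_closed_def by blast
qed

lemma openin_circ_open:
  assumes "a \<noteq> b"
  shows "openin (circ_topology C R) (circ_open R a b)"
proof (cases "a \<in> C \<and> b \<in> C")
  case True
  then show ?thesis using circ_open_eq_compl[OF _ _ assms] openin_compl_closed by simp
next
  case False
  then have "circ_open R a b = {}" unfolding circ_open_def using R_mem by blast
  then show ?thesis by simp
qed

lemma openin_compl_point: "a \<in> C \<Longrightarrow> openin (circ_topology C R) (C - {a})"
proof -
  assume "a \<in> C"
  moreover have "circ_closed R a a = {a}"
    using R_distinct unfolding circ_closed_def circ_open_def by blast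
  ultimately show ?thesis using openin_compl_closed[of a a] by simp
qed

text \<open>Around the circle the points come in the order \<open>d\<close>, \<open>p\<close>,
  \<open>x\<close>, \<open>q\<close>; the conclusion is transitivity based at
  \<open>x\<close>.\<close>

lemma R_mid: "(d, p, x) \<in> R \<Longrightarrow> (d, x, q) \<in> R \<Longrightarrow> (p, x, q) \<in> R"
  using R_trans[of x q d p] R_cyc[of d x q] R_cyc[of d p x] R_cyc[of p x d] R_cyc[of x q p]
    R_cyc[of q p x] by blast

text \<open>Given \<open>d\<close> on the arc from \<open>q\<close> to \<open>p\<close>, a point
  \<open>c\<close> on the other arc splits the circle into the arcs from \<open>d\<close> to
  \<open>c\<close> and from \<open>c\<close> to \<open>d\<close>. If there is no \<open>c\<close>,
  the arcs from \<open>d\<close> to \<open>q\<close> and from \<open>p\<close> to \<open>d\<close>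
  are disjoint, since a common point would lie between \<open>p\<close> and \<open>q\<close>. If
  neither arc has a point, the circle is \<open>{p, q}\<close>.\<close>

lemma Hausdorff_circ: "Hausdorff_space (circ_topology C R)"
proof -
  let ?T = "circ_topology C R"
  have sep: "\<exists>U V. openin ?T U \<and> openin ?T V \<and> p \<in> U \<and> q \<in> V \<and> disjnt U V"
    if d: "(q, d, p) \<in> R" for p q d
  proof (cases "\<exists>c. (p, c, q) \<in> R")
    case True
    then obtain c where c: "(p, c, q) \<in> R" by blast
    have "p \<in> circ_open R d c" "q \<in> circ_open R c d"
      using R_mid[of q d p c] R_mid[of p c q d] R_cyc c d unfolding circ_open_def by blast+
    moreover have "disjnt (circ_open R d c) (circ_open R c d)"
      unfolding disjnt_iff circ_open_def using R_asym R_cyc by blast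
    moreover have "c \<noteq> d" using c d R_asym by blast
    ultimately show ?thesis using openin_circ_open[of d c] openin_circ_open[of c d] by blast
  next
    case False
    have "p \<in> circ_open R d q" "q \<in> circ_open R p d"
      using R_cyc d unfolding circ_open_def by blast+
    moreover have "disjnt (circ_open R d q) (circ_open R p d)"
      unfolding disjnt_iff circ_open_def using False R_mid R_cyc by blast
    moreover have "d \<noteq> q" "p \<noteq> d" using d R_distinct by blast+
    ultimately show ?thesis using openin_circ_open[of d q] openin_circ_open[of p d] by blast
  qed
  show ?thesis
    unfolding Hausdorff_space_def topspace_circ
  proof (intro allI impI)
    fix p q assume "p \<in> C \<and> q \<in> C \<and> p \<noteq> q"
    then have pq: "p \<in> C" "q \<in> C" "p \<noteq> q" by auto
    consider d where "(q, d, p) \<in> R" | d where "(p, d, q) \<in> R"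
      | "\<not> (\<exists>d. (q, d, p) \<in> R)" "\<not> (\<exists>d. (p, d, q) \<in> R)"
      by blast
    then show "\<exists>U V. openin ?T U \<and> openin ?T V \<and> p \<in> U \<and> q \<in> V \<and> disjnt U V"
    proof cases
      case 1
      then show ?thesis by (rule sep)
    next
      case 2
      from sep[OF this] show ?thesis using disjnt_sym by blast
    next
      case 3
      have "x = p \<or> x = q" if "x \<in> C" for x
        using R_total[of p x q] that pq 3 R_cyc by blast
      then have "disjnt (C - {q}) (C - {p})" unfolding disjnt_iff by blast
      then show ?thesis using openin_compl_point[of p] openin_compl_point[of q] pq by blast
    qed
  qed
qed

text \<open>Near \<open>L\<close>, an interval around \<open>L\<close> is cut out by the last left end point and the first right
  end point in the linear order starting at \<open>L\<close>.\<close>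

lemma circ_interval_Int:
  assumes "(a, L, b) \<in> R" "(a', L, b') \<in> R"
  obtains a'' b'' where "a'' \<in> {a, a'}" "b'' \<in> {b, b'}" "(a'', L, b'') \<in> R"
    "circ_open R a'' b'' \<subseteq> circ_open R a b \<inter> circ_open R a' b'"
proof -
  have mem: "L \<in> C" "a \<in> C" "b \<in> C" "a' \<in> C" "b' \<in> C" using assms R_mem by blast+
  note cut = circ_cut_lower_cut[OF mem(1)]
  interpret L: linear_order_set C "lower_cut C R L"
    using linear_lower_cut[OF mem(1)] by unfold_locales
  have least: "L = x \<or> lin_less (lower_cut C R L) L x" if "x \<in> C" for x
    using that lower_cut_less_iff[OF mem(1)] by blast
  \<comment> \<open>In the order that starts at \<open>L\<close>, right ends come before left ends:
    an interval around \<open>L\<close> is what precedes its right end together with what follows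
    its left end. So the larger left end and the smaller right end are taken.\<close>
  have iff: "(x, L, y) \<in> R \<longleftrightarrow> lin_less (lower_cut C R L) y x \<and> L \<noteq> y" if "x \<in> C" "y \<in> C" for x y
    using lower_cut_less_iff[OF mem(1), of y x] R_cyc_iff[of L y x] R_cyc_iff[of y x L]
      R_distinct[of x L y] that by blast
  define a'' where "a'' = (if (a, a') \<in> lower_cut C R L then a' else a)"
  define b'' where "b'' = (if (b, b') \<in> lower_cut C R L then b else b')"
  have a'': "a'' \<in> {a, a'}" "(a, a'') \<in> lower_cut C R L" "(a', a'') \<in> lower_cut C R L"
    using L.s_total[of a a'] L.s_refl mem unfolding a''_def by auto
  have b'': "b'' \<in> {b, b'}" "(b'', b) \<in> lower_cut C R L" "(b'', b') \<in> lower_cut C R L"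
    using L.s_total[of b b'] L.s_refl mem unfolding b''_def by auto
  have memx: "a'' \<in> C" "b'' \<in> C" using a''(1) b''(1) mem by auto
  have "lin_less (lower_cut C R L) b a" "L \<noteq> b" "lin_less (lower_cut C R L) b' a'" "L \<noteq> b'"
    using assms iff mem by blast+
  then have "(a'', L, b'') \<in> R"
    using iff[OF memx] L.le_lt_trans[OF b''(2)] L.lt_le_trans[OF _ a''(2)] b''(1) by blast
  moreover have sub: "circ_open R a'' b'' \<subseteq> circ_open R u v"
    if uv: "(u, a'') \<in> lower_cut C R L" "(b'', v) \<in> lower_cut C R L" "(u, L, v) \<in> R" for u v
  proof
    fix x assume "x \<in> circ_open R a'' b''"
    then have x: "(a'', x, b'') \<in> R" "x \<in> C" unfolding circ_open_def using R_mem by blast+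
    have uvC: "u \<in> C" "v \<in> C" using uv(3) R_mem by blast+
    have vu: "lin_less (lower_cut C R L) v u" "L \<noteq> v" using iff[OF uvC] uv(3) by blast+
    have "lin_less (lower_cut C R L) b'' a''"
      using L.lt_le_trans[OF L.le_lt_trans[OF uv(2) vu(1)] uv(1)] .
    then have "lin_less (lower_cut C R L) x b'' \<or> lin_less (lower_cut C R L) a'' x"
      using x(1) R_iff_cut[OF cut memx(1) x(2) memx(2)] L.lt_trans L.lt_irrefl by blast
    then have "lin_less (lower_cut C R L) x v \<or> lin_less (lower_cut C R L) u x"
      using L.lt_le_trans[OF _ uv(2)] L.le_lt_trans[OF uv(1)] by blast
    then show "x \<in> circ_open R u v"
      unfolding circ_open_def mem_Collect_eq R_iff_cut[OF cut uvC(1) x(2) uvC(2)] using vu(1) by blast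
  qed
  ultimately show ?thesis
    using that a''(1) b''(1) sub[OF a''(2) b''(2) assms(1)] sub[OF a''(3) b''(3) assms(2)] by blast
qed

section \<open>Intervals and their images under automorphisms\<close>

lemma cop_iff:
  assumes "cop C R f" "a \<in> C" "b \<in> C" "c \<in> C"
  shows "(f a, f b, f c) \<in> R \<longleftrightarrow> (a, b, c) \<in> R"
proof
  assume *: "(f a, f b, f c) \<in> R"
  then have "a \<noteq> b" "b \<noteq> c" "a \<noteq> c" using R_distinct by blast+
  then have "(a, b, c) \<in> R \<or> (c, b, a) \<in> R" using R_total[OF assms(2-4)] R_cyc by blast
  then show "(a, b, c) \<in> R" using assms(1) * R_asym unfolding cop_def by blast
qed (use assms(1) in \<open>simp add: cop_def\<close>)

lemma R_between:
  assumes "(a, c, d) \<in> R" "(c, x, d) \<in> R"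
  shows "(a, c, x) \<in> R" "(a, x, d) \<in> R"
proof -
  have "(d, a, c) \<in> R" "(d, c, x) \<in> R" "(c, d, a) \<in> R" using assms R_cyc by blast+
  then show "(a, c, x) \<in> R" "(a, x, d) \<in> R"
    using R_trans[of d a c x] R_trans[of c x d a] assms(2) R_cyc by blast+
qed

text \<open>Used with \<open>c\<close> and \<open>d\<close> the images of the ends of a small
  interval around \<open>L\<close> and \<open>x\<close> the image of one of its elements: as long as
  \<open>c\<close> stays between \<open>a\<close> and \<open>L\<close>, and \<open>d\<close> between
  \<open>L\<close> and \<open>b\<close>, the image does not leave the arc from \<open>a\<close> to
  \<open>b\<close>.\<close>

lemma interval_translate:
  assumes "(a, L, b) \<in> R" "(a, c, L) \<in> R" "(L, d, b) \<in> R" "(c, x, d) \<in> R"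
  shows "(a, x, b) \<in> R"
proof -
  have "(a, L, d) \<in> R" "(a, d, b) \<in> R" using R_between[OF assms(1,3)] by blast+
  moreover have "(a, c, d) \<in> R" using R_trans[OF assms(2) calculation(1)] .
  ultimately show ?thesis using R_between(2)[OF _ assms(4)] R_trans by blast
qed

text \<open>Primes denote images under an automorphism, and \<open>q\<close> is isolated on the
  left, with \<open>a\<close> as its predecessor. An \<open>x\<close> other than \<open>q\<close>
  lies between \<open>q\<close> and \<open>d\<close>, so its image lies between \<open>q'\<close>
  and \<open>d'\<close>, and it remains to see that \<open>q'\<close> comes before \<open>d'\<close>
  on the arc that starts at \<open>a\<close>. Since nothing lies between \<open>a\<close> and
  \<open>q\<close>, \<open>[b,a',q]\<close> confines \<open>a'\<close> to \<open>a\<close> or to the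
  arc from \<open>b\<close> to \<open>a\<close>; this lets \<open>[a',q',d']\<close> be read from
  \<open>a\<close>.\<close>

lemma jump_translate:
  assumes "(a, q, b) \<in> R" "\<And>x. (a, x, q) \<notin> R" "(q, d, b) \<in> R" "(a, x, d) \<in> R"
    and f: "(b, a', q) \<in> R" "(a, q', b) \<in> R" "(q, d', b) \<in> R"
      "(a, q, d) \<in> R \<Longrightarrow> (a', q', d') \<in> R" "(q, x, d) \<in> R \<Longrightarrow> (q', x', d') \<in> R" "x = q \<Longrightarrow> x' = q'"
  shows "(a, x', b) \<in> R"
proof (cases "x = q")
  case True
  then show ?thesis using f by simp
next
  case False
  have "(a, q, d) \<in> R" using R_between(1)[OF assms(1,3)] .
  then have 1: "(a', q', d') \<in> R" by (rule f(4))
  have "(a, x, q) \<in> R \<or> (a, q, x) \<in> R"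
    using R_total[of a x q] False R_distinct[OF assms(4)] R_distinct[OF assms(1)] R_mem assms(1,4)
    by blast
  then have "(a, q, x) \<in> R" using assms(2) by blast
  then have 2: "(q', x', d') \<in> R" using f(5) R_mid assms(4) by blast
  have 3: "(a, d', b) \<in> R" using R_between(2)[OF assms(1) f(3)] .
  have "(a, q', d') \<in> R"
  proof (cases "a' = a")
    case True
    then show ?thesis using 1 by simp
  next
    case neq: False
    have "a' \<noteq> b" using R_distinct[OF f(1)] by blast
    moreover have "(a, a', b) \<notin> R"
    proof
      assume "(a, a', b) \<in> R"
      moreover have "(b, a, q) \<in> R" using assms(1) R_cyc by blast
      ultimately have "(b, a, a') \<in> R" "(b, a', q) \<in> R" using R_cyc f(1) by blast+
      then have "(a, a', q) \<in> R" by (rule R_mid)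
      then show False using assms(2) by blast
    qed
    ultimately have "(b, a', a) \<in> R"
      using R_total[of a a' b] neq R_mem f(1) assms(1) R_distinct[OF assms(1)] R_cyc by blast
    moreover have "(b, a, q') \<in> R" "(b, a, d') \<in> R" using f(2) 3 R_cyc by blast+
    ultimately have "(b, a', d') \<in> R" using R_trans by blast
    then have "(b, q', d') \<in> R" using 1 R_between(2) by blast
    then show ?thesis using \<open>(b, a, q') \<in> R\<close> R_mid by blast
  qed
  then have "(a, x', d') \<in> R" using 2 R_between(2) by blast
  then show ?thesis using 3 R_trans by blast
qed

text \<open>Reversing the orientation makes mirror images of results available, such as the next
  lemma.\<close>

lemma circular_order_converse: "circular_order C {(c, b, a). (a, b, c) \<in> R}"
  unfolding circular_order_def
proof (intro conjI allI impI ballI)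
  show "{(c, b, a). (a, b, c) \<in> R} \<subseteq> C \<times> C \<times> C" using R_mem by auto
next
  fix a b c assume "(a, b, c) \<in> {(c, b, a). (a, b, c) \<in> R}"
  then have "(c, b, a) \<in> R" by simp
  then have "(a, c, b) \<in> R" "(a, b, c) \<notin> R" using R_cyc R_asym by blast+
  then show "(b, c, a) \<in> {(c, b, a). (a, b, c) \<in> R}" "(c, b, a) \<notin> {(c, b, a). (a, b, c) \<in> R}"
    by simp_all
next
  fix a b c d
  assume "(a, b, c) \<in> {(c, b, a). (a, b, c) \<in> R} \<and> (a, c, d) \<in> {(c, b, a). (a, b, c) \<in> R}"
  then have "(c, b, a) \<in> R" "(d, c, a) \<in> R" by simp_all
  then have "(a, c, b) \<in> R" "(a, d, c) \<in> R" using R_cyc by blast+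
  then have "(a, d, b) \<in> R" using R_trans by blast
  then have "(d, b, a) \<in> R" using R_cyc by blast
  then show "(a, b, d) \<in> {(c, b, a). (a, b, c) \<in> R}" by simp
next
  fix a b c assume "a \<in> C" "b \<in> C" "c \<in> C" "a \<noteq> b \<and> b \<noteq> c \<and> a \<noteq> c"
  then show "(a, b, c) \<in> {(c, b, a). (a, b, c) \<in> R} \<or> (a, c, b) \<in> {(c, b, a). (a, b, c) \<in> R}"
  proof -
    have "(a, b, c) \<in> R \<or> (a, c, b) \<in> R"
      using R_total \<open>a \<in> C\<close> \<open>b \<in> C\<close> \<open>c \<in> C\<close> \<open>a \<noteq> b \<and> b \<noteq> c \<and> a \<noteq> c\<close> by blast
    then have "(c, b, a) \<in> R \<or> (b, c, a) \<in> R" using R_cyc by blast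
    then show ?thesis by simp
  qed
qed

text \<open>The previous translation lemma in the converse order: \<open>a\<close> and
  \<open>b\<close> change places, and \<open>c\<close> takes the part of \<open>d\<close>.\<close>

lemma jump_translate_right:
  assumes "(a, q, b) \<in> R" "\<And>x. (q, x, b) \<notin> R" "(a, c, q) \<in> R" "(c, x, b) \<in> R"
    and f: "(q, b', a) \<in> R" "(a, q', b) \<in> R" "(a, c', q) \<in> R"
      "(c, q, b) \<in> R \<Longrightarrow> (c', q', b') \<in> R" "(c, x, q) \<in> R \<Longrightarrow> (c', x', q') \<in> R" "x = q \<Longrightarrow> x' = q'"
  shows "(a, x', b) \<in> R"
proof -
  interpret conv: circular_order_set C "{(c, b, a). (a, b, c) \<in> R}"
    by unfold_locales (rule circular_order_converse)
  have "(b, x', a) \<in> {(c, b, a). (a, b, c) \<in> R}"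
    by (rule conv.jump_translate[where q = q and d = c and x = x and a' = b' and q' = q' and d' = c'])
      (use assms in auto)
  then show ?thesis by simp
qed

text \<open>The end points of a consecutive triple of a cycle enclose no other point of the cycle, so an
  interval with end points in the cycle that contains the middle point contains the whole gap.\<close>

lemma cycle_cover_refines:
  assumes as: "distinct as" "3 \<le> length as" "set as \<subseteq> C"
    and iff: "\<And>i k l. i < length as \<Longrightarrow> k < length as \<Longrightarrow> l < length as \<Longrightarrow>
       (as ! i, as ! k, as ! l) \<in> R \<longleftrightarrow> cyc_lt (int i) (int k) (int l)"
    and cover: "\<And>x. x \<in> set as \<Longrightarrow> \<exists>(a, b)\<in>E. (a, x, b) \<in> R" "\<And>a b. (a, b) \<in> E \<Longrightarrow> a \<in> set as \<and> b \<in> set as"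
  shows "refines (cycle_cover R as) ((\<lambda>(a, b). circ_open R a b) ` E)"
  unfolding refines_def
proof
  let ?n = "length as"
  fix A assume "A \<in> cycle_cover R as"
  then obtain i where i: "i < ?n" "A = circ_open R (as ! i) (as ! ((i + 2) mod ?n))"
    unfolding cycle_cover_def by blast
  define m where "m = (i + 1) mod ?n"
  define l where "l = (i + 2) mod ?n"
  have ml: "m < ?n" "l < ?n" using i(1) by (auto simp: m_def l_def intro!: mod_less_divisor)
  have m: "m = (if i + 1 = ?n then 0 else i + 1)" using i(1) by (simp add: m_def)
  \<comment> \<open>Explicit remainders turn the comparisons of cyclic positions into linear
    arithmetic; two steps from the last index lead to index 1.\<close>
  have l: "l = (if i + 1 = ?n then 1 else if i + 2 = ?n then 0 else i + 2)"
    using i(1) as(2) by (auto simp: l_def mod_if)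
  obtain a b where ab: "(a, b) \<in> E" "(a, as ! m, b) \<in> R"
    using cover(1)[of "as ! m"] ml(1) nth_mem by blast
  obtain u v where uv: "u < ?n" "a = as ! u" "v < ?n" "b = as ! v"
    using cover(2)[OF ab(1)] by (metis in_set_conv_nth)
  have umv: "cyc_lt (int u) (int m) (int v)" using iff[of u m v] ab(2) uv ml(1) by simp
  have "A \<subseteq> circ_open R a b"
  proof
    fix x assume "x \<in> A"
    then have x: "(as ! i, x, as ! l) \<in> R" using i(2) by (simp add: circ_open_def l_def)
    have iml: "(as ! i, as ! m, as ! l) \<in> R"
      using iff[OF i(1) ml] m l i(1) as(2) unfolding cyc_lt_def by (auto split: if_splits)
    have left: "a = as ! i \<or> (a, as ! i, as ! m) \<in> R"
    proof (cases "u = i")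
      case False
      then have "cyc_lt (int u) (int i) (int m)"
        using umv m uv i(1) unfolding cyc_lt_def by (auto split: if_splits)
      then show ?thesis using iff[OF uv(1) i(1) ml(1)] uv by simp
    qed (use uv in simp)
    have right: "b = as ! l \<or> (as ! m, as ! l, b) \<in> R"
    proof (cases "v = l")
      case False
      then have "cyc_lt (int m) (int l) (int v)"
        using umv m l uv i(1) as(2) unfolding cyc_lt_def by (auto split: if_splits)
      then show ?thesis using iff[OF ml uv(3)] uv by simp
    qed (use uv in simp)
    consider "x = as ! m" | "(as ! i, x, as ! m) \<in> R" | "(as ! m, x, as ! l) \<in> R"
    proof (cases "x = as ! m")
      case False
      then have "(as ! i, x, as ! m) \<in> R \<or> (as ! i, as ! m, x) \<in> R"
        using R_total[of "as ! i" x "as ! m"] R_mem[OF x] R_mem[OF iml] R_distinct[OF x]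
          R_distinct[OF iml] by blast
      then show ?thesis using that(2,3) R_mid[OF _ x, of "as ! m"] by blast
    qed
    then have "(a, x, b) \<in> R"
    proof cases
      case 1
      then show ?thesis using ab(2) by simp
    next
      case 2
      then have "(a, x, as ! m) \<in> R" using left R_between(2) by blast
      then show ?thesis using R_trans ab(2) by blast
    next
      case 3
      then have "(as ! m, x, b) \<in> R" using right R_trans by blast
      then show ?thesis using R_between(2) ab(2) by blast
    qed
    then show "x \<in> circ_open R a b" by (simp add: circ_open_def)
  qed
  then show "\<exists>B\<in>(\<lambda>(a, b). circ_open R a b) ` E. A \<subseteq> B" using ab(1) by blast
qed

end

subsection \<open>The Novak completion\<close>

lemma Field_linear_order: "linear_order_on A r \<Longrightarrow> Field r = A"
  unfolding order_on_defs refl_on_def Field_def by blast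

lemma linear_order_on_subset:
  assumes "linear_order_on A r" "B \<subseteq> A"
  shows "linear_order_on B (r \<inter> B \<times> B)"
  unfolding linear_order_on_def partial_order_on_def preorder_on_def
proof (intro conjI)
  show "refl_on B (r \<inter> B \<times> B)"
    using assms unfolding order_on_defs by (auto simp: refl_on_def)
  show "trans (r \<inter> B \<times> B)"
  proof (rule transI)
    fix x y z assume "(x, y) \<in> r \<inter> B \<times> B" "(y, z) \<in> r \<inter> B \<times> B"
    moreover have "trans r" using assms unfolding order_on_defs by blast
    ultimately show "(x, z) \<in> r \<inter> B \<times> B" using transD[of r x y z] by auto
  qed
  show "antisym (r \<inter> B \<times> B)"
    using assms unfolding order_on_defs by (auto simp: antisym_def)
  show "total_on B (r \<inter> B \<times> B)"
    using assms unfolding order_on_defs total_on_def by (auto simp: subset_iff)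
qed simp

lemma novak_orderE:
  assumes "(L1, L2, L3) \<in> novak_order X R"
  obtains A B D r s t where "A \<noteq> {}" "B \<noteq> {}" "D \<noteq> {}"
    "A \<inter> B = {}" "B \<inter> D = {}" "A \<inter> D = {}" "A \<union> B \<union> D = X"
    "linear_order_on A r" "linear_order_on B s" "linear_order_on D t"
    "L1 = ordinal_sum3 r s t" "L2 = ordinal_sum3 s t r" "L3 = ordinal_sum3 t r s"
  using assms unfolding novak_order_def mem_Collect_eq split_conv
  by (elim conjE exE) (rule that)

lemma novak_orderI:
  assumes "L1 \<in> novak_points X R" "L2 \<in> novak_points X R" "L3 \<in> novak_points X R"
    "L1 \<noteq> L2" "L2 \<noteq> L3" "L1 \<noteq> L3"
    "A \<noteq> {}" "B \<noteq> {}" "D \<noteq> {}"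
    "A \<inter> B = {}" "B \<inter> D = {}" "A \<inter> D = {}" "A \<union> B \<union> D = X"
    "linear_order_on A r" "linear_order_on B s" "linear_order_on D t"
    "L1 = ordinal_sum3 r s t" "L2 = ordinal_sum3 s t r" "L3 = ordinal_sum3 t r s"
  shows "(L1, L2, L3) \<in> novak_order X R"
  unfolding novak_order_def mem_Collect_eq split_conv
  by (intro conjI exI) (rule assms)+

lemma novak_order_points:
  assumes "(L1, L2, L3) \<in> novak_order X R"
  shows "L1 \<in> novak_points X R" "L2 \<in> novak_points X R" "L3 \<in> novak_points X R"
    "L1 \<noteq> L2" "L2 \<noteq> L3" "L1 \<noteq> L3"
  using assms unfolding novak_order_def mem_Collect_eq split_conv by simp_all

lemma novak_order_cyc:
  assumes "(L1, L2, L3) \<in> novak_order X R"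
  shows "(L2, L3, L1) \<in> novak_order X R"
proof -
  obtain A B D r s t where *: "A \<noteq> {}" "B \<noteq> {}" "D \<noteq> {}" "A \<inter> B = {}" "B \<inter> D = {}" "A \<inter> D = {}"
      "A \<union> B \<union> D = X" "linear_order_on A r" "linear_order_on B s" "linear_order_on D t"
      "L1 = ordinal_sum3 r s t" "L2 = ordinal_sum3 s t r" "L3 = ordinal_sum3 t r s"
    using assms by (rule novak_orderE)
  note mem = novak_order_points[OF assms]
  show ?thesis
    by (rule novak_orderI[OF mem(2,3,1,5) mem(6)[symmetric] mem(4)[symmetric] *(2,3,1) *(5) _ _ _
          *(9,10,8) *(12,13,11)]) (use *(4,6,7) in blast)+
qed

context circular_order_set
begin

abbreviation "\<N> \<equiv> novak_points C R"
abbreviation "\<O> \<equiv> novak_order C R"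
abbreviation "\<nu> \<equiv> lower_cut C R"

text \<open>Every \<open>a\<close> below \<open>b\<close> other than \<open>z\<close> gives
  \<open>[z,a,b]\<close>, and asymmetry excludes the reverse, so the least element determines the
  whole cut.\<close>

lemma circ_cut_with_least:
  assumes L: "circ_cut C R L" and z: "z \<in> C" "\<forall>y\<in>C. (z, y) \<in> L"
  shows "L = \<nu> z"
proof -
  interpret L: linear_order_set C L
    using L by unfold_locales (simp add: circ_cut_def)
  have cut: "(x, y, w) \<in> R" if "(x, y) \<in> L" "x \<noteq> y" "(y, w) \<in> L" "y \<noteq> w" for x y w
    using L that unfolding circ_cut_def by blast
  have "(a, b) \<in> L \<longleftrightarrow> (a, b) \<in> \<nu> z" for a b
  proof
    assume ab: "(a, b) \<in> L"
    then have "(z, a, b) \<in> R" if "a \<noteq> z" "a \<noteq> b" using cut[of z a b] z that L.s_mem by blast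
    then show "(a, b) \<in> \<nu> z" using L.s_mem[OF ab] unfolding lower_cut_def by blast
  next
    assume ab: "(a, b) \<in> \<nu> z"
    then have mem: "a \<in> C" "b \<in> C" unfolding lower_cut_def by auto
    consider "a = z" | "a = b" | "(z, a, b) \<in> R" using ab unfolding lower_cut_def by blast
    then show "(a, b) \<in> L"
    proof cases
      case 3
      show ?thesis
      proof (rule ccontr)
        assume "(a, b) \<notin> L"
        then have "(b, a) \<in> L" using L.s_total mem by blast
        then have "(z, b, a) \<in> R" using cut[of z b a] z mem R_distinct[OF 3] by blast
        then show False using 3 R_asym R_cyc by blast
      qed
    qed (use z mem L.s_refl in auto)
  qed
  then show ?thesis by auto
qed

lemma cut_mem: "circ_cut C R L \<Longrightarrow> (a, b) \<in> L \<Longrightarrow> a \<in> C \<and> b \<in> C"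
  unfolding circ_cut_def linear_order_on_def partial_order_on_def preorder_on_def by auto

lemma lower_cut_least: "z \<in> C \<Longrightarrow> y \<in> C \<Longrightarrow> (z, y) \<in> \<nu> z"
  unfolding lower_cut_def by simp

lemma inj_lower_cut: "inj_on \<nu> C"
proof (rule inj_onI)
  fix a b assume ab: "a \<in> C" "b \<in> C" "\<nu> a = \<nu> b"
  interpret L: linear_order_set C "\<nu> a"
    using linear_lower_cut[OF ab(1)] by unfold_locales
  show "a = b" using lower_cut_least[OF ab(1,2)] lower_cut_least[OF ab(2,1)] ab(3) L.s_antisym by simp
qed

lemma novak_cut: "L \<in> \<N> \<Longrightarrow> circ_cut C R L"
  unfolding novak_points_def circ_gap_def using circ_cut_lower_cut by blast

lemma novak_cases:
  assumes "L \<in> \<N>"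
  obtains z where "z \<in> C" "L = \<nu> z" | "circ_gap C R L"
  using assms unfolding novak_points_def by blast

text \<open>The only cuts left out are those with a greatest but no least element: they mark the
  position immediately behind a point that has no next point.\<close>

lemma novak_mem_iff:
  assumes "C \<noteq> {}"
  shows "L \<in> \<N> \<longleftrightarrow> circ_cut C R L \<and>
    ((\<exists>x\<in>C. \<forall>y\<in>C. (x, y) \<in> L) \<or> \<not> (\<exists>x\<in>C. \<forall>y\<in>C. (y, x) \<in> L))"
proof
  assume "L \<in> \<N>"
  then show "circ_cut C R L \<and> ((\<exists>x\<in>C. \<forall>y\<in>C. (x, y) \<in> L) \<or> \<not> (\<exists>x\<in>C. \<forall>y\<in>C. (y, x) \<in> L))"
    using novak_cut novak_cases[of L] lower_cut_least unfolding circ_gap_def by metis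
next
  assume "circ_cut C R L \<and> ((\<exists>x\<in>C. \<forall>y\<in>C. (x, y) \<in> L) \<or> \<not> (\<exists>x\<in>C. \<forall>y\<in>C. (y, x) \<in> L))"
  then show "L \<in> \<N>"
    using circ_cut_with_least[of L] unfolding novak_points_def circ_gap_def by blast
qed

text \<open>The least element of an ordinal sum lies in its first summand, so \<open>a\<close>,
  \<open>b\<close>, \<open>c\<close> lie in \<open>A\<close>, \<open>B\<close>, \<open>D\<close>
  respectively and increase in the cut \<open>\<nu> a\<close>.\<close>

lemma novak_order_lower_cut_imp:
  assumes "(\<nu> a, \<nu> b, \<nu> c) \<in> \<O>" "a \<in> C" "b \<in> C" "c \<in> C"
  shows "(a, b, c) \<in> R"
proof -
  obtain A B D r s t where *: "A \<noteq> {}" "B \<noteq> {}" "D \<noteq> {}" "A \<inter> B = {}" "B \<inter> D = {}" "A \<inter> D = {}"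
      "A \<union> B \<union> D = C" "linear_order_on A r" "linear_order_on B s" "linear_order_on D t"
      "\<nu> a = ordinal_sum3 r s t" "\<nu> b = ordinal_sum3 s t r" "\<nu> c = ordinal_sum3 t r s"
    using assms(1) by (rule novak_orderE)
  note F = Field_linear_order[OF *(8)] Field_linear_order[OF *(9)] Field_linear_order[OF *(10)]
  have first: "z \<in> A'" if sum: "\<nu> z = ordinal_sum3 r' s' t'" "Field r' = A'" "Field s' = B'" "Field t' = D'"
      "A' \<noteq> {}" "A' \<union> B' \<union> D' = C" "z \<in> C" for z A' B' D' r' s' t'
  proof (rule ccontr)
    assume z: "z \<notin> A'"
    interpret L: linear_order_set C "\<nu> z"
      using linear_lower_cut[OF that(7)] by unfold_locales
    obtain y where y: "y \<in> A'" using sum(5) by blast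
    have "(y, z) \<in> \<nu> z" unfolding sum(1) ordinal_sum3_def using sum(2-4,6,7) y z by blast
    moreover have "(z, y) \<in> \<nu> z" using lower_cut_least that y by blast
    ultimately have "y = z" using L.s_antisym by blast
    then show False using y z by blast
  qed
  have "a \<in> A" by (rule first[OF *(11) F *(1,7) assms(2)])
  moreover have "b \<in> B" by (rule first[OF *(12) F(2,3,1) *(2) _ assms(3)]) (use *(7) in blast)
  moreover have "c \<in> D" by (rule first[OF *(13) F(3,1,2) *(3) _ assms(4)]) (use *(7) in blast)
  ultimately have "(a, b) \<in> \<nu> a" "(b, c) \<in> \<nu> a" "a \<noteq> b" "b \<noteq> c"
    unfolding *(11) ordinal_sum3_def F using *(4-6) by blast+
  then show ?thesis using circ_cut_lower_cut[OF assms(2)] unfolding circ_cut_def by blast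
qed

end

section \<open>Cuts as initial segments of the order starting at a base point\<close>

locale pointed_circular_order = circular_order_set C R for C :: "'c set" and R +
  fixes p0 :: 'c
  assumes p0_mem: "p0 \<in> C"
begin

abbreviation "M \<equiv> lower_cut C R p0"

sublocale M: linear_order_set C M
  using linear_lower_cut[OF p0_mem] by unfold_locales

text \<open>A cut \<open>L\<close> is the ordinal sum of \<open>C - seg L\<close> and \<open>seg L\<close>, both ordered by \<open>M\<close>, so it is determined by
  the initial segment \<open>seg L\<close> of \<open>M\<close>, and the circular order of cuts becomes cyclic inclusion.\<close>

definition seg :: "'c rel \<Rightarrow> 'c set" where
  "seg L = {y. (p0, y) \<in> L}"

lemma p0_least: "y \<in> C \<Longrightarrow> (p0, y) \<in> M"
  by (rule lower_cut_least[OF p0_mem])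

text \<open>All comparisons pass through \<open>p0\<close>. Two elements behind \<open>p0\<close> in
  \<open>L\<close> give \<open>[p0,a,b]\<close>, two in front of it give \<open>[a,b,p0]\<close>, a
  rotation of the same; so inside each part \<open>L\<close> agrees with \<open>M\<close>. An
  \<open>a\<close> in front of \<open>p0\<close> and a \<open>b\<close> other than \<open>p0\<close>
  behind it give \<open>[a,p0,b]\<close>, which puts \<open>b\<close> before \<open>a\<close> in
  \<open>M\<close>.\<close>

lemma seg_facts:
  assumes L: "circ_cut C R L"
  shows "p0 \<in> seg L" "seg L \<subseteq> C"
    "a \<in> seg L \<Longrightarrow> (b, a) \<in> M \<Longrightarrow> b \<in> seg L"
    "a \<in> C \<Longrightarrow> b \<in> C \<Longrightarrow> (a, b) \<in> L \<longleftrightarrow> (a \<in> seg L \<longleftrightarrow> b \<in> seg L) \<and> (a, b) \<in> M \<or> a \<notin> seg L \<and> b \<in> seg L"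
proof -
  interpret L: linear_order_set C L
    using L by unfold_locales (simp add: circ_cut_def)
  have cut: "(x, y, w) \<in> R" if "(x, y) \<in> L" "x \<noteq> y" "(y, w) \<in> L" "y \<noteq> w" for x y w
    using L that unfolding circ_cut_def by blast
  show "p0 \<in> seg L" "seg L \<subseteq> C" using L.s_refl p0_mem L.s_mem unfolding seg_def by blast+
  have out: "(y, p0) \<in> L \<and> y \<noteq> p0" if "y \<in> C" "y \<notin> seg L" for y
    using that L.s_total[OF p0_mem, of y] L.s_refl p0_mem unfolding seg_def by blast
  have same: "(a, b) \<in> M" if ab: "(a, b) \<in> L" "a \<in> seg L \<longleftrightarrow> b \<in> seg L" for a b
  proof (cases "a = b \<or> a = p0")
    case True
    then show ?thesis using M.s_refl p0_least L.s_mem[OF ab(1)] by blast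
  next
    case False
    have mem: "a \<in> C" "b \<in> C" using L.s_mem[OF ab(1)] by auto
    have "(p0, a, b) \<in> R"
    proof (cases "a \<in> seg L")
      case True
      then show ?thesis using cut[of p0 a b] ab False unfolding seg_def by blast
    next
      case notin: False
      then have "(a, b, p0) \<in> R" using cut[of a b p0] ab False out mem by blast
      then show ?thesis using R_cyc by blast
    qed
    then show ?thesis unfolding lower_cut_def using mem by blast
  qed
  have diff: "(b, a) \<in> M \<and> (a, b) \<in> L \<and> a \<noteq> b" if "a \<in> C" "a \<notin> seg L" "b \<in> seg L" for a b
  proof -
    have ao: "(a, p0) \<in> L" "a \<noteq> p0" using out that by blast+
    have ob: "(p0, b) \<in> L" "b \<in> C" using that L.s_mem unfolding seg_def by blast+
    have "(p0, b, a) \<in> R" if "b \<noteq> p0" using cut[of a p0 b] ao ob that R_cyc by blast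
    then have "(b, a) \<in> M" unfolding lower_cut_def using ob \<open>a \<in> C\<close> by blast
    then show ?thesis using L.s_trans[OF ao(1) ob(1)] that by blast
  qed
  show "b \<in> seg L" if "a \<in> seg L" "(b, a) \<in> M"
  proof (rule ccontr)
    assume "b \<notin> seg L"
    then show False using diff[of b a] that M.s_mem M.s_antisym by blast
  qed
  show "(a, b) \<in> L \<longleftrightarrow> (a \<in> seg L \<longleftrightarrow> b \<in> seg L) \<and> (a, b) \<in> M \<or> a \<notin> seg L \<and> b \<in> seg L"
    if ab: "a \<in> C" "b \<in> C"
  proof
    assume "(a, b) \<in> L"
    then show "(a \<in> seg L \<longleftrightarrow> b \<in> seg L) \<and> (a, b) \<in> M \<or> a \<notin> seg L \<and> b \<in> seg L"
      using same[of a b] diff[of b a] ab L.s_antisym by blast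
  next
    assume *: "(a \<in> seg L \<longleftrightarrow> b \<in> seg L) \<and> (a, b) \<in> M \<or> a \<notin> seg L \<and> b \<in> seg L"
    show "(a, b) \<in> L"
    proof (cases "a \<notin> seg L \<and> b \<in> seg L")
      case True
      then show ?thesis using diff ab by blast
    next
      case False
      then have "(a \<in> seg L \<longleftrightarrow> b \<in> seg L) \<and> (a, b) \<in> M" using * by blast
      then show ?thesis using same[of b a] L.s_total[OF ab] M.s_antisym[of a b] L.s_refl[OF ab(1)] by blast
    qed
  qed
qed

lemma seg_total:
  assumes "circ_cut C R L" "circ_cut C R L'"
  shows "seg L \<subseteq> seg L' \<or> seg L' \<subseteq> seg L"
proof (rule ccontr)
  assume "\<not> (seg L \<subseteq> seg L' \<or> seg L' \<subseteq> seg L)"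
  then obtain x y where xy: "x \<in> seg L" "x \<notin> seg L'" "y \<in> seg L'" "y \<notin> seg L" by blast
  then have "(x, y) \<in> M \<or> (y, x) \<in> M"
    using seg_facts(2)[OF assms(1)] seg_facts(2)[OF assms(2)] M.s_total by blast
  then show False using xy seg_facts(3)[OF assms(1)] seg_facts(3)[OF assms(2)] by blast
qed

lemma seg_inj:
  assumes "circ_cut C R L" "circ_cut C R L'" "seg L = seg L'"
  shows "L = L'"
proof -
  have mem: "a \<in> C \<and> b \<in> C" if "(a, b) \<in> L \<or> (a, b) \<in> L'" for a b
    using cut_mem assms(1,2) that by blast
  have "(a, b) \<in> L \<longleftrightarrow> (a, b) \<in> L'" for a b
    using mem[of a b] seg_facts(4)[OF assms(1), of a b] seg_facts(4)[OF assms(2), of a b] assms(3) by blast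
  then show ?thesis by auto
qed

text \<open>From \<open>p0\<close> on, the order that starts at \<open>z\<close> runs through what
  precedes \<open>z\<close> in \<open>M\<close>. Segments always contain \<open>p0\<close>, so the
  base point itself receives \<open>C\<close> and sits at the top of the inclusion order rather than
  at the bottom.\<close>

lemma seg_lower_cut:
  assumes "z \<in> C"
  shows "seg (\<nu> z) = (if z = p0 then C else {y. lin_less M y z})"
proof (cases "z = p0")
  case True
  then show ?thesis unfolding seg_def lower_cut_def using p0_mem by auto
next
  case False
  have "(p0, y) \<in> \<nu> z \<longleftrightarrow> lin_less M y z" for y
    unfolding lower_cut_less_iff[OF p0_mem] unfolding lower_cut_def mem_Collect_eq split_conv
    using False assms p0_mem R_cyc_iff[of p0 y z] R_mem[of z p0 y] R_distinct[of z p0 y] by blast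
  then show ?thesis using False unfolding seg_def by simp
qed

text \<open>The segment of a sum runs from \<open>p0\<close> to its end. With \<open>p0\<close> in
  \<open>A\<close>, the blocks following \<open>A\<close> in the three sums are none,
  \<open>B\<close>, and both \<open>B\<close> and \<open>D\<close>.\<close>

lemma ordinal_sum_seg:
  assumes "linear_order_on A r" "linear_order_on B s" "linear_order_on D t"
    "A \<inter> B = {}" "B \<inter> D = {}" "A \<inter> D = {}" "B \<noteq> {}" "D \<noteq> {}" "p0 \<in> A"
  shows "seg (ordinal_sum3 s t r) \<subset> seg (ordinal_sum3 t r s)"
    "seg (ordinal_sum3 t r s) \<subset> seg (ordinal_sum3 r s t)"
proof -
  note F = Field_linear_order[OF assms(1)] Field_linear_order[OF assms(2)] Field_linear_order[OF assms(3)]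
  have mem: "(a, b) \<in> r \<Longrightarrow> a \<in> A \<and> b \<in> A" "(a, b) \<in> s \<Longrightarrow> a \<in> B \<and> b \<in> B"
      "(a, b) \<in> t \<Longrightarrow> a \<in> D \<and> b \<in> D" for a b
    using assms(1-3) unfolding order_on_defs by blast+
  let ?A = "{y. (p0, y) \<in> r}"
  have no: "(p0, y) \<notin> s" "(p0, y) \<notin> t" "p0 \<notin> B" "p0 \<notin> D" for y
    using assms(4-6,9) mem by blast+
  have "seg (ordinal_sum3 s t r) = ?A"
    unfolding seg_def ordinal_sum3_def F using no by simp
  moreover have "seg (ordinal_sum3 t r s) = ?A \<union> B"
    unfolding seg_def ordinal_sum3_def F using no assms(9) by auto
  moreover have "seg (ordinal_sum3 r s t) = ?A \<union> B \<union> D"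
    unfolding seg_def ordinal_sum3_def F using no assms(9) by auto
  moreover have "?A \<subset> ?A \<union> B" "?A \<union> B \<subset> ?A \<union> B \<union> D"
  proof -
    obtain b d where "b \<in> B" "d \<in> D" using assms(7,8) by blast
    moreover have "b \<notin> ?A" "d \<notin> ?A" "d \<notin> B" using calculation mem(1) assms(4-6) by blast+
    ultimately show "?A \<subset> ?A \<union> B" "?A \<union> B \<subset> ?A \<union> B \<union> D" by blast+
  qed
  ultimately show "seg (ordinal_sum3 s t r) \<subset> seg (ordinal_sum3 t r s)"
    "seg (ordinal_sum3 t r s) \<subset> seg (ordinal_sum3 r s t)"
    by (simp_all only:)
qed

lemma novak_order_imp_seg:
  assumes "(L1, L2, L3) \<in> \<O>"
  shows "seg L1 \<subset> seg L2 \<and> seg L2 \<subset> seg L3 \<or> seg L2 \<subset> seg L3 \<and> seg L3 \<subset> seg L1 \<or>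
    seg L3 \<subset> seg L1 \<and> seg L1 \<subset> seg L2"
proof -
  obtain A B D r s t where *: "A \<noteq> {}" "B \<noteq> {}" "D \<noteq> {}" "A \<inter> B = {}" "B \<inter> D = {}" "A \<inter> D = {}"
      "A \<union> B \<union> D = C" "linear_order_on A r" "linear_order_on B s" "linear_order_on D t"
      "L1 = ordinal_sum3 r s t" "L2 = ordinal_sum3 s t r" "L3 = ordinal_sum3 t r s"
    using assms by (rule novak_orderE)
  have "B \<inter> A = {}" "D \<inter> B = {}" "D \<inter> A = {}" using * by blast+
  consider "p0 \<in> A" | "p0 \<in> B" | "p0 \<in> D" using p0_mem *(7) by blast
  then show ?thesis
  proof cases
    case 1
    show ?thesis
      unfolding *(11-13) using ordinal_sum_seg[OF *(8,9,10,4,5,6,2,3) 1] by blast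
  next
    case 2
    show ?thesis
      unfolding *(11-13)
      using ordinal_sum_seg[OF *(9,10,8,5) _ \<open>B \<inter> A = {}\<close> *(3,1) 2] \<open>D \<inter> A = {}\<close> by blast
  next
    case 3
    show ?thesis
      unfolding *(11-13)
      using ordinal_sum_seg[OF *(10,8,9) \<open>D \<inter> A = {}\<close> *(4) \<open>D \<inter> B = {}\<close> *(1,2) 3] by blast
  qed
qed

text \<open>Seen from \<open>p0\<close> the cuts occur in the order \<open>L1\<close>,
  \<open>L2\<close>, \<open>L3\<close>, and the blocks are the arcs between consecutive
  cuts.\<close>

lemma seg_imp_novak_order:
  assumes L: "L1 \<in> \<N>" "L2 \<in> \<N>" "L3 \<in> \<N>" and seg: "seg L1 \<subset> seg L2" "seg L2 \<subset> seg L3"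
  shows "(L1, L2, L3) \<in> \<O>"
proof -
  note cut = novak_cut[OF L(1)] novak_cut[OF L(2)] novak_cut[OF L(3)]
  note f1 = seg_facts[OF cut(1)] and f2 = seg_facts[OF cut(2)] and f3 = seg_facts[OF cut(3)]
  define A where "A = seg L2 - seg L1"
  define B where "B = seg L3 - seg L2"
  \<comment> \<open>The arc from \<open>L3\<close> back to \<open>L1\<close> passes through
    \<open>p0\<close>, so it consists of a final and an initial piece of \<open>M\<close>, in this
    order in \<open>L1\<close>.\<close>
  define D where "D = (C - seg L3) \<union> seg L1"
  define r where "r = L1 \<inter> A \<times> A"
  define s where "s = L1 \<inter> B \<times> B"
  define t where "t = L1 \<inter> D \<times> D"
  have sub: "A \<subseteq> C" "B \<subseteq> C" "D \<subseteq> C" using f1(2) f2(2) f3(2) unfolding A_def B_def D_def by blast+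
  have lin: "linear_order_on C L1" using cut(1) unfolding circ_cut_def by blast
  note lins = linear_order_on_subset[OF lin sub(1)] linear_order_on_subset[OF lin sub(2)]
    linear_order_on_subset[OF lin sub(3)]
  have lins': "linear_order_on A r" "linear_order_on B s" "linear_order_on D t"
    unfolding r_def s_def t_def using lins by blast+
  note F = Field_linear_order[OF lins'(1)] Field_linear_order[OF lins'(2)] Field_linear_order[OF lins'(3)]
  have memL: "a \<in> C \<and> b \<in> C" if "(a, b) \<in> L1 \<or> (a, b) \<in> L2 \<or> (a, b) \<in> L3" for a b
    using cut_mem cut that by blast
  have part: "A \<noteq> {}" "B \<noteq> {}" "D \<noteq> {}" "A \<inter> B = {}" "B \<inter> D = {}" "A \<inter> D = {}" "A \<union> B \<union> D = C"
    using seg f1(1,2) f2(2) f3(2) unfolding A_def B_def D_def by blast+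
  have Mfacts: "(a \<in> S \<and> b \<notin> S \<longrightarrow> (a, b) \<in> M \<and> (b, a) \<notin> M)"
    if "S = seg L1 \<or> S = seg L2 \<or> S = seg L3" "a \<in> C" "b \<in> C" for a b S
    using that f1(3) f2(3) f3(3) M.s_total[of a b] by blast
  have eq: "(a, b) \<in> L1 \<longleftrightarrow> (a, b) \<in> ordinal_sum3 r s t" "(a, b) \<in> L2 \<longleftrightarrow> (a, b) \<in> ordinal_sum3 s t r"
      "(a, b) \<in> L3 \<longleftrightarrow> (a, b) \<in> ordinal_sum3 t r s" if ab: "a \<in> C" "b \<in> C" for a b
  proof -
    \<comment> \<open>With these facts the three equivalences become propositional in the
      memberships of \<open>a\<close> and \<open>b\<close> in the segments and in the two
      \<open>M\<close>-comparisons.\<close>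
    note m = Mfacts[of "seg L1", OF _ ab, simplified] Mfacts[of "seg L2", OF _ ab, simplified]
      Mfacts[of "seg L3", OF _ ab, simplified] Mfacts[of "seg L1", OF _ ab(2,1), simplified]
      Mfacts[of "seg L2", OF _ ab(2,1), simplified] Mfacts[of "seg L3", OF _ ab(2,1), simplified]
    note e = f1(4)[OF ab] f2(4)[OF ab] f3(4)[OF ab]
    have mono: "a \<in> seg L1 \<longrightarrow> a \<in> seg L2" "a \<in> seg L2 \<longrightarrow> a \<in> seg L3"
        "b \<in> seg L1 \<longrightarrow> b \<in> seg L2" "b \<in> seg L2 \<longrightarrow> b \<in> seg L3"
      using seg by blast+
    show "(a, b) \<in> L1 \<longleftrightarrow> (a, b) \<in> ordinal_sum3 r s t" "(a, b) \<in> L2 \<longleftrightarrow> (a, b) \<in> ordinal_sum3 s t r"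
      "(a, b) \<in> L3 \<longleftrightarrow> (a, b) \<in> ordinal_sum3 t r s"
      unfolding ordinal_sum3_def Un_iff mem_Times_iff F
      unfolding r_def s_def t_def Int_iff mem_Times_iff fst_conv snd_conv e A_def B_def D_def
        Diff_iff Un_iff
      using m mono ab by argo+
  qed
  have memO: "a \<in> C \<and> b \<in> C" if "(a, b) \<in> ordinal_sum3 r s t \<or> (a, b) \<in> ordinal_sum3 s t r \<or>
      (a, b) \<in> ordinal_sum3 t r s" for a b
    using that sub unfolding ordinal_sum3_def F unfolding r_def s_def t_def by blast
  have "(a, b) \<in> L1 \<longleftrightarrow> (a, b) \<in> ordinal_sum3 r s t" "(a, b) \<in> L2 \<longleftrightarrow> (a, b) \<in> ordinal_sum3 s t r"
      "(a, b) \<in> L3 \<longleftrightarrow> (a, b) \<in> ordinal_sum3 t r s" for a b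
    using eq[of a b] memL[of a b] memO[of a b] by blast+
  then have "L1 = ordinal_sum3 r s t" "L2 = ordinal_sum3 s t r" "L3 = ordinal_sum3 t r s"
    by (simp_all add: set_eq_iff split_paired_all)
  moreover have "L1 \<noteq> L2" "L2 \<noteq> L3" "L1 \<noteq> L3" using seg by auto
  ultimately show ?thesis
    by (rule novak_orderI[OF L _ _ _ part lins', rotated 3])
qed

lemma novak_order_iff:
  assumes L: "L1 \<in> \<N>" "L2 \<in> \<N>" "L3 \<in> \<N>"
  shows "(L1, L2, L3) \<in> \<O> \<longleftrightarrow>
    seg L1 \<subset> seg L2 \<and> seg L2 \<subset> seg L3 \<or> seg L2 \<subset> seg L3 \<and> seg L3 \<subset> seg L1 \<or>
    seg L3 \<subset> seg L1 \<and> seg L1 \<subset> seg L2" (is "_ \<longleftrightarrow> ?r")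
proof
  assume ?r
  then consider "(L1, L2, L3) \<in> \<O>" | "(L2, L3, L1) \<in> \<O>" | "(L3, L1, L2) \<in> \<O>"
    using seg_imp_novak_order[OF L] seg_imp_novak_order[OF L(2,3,1)]
      seg_imp_novak_order[OF L(3,1,2)] by blast
  then show "(L1, L2, L3) \<in> \<O>"
    using novak_order_cyc[of L2 L3 L1] novak_order_cyc[of L3 L1 L2] novak_order_cyc[of L3 L1 L2]
      novak_order_cyc[of L1 L2 L3] by cases blast+
qed (rule novak_order_imp_seg)

end

section \<open>Circular order, density and compactness of the Novak points\<close>

context pointed_circular_order
begin

lemma seg_total_novak: "L \<in> \<N> \<Longrightarrow> L' \<in> \<N> \<Longrightarrow> seg L \<subset> seg L' \<or> L = L' \<or> seg L' \<subset> seg L"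
  using seg_total[OF novak_cut novak_cut, of L L'] seg_inj[OF novak_cut novak_cut, of L L'] by blast

lemma circular_novak_pointed: "circular_order \<N> \<O>"
  unfolding circular_order_def
proof (intro conjI allI impI ballI)
  show "\<O> \<subseteq> \<N> \<times> \<N> \<times> \<N>" using novak_order_points by fastforce
next
  fix a b c assume "(a, b, c) \<in> \<O>"
  then show "(b, c, a) \<in> \<O>" by (rule novak_order_cyc)
next
  fix a b c assume abc: "(a, b, c) \<in> \<O>"
  note m = novak_order_points(1-3)[OF abc]
  show "(c, b, a) \<notin> \<O>"
    using abc unfolding novak_order_iff[OF m] novak_order_iff[OF m(3,2,1)] by blast
next
  fix a b c d assume *: "(a, b, c) \<in> \<O> \<and> (a, c, d) \<in> \<O>"
  then have m: "a \<in> \<N>" "b \<in> \<N>" "c \<in> \<N>" "d \<in> \<N>" using novak_order_points by blast+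
  have "seg b \<subset> seg c \<and> seg c \<subset> seg d \<longrightarrow> seg b \<subset> seg d" "seg a \<subset> seg b \<and> seg b \<subset> seg c \<longrightarrow> seg a \<subset> seg c"
    "seg c \<subset> seg d \<and> seg d \<subset> seg a \<longrightarrow> seg c \<subset> seg a" "\<not> (seg a \<subset> seg c \<and> seg c \<subset> seg a)"
    by blast+
  with * show "(a, b, d) \<in> \<O>"
    unfolding novak_order_iff[OF m(1-3)] novak_order_iff[OF m(1,3,4)] novak_order_iff[OF m(1,2,4)]
    by argo
next
  fix a b c assume m: "a \<in> \<N>" "b \<in> \<N>" "c \<in> \<N>" and "a \<noteq> b \<and> b \<noteq> c \<and> a \<noteq> c"
  then show "(a, b, c) \<in> \<O> \<or> (a, c, b) \<in> \<O>"
    unfolding novak_order_iff[OF m] novak_order_iff[OF m(1,3,2)]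
    using seg_total_novak[OF m(1,2)] seg_total_novak[OF m(2,3)] seg_total_novak[OF m(1,3)] by argo
qed

text \<open>In \<open>L\<close> the complement of \<open>seg L\<close> comes first and
  \<open>seg L\<close> last, so an \<open>M\<close>-greatest element of \<open>seg L\<close> would
  be greatest for \<open>L\<close>, and an \<open>M\<close>-least element of the complement would be
  least. If the complement were empty, \<open>p0\<close> would be least.\<close>

lemma gap_seg:
  assumes gap: "circ_gap C R L"
  shows "y \<in> seg L \<Longrightarrow> \<exists>y'\<in>seg L. lin_less M y y'"
    "y \<in> C \<Longrightarrow> y \<notin> seg L \<Longrightarrow> \<exists>y'\<in>C - seg L. lin_less M y' y"
    "seg L \<noteq> C"
proof -
  have cut: "circ_cut C R L" using gap unfolding circ_gap_def by blast
  note f = seg_facts[OF cut]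
  have nog: "\<not> (\<exists>x\<in>C. \<forall>y\<in>C. (y, x) \<in> L)" and nol: "\<not> (\<exists>x\<in>C. \<forall>y\<in>C. (x, y) \<in> L)"
    using gap unfolding circ_gap_def by blast+
  show "\<exists>y'\<in>seg L. lin_less M y y'" if y: "y \<in> seg L"
  proof (rule ccontr)
    assume no: "\<not> (\<exists>y'\<in>seg L. lin_less M y y')"
    have "(a, y) \<in> L" if a: "a \<in> C" for a
      using f(4)[OF a, of y] M.not_lt[of y a] no a y f(2) by blast
    then show False using nog y f(2) by blast
  qed
  show "\<exists>y'\<in>C - seg L. lin_less M y' y" if y: "y \<in> C" "y \<notin> seg L"
  proof (rule ccontr)
    assume no: "\<not> (\<exists>y'\<in>C - seg L. lin_less M y' y)"
    have "(y, a) \<in> L" if a: "a \<in> C" for a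
      using f(4)[OF y(1) a] M.not_lt[of a y] no a y by blast
    then show False using nol y by blast
  qed
  show "seg L \<noteq> C"
  proof
    assume "seg L = C"
    then have "(p0, y) \<in> L" if "y \<in> C" for y using that unfolding seg_def by blast
    then show False using nol p0_mem by blast
  qed
qed

text \<open>If \<open>seg L \<subset> seg L'\<close>, take \<open>y\<close> in the difference. When
  \<open>L'\<close> is a gap, a larger \<open>y'\<close> in \<open>seg L'\<close> leaves room above
  \<open>L\<close>; when \<open>L\<close> is a gap, a smaller \<open>y'\<close> outside
  \<open>seg L\<close> shows that \<open>y\<close> itself does.\<close>

lemma novak_between_pointed:
  assumes L: "L \<in> \<N>" "L' \<in> \<N>" "L \<noteq> L'" and gap: "circ_gap C R L \<or> circ_gap C R L'"
  shows "\<exists>x\<in>C. (L, \<nu> x, L') \<in> \<O>"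
proof -
  note f = seg_facts[OF novak_cut[OF L(1)]] and f' = seg_facts[OF novak_cut[OF L(2)]]
  have nu: "\<nu> x \<in> \<N>" if "x \<in> C" for x using that unfolding novak_points_def by blast
  have iff: "(L, \<nu> x, L') \<in> \<O> \<longleftrightarrow>
      seg L \<subset> seg (\<nu> x) \<and> seg (\<nu> x) \<subset> seg L' \<or> seg (\<nu> x) \<subset> seg L' \<and> seg L' \<subset> seg L \<or>
      seg L' \<subset> seg L \<and> seg L \<subset> seg (\<nu> x)" if "x \<in> C" for x
    using novak_order_iff[OF L(1) nu[OF that] L(2)] .
  have below: "S \<subseteq> seg (\<nu> y)" if "y \<in> C" "y \<notin> S" "S = seg L \<or> S = seg L'" for S y
  proof -
    have "S \<subseteq> C" "p0 \<in> S" using that(3) f(1,2) f'(1,2) by blast+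
    moreover have "lin_less M x y" if "x \<in> S" for x
      using that \<open>S \<subseteq> C\<close> \<open>y \<in> C\<close> \<open>y \<notin> S\<close> M.not_lt[of x y] \<open>S = seg L \<or> S = seg L'\<close> f(3) f'(3) by blast
    moreover have "y \<noteq> p0" using that(2) calculation(2) by blast
    ultimately show ?thesis using seg_lower_cut[OF \<open>y \<in> C\<close>] by auto
  qed
  have above: "seg (\<nu> y) \<subset> seg L'" if "y \<in> seg L'" "y \<noteq> p0" for y
  proof -
    have yC: "y \<in> C" using that f'(2) by blast
    have "seg (\<nu> y) = {x. lin_less M x y}" using seg_lower_cut[OF yC] that(2) by simp
    moreover have "x \<in> seg L'" if "lin_less M x y" for x
      using f'(3)[OF \<open>y \<in> seg L'\<close>] that unfolding lin_less_def by blast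
    ultimately show ?thesis using that(1) M.lt_irrefl by blast
  qed
  consider "seg L \<subset> seg L'" | "seg L' \<subset> seg L" using seg_total_novak[OF L(1,2)] L(3) by blast
  then show ?thesis
  proof cases
    case 1
    then obtain y where y: "y \<in> seg L'" "y \<notin> seg L" by blast
    then have y0: "y \<noteq> p0" "y \<in> C" using f(1) f'(2) by blast+
    show ?thesis
    proof (cases "circ_gap C R L'")
      case True
      obtain y' where y': "y' \<in> seg L'" "lin_less M y y'" using gap_seg(1)[OF True y(1)] by blast
      have "y' \<notin> seg L" using f(3)[of y' y] y'(2) y(2) unfolding lin_less_def by blast
      then have "y' \<in> C" "y' \<noteq> p0" "seg L \<subseteq> seg (\<nu> y')" using below y'(1) f'(2) f(1) by blast+
      moreover have "y \<in> seg (\<nu> y')" using seg_lower_cut[of y'] calculation y'(2) by simp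
      ultimately show ?thesis using iff above[OF y'(1)] y(2) by blast
    next
      case False
      then have "circ_gap C R L" using gap by blast
      then obtain y' where "y' \<in> C" "y' \<notin> seg L" "lin_less M y' y"
        using gap_seg(2) y0(2) y(2) by blast
      then have "y' \<in> seg (\<nu> y)" using seg_lower_cut[OF y0(2)] y0 by simp
      then show ?thesis
        using iff[OF y0(2)] above[OF y(1) y0(1)] below[OF y0(2) y(2)] \<open>y' \<notin> seg L\<close> y0(2) by blast
    qed
  next
    case 2
    show ?thesis
    \<comment> \<open>Now the arc from \<open>L\<close> to \<open>L'\<close> runs past the base
      point, so \<open>\<nu> p0\<close> lies on it unless \<open>L\<close> is
      \<open>\<nu> p0\<close>; in that case a point of \<open>seg L'\<close> other than
      \<open>p0\<close> is used.\<close>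
    proof (cases "seg L = C")
      case False
      then have "seg L \<subset> seg (\<nu> p0)" using seg_lower_cut[OF p0_mem] f(2) by auto
      then show ?thesis using iff[OF p0_mem] 2 p0_mem by blast
    next
      case True
      then have "circ_gap C R L'" using gap gap_seg(3) by blast
      then obtain y' where y': "y' \<in> seg L'" "lin_less M p0 y'" using gap_seg(1) f'(1) by blast
      then have "y' \<noteq> p0" "y' \<in> C" using M.lt_irrefl f'(2) by blast+
      then show ?thesis using iff[of y'] above[OF y'(1)] 2 by blast
    qed
  qed
qed

text \<open>The inverse of \<open>seg\<close>: the complement of \<open>U\<close> is placed in front
  of \<open>U\<close>.\<close>

definition cut_of :: "'c set \<Rightarrow> 'c rel" where
  "cut_of U = {(a, b). a \<in> C \<and> b \<in> C \<and> ((a \<in> U \<longleftrightarrow> b \<in> U) \<and> (a, b) \<in> M \<or> a \<notin> U \<and> b \<in> U)}"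

lemma circ_cut_cut_of:
  assumes U: "U \<subseteq> C" "\<And>a b. a \<in> U \<Longrightarrow> (b, a) \<in> M \<Longrightarrow> b \<in> U"
  shows "circ_cut C R (cut_of U)"
  unfolding circ_cut_def linear_order_on_def partial_order_on_def preorder_on_def
proof (intro conjI allI impI)
  show "cut_of U \<subseteq> C \<times> C" unfolding cut_of_def by blast
  show "refl_on C (cut_of U)" unfolding cut_of_def using M.s_refl by (intro refl_onI) simp
  show "trans (cut_of U)"
  proof (rule transI)
    fix a b c assume "(a, b) \<in> cut_of U" "(b, c) \<in> cut_of U"
    then show "(a, c) \<in> cut_of U" unfolding cut_of_def using M.s_trans[of a b c] by auto
  qed
  show "antisym (cut_of U)"
    unfolding cut_of_def using M.s_antisym by (intro antisymI) auto
  show "total_on C (cut_of U)"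
    unfolding cut_of_def total_on_def using M.s_total by auto
  fix a b c assume *: "(a, b) \<in> cut_of U \<and> a \<noteq> b \<and> (b, c) \<in> cut_of U \<and> b \<noteq> c"
  then have m: "a \<in> C" "b \<in> C" "c \<in> C" unfolding cut_of_def by auto
  have out: "lin_less M y x" if "x \<in> C" "x \<notin> U" "y \<in> U" for x y
    using that U M.not_lt[of y x] by blast
  show "(a, b, c) \<in> R"
    unfolding R_iff_cut[OF circ_cut_lower_cut[OF p0_mem] m]
    using * out[of a b] out[of a c] out[of b c] m unfolding cut_of_def lin_less_def by auto
qed

lemma seg_cut_of: "U \<subseteq> C \<Longrightarrow> p0 \<in> U \<Longrightarrow> seg (cut_of U) = U"
  unfolding seg_def cut_of_def using p0_mem p0_least by auto

text \<open>Cutting the circle of Novak points at \<open>\<nu> p0\<close> and doubling this point, with copies \<open>{}\<close> and \<open>C\<close>,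
  gives a linear order that is complete because it is closed under unions.\<close>

abbreviation "segs \<equiv> insert {} (seg ` \<N>)"
abbreviation "segs_order \<equiv> {(A, B). A \<in> segs \<and> B \<in> segs \<and> A \<subseteq> B}"

lemma segs_total:
  assumes "A \<in> segs" "B \<in> segs"
  shows "A \<subseteq> B \<or> B \<subseteq> A"
  using assms seg_total[OF novak_cut novak_cut] by (elim insertE imageE) simp_all

lemma linear_segs: "linear_order_on segs segs_order"
  unfolding linear_order_on_def partial_order_on_def preorder_on_def
proof (intro conjI)
  show "segs_order \<subseteq> segs \<times> segs" by blast
  show "refl_on segs segs_order" by (rule refl_onI) simp
  show "trans segs_order" by (rule transI) auto
  show "antisym segs_order" by (rule antisymI) auto
  show "total_on segs segs_order" unfolding total_on_def using segs_total by simp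
qed

text \<open>If the cut belonging to a new nonempty union \<open>U\<close> had a greatest element
  \<open>x\<close>, then \<open>x\<close> would lie in some \<open>A \<in> S\<close>, which would
  contain all of \<open>U\<close>. So the cut has no greatest element and is a Novak point. Points
  other than \<open>p0\<close> appear here as strict segments, which is why unions are used, whereas
  the Dedekind points \<open>{y. y \<le> x}\<close> call for intersections.\<close>

lemma segs_Union:
  assumes "S \<subseteq> segs"
  shows "\<Union>S \<in> segs"
proof (cases "\<Union>S \<in> S \<or> \<Union>S = {}")
  case True
  then show ?thesis using assms by auto
next
  case False
  let ?U = "\<Union>S"
  have S: "A = {} \<or> (\<exists>L. circ_cut C R L \<and> A = seg L)" if "A \<in> S" for A
    using that assms novak_cut by blast
  have UC: "?U \<subseteq> C" using S seg_facts(2) by blast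
  have down: "b \<in> A" if "A \<in> S" "a \<in> A" "(b, a) \<in> M" for A a b
    using S[OF that(1)] that(2,3) seg_facts(3) by blast
  then have downU: "\<And>a b. a \<in> ?U \<Longrightarrow> (b, a) \<in> M \<Longrightarrow> b \<in> ?U" by blast
  have p0U: "p0 \<in> ?U" using False downU p0_least UC by blast
  note cut = circ_cut_cut_of[OF UC downU]
  have "\<not> (\<exists>x\<in>C. \<forall>y\<in>C. (y, x) \<in> cut_of ?U)"
  proof
    assume "\<exists>x\<in>C. \<forall>y\<in>C. (y, x) \<in> cut_of ?U"
    then obtain x where x: "x \<in> C" "\<And>y. y \<in> C \<Longrightarrow> (y, x) \<in> cut_of ?U" by blast
    have xU: "x \<in> ?U" using x(2)[OF p0_mem] p0U unfolding cut_of_def by blast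
    then obtain A where A: "A \<in> S" "x \<in> A" by blast
    have "?U \<subseteq> A"
    proof
      fix y assume y: "y \<in> ?U"
      then have "(y, x) \<in> M" using x(2)[of y] UC xU unfolding cut_of_def by blast
      then show "y \<in> A" by (rule down[OF A])
    qed
    then have "?U = A" using A(1) by blast
    then show False using False A(1) by blast
  qed
  then have "cut_of ?U \<in> \<N>" using novak_mem_iff[of "cut_of ?U"] cut p0_mem by auto
  then show ?thesis using seg_cut_of[OF UC p0U] by (metis image_eqI insertI2)
qed

interpretation S: linear_order_set segs segs_order
  using linear_segs by unfold_locales

lemma compact_segs: "compact_space (lin_topology segs segs_order)"
proof (rule S.compact_lin)
  fix T assume "T \<subseteq> segs"
  then show "\<exists>u\<in>segs. (\<forall>x\<in>T. (x, u) \<in> segs_order) \<and>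
      (\<forall>v\<in>segs. (\<forall>x\<in>T. (x, v) \<in> segs_order) \<longrightarrow> (u, v) \<in> segs_order)"
    using segs_Union[of T] by (intro bexI[of _ "\<Union>T"]) auto
qed

lemma segs_less_iff: "lin_less segs_order A B \<longleftrightarrow> A \<in> segs \<and> B \<in> segs \<and> A \<subset> B"
  unfolding lin_less_def by auto

lemma openin_segs_above: "P \<in> segs \<Longrightarrow> openin (lin_topology segs segs_order) {A\<in>segs. P \<subset> A}"
  using S.openin_upper_ray[of P] unfolding segs_less_iff by (simp cong: conj_cong)

lemma openin_segs_below: "P \<in> segs \<Longrightarrow> openin (lin_topology segs segs_order) {A\<in>segs. A \<subset> P}"
  using S.openin_lower_ray[of P] unfolding segs_less_iff by (simp cong: conj_cong)

text \<open>Glues the ends \<open>{}\<close> and \<open>C\<close> of the linear order to the one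
  Novak point \<open>\<nu> p0\<close>; on nonempty segments it inverts \<open>seg\<close>.\<close>

definition of_seg :: "'c set \<Rightarrow> 'c rel" where
  "of_seg A = (if A = {} then \<nu> p0 else the_inv_into \<N> seg A)"

lemma inj_seg: "inj_on seg \<N>"
  by (rule inj_onI) (use seg_inj novak_cut in blast)

lemma of_seg_seg:
  assumes "L \<in> \<N>"
  shows "of_seg (seg L) = L"
  using seg_facts(1)[OF novak_cut[OF assms]] the_inv_into_f_f[OF inj_seg assms]
  unfolding of_seg_def by auto

lemma nu_p0: "\<nu> p0 \<in> \<N>" "seg (\<nu> p0) = C"
  using p0_mem seg_lower_cut[OF p0_mem] unfolding novak_points_def by auto

lemma of_seg_image: "of_seg ` segs = \<N>"
proof -
  have "of_seg ` seg ` \<N> = \<N>" unfolding image_image using of_seg_seg by simp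
  moreover have "of_seg {} \<in> \<N>" using nu_p0 by (simp add: of_seg_def)
  ultimately show ?thesis by auto
qed

text \<open>Preimages of basic open sets are computed by position relative to the base point: an arc
  avoiding \<open>\<nu> p0\<close> pulls back to an interval of segments, an arc through it to two
  rays at opposite ends, and an arc starting at it to a ray without the end \<open>{}\<close>. The
  complement of \<open>\<nu> p0\<close> lacks both ends.\<close>

lemma of_seg_continuous: "continuous_map (lin_topology segs segs_order) (novak_topology C R) of_seg"
  unfolding novak_topology_def circ_topology_def
proof (rule continuous_on_generated_topo)
  let ?T = "lin_topology segs segs_order"
  interpret N: circular_order_set "\<N>" "\<O>"
    using circular_novak_pointed by unfold_locales
  have segC: "seg L \<subseteq> C" "seg L \<noteq> {}" if "L \<in> \<N>" for L
    using seg_facts(1,2)[OF novak_cut[OF that]] by blast+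
  have point: "openin ?T {A\<in>segs. of_seg A \<noteq> P}" if P: "P \<in> \<N>" for P
  proof (cases "seg P = C")
    case True
    then have "P = \<nu> p0" using seg_inj[OF novak_cut novak_cut] P nu_p0 by blast
    have "{A\<in>segs. of_seg A \<noteq> P} = {A\<in>segs. {} \<subset> A} \<inter> {A\<in>segs. A \<subset> seg P}" (is "?l = ?r")
    proof (rule Set.set_eqI)
      fix A show "A \<in> ?l \<longleftrightarrow> A \<in> ?r"
      proof (cases "A \<in> seg ` \<N>")
        case True
        then obtain L where L: "L \<in> \<N>" "A = seg L" by blast
        have "L \<noteq> P \<longleftrightarrow> seg L \<subset> C"
          using segC[OF L(1)] \<open>seg P = C\<close> seg_inj[OF novak_cut[OF L(1)] novak_cut[OF P]] by auto
        then show ?thesis using L segC[OF L(1)] of_seg_seg[OF L(1)] \<open>seg P = C\<close> by auto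
      next
        case False
        then show ?thesis using \<open>P = \<nu> p0\<close> by (auto simp: of_seg_def)
      qed
    qed
    then show ?thesis
      using openin_segs_above[of "{}"] openin_segs_below[of "seg P"] P by (simp add: openin_Int)
  next
    case False
    have "{A\<in>segs. of_seg A \<noteq> P} = {A\<in>segs. seg P \<subset> A} \<union> {A\<in>segs. A \<subset> seg P}" (is "?l = ?r")
    proof (rule Set.set_eqI)
      fix A show "A \<in> ?l \<longleftrightarrow> A \<in> ?r"
      proof (cases "A \<in> seg ` \<N>")
        case True
        then obtain L where L: "L \<in> \<N>" "A = seg L" by blast
        then show ?thesis using seg_total_novak[OF L(1) P] of_seg_seg[OF L(1)] by auto
      next
        case notin: False
        have "\<nu> p0 \<noteq> P" using False nu_p0(2) by blast
        then show ?thesis using notin segC[OF P] by (auto simp: of_seg_def)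
      qed
    qed
    then show ?thesis
      using openin_segs_above[of "seg P"] openin_segs_below[of "seg P"] P by (simp add: openin_Un)
  qed
  have interval: "openin ?T {A\<in>segs. (Q, of_seg A, P) \<in> \<O>}" if PQ: "P \<in> \<N>" "Q \<in> \<N>" "P \<noteq> Q" for P Q
  proof -
    have iff: "(Q, L, P) \<in> \<O> \<longleftrightarrow> seg Q \<subset> seg L \<and> seg L \<subset> seg P \<or> seg L \<subset> seg P \<and> seg P \<subset> seg Q \<or>
        seg P \<subset> seg Q \<and> seg Q \<subset> seg L" if "L \<in> \<N>" for L
      using novak_order_iff[OF PQ(2) that PQ(1)] .
    have empty: "(Q, of_seg {}, P) \<in> \<O> \<longleftrightarrow> seg P \<subset> seg Q \<and> seg Q \<subset> C"
      unfolding of_seg_def using iff[OF nu_p0(1)] nu_p0(2) segC(1)[OF PQ(1)] by auto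
    have "seg P \<noteq> {}" "seg P \<subseteq> C" "seg Q \<subseteq> C" "seg Q \<noteq> {}" using segC PQ by auto
    consider "seg Q \<subset> seg P" | "seg P \<subset> seg Q" "seg Q = C" | "seg P \<subset> seg Q" "seg Q \<subset> C"
      using seg_total_novak[OF PQ(1,2)] PQ(3) segC[OF PQ(2)] by blast
    then show ?thesis
    proof cases
      case 1
      have "{A\<in>segs. (Q, of_seg A, P) \<in> \<O>} = {A\<in>segs. seg Q \<subset> A} \<inter> {A\<in>segs. A \<subset> seg P}" (is "?l = ?r")
      proof (rule Set.set_eqI)
        fix A show "A \<in> ?l \<longleftrightarrow> A \<in> ?r"
        proof (cases "A \<in> seg ` \<N>")
          case True
          then obtain L where L: "L \<in> \<N>" "A = seg L" by blast
          have "(Q, L, P) \<in> \<O> \<longleftrightarrow> seg Q \<subset> seg L \<and> seg L \<subset> seg P" using iff[OF L(1)] 1 by blast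
          then show ?thesis using L of_seg_seg[OF L(1)] by simp
        next
          case False
          then show ?thesis using empty 1 by auto
        qed
      qed
      then show ?thesis
        using openin_segs_above[of "seg Q"] openin_segs_below[of "seg P"] PQ by (simp add: openin_Int)
    next
      case 2
      have "{A\<in>segs. (Q, of_seg A, P) \<in> \<O>} = {A\<in>segs. {} \<subset> A} \<inter> {A\<in>segs. A \<subset> seg P}" (is "?l = ?r")
      proof (rule Set.set_eqI)
        fix A show "A \<in> ?l \<longleftrightarrow> A \<in> ?r"
        proof (cases "A \<in> seg ` \<N>")
          case True
          then obtain L where L: "L \<in> \<N>" "A = seg L" by blast
          have "(Q, L, P) \<in> \<O> \<longleftrightarrow> seg L \<subset> seg P" using iff[OF L(1)] 2 segC(1)[OF L(1)] by blast
          then show ?thesis using L of_seg_seg[OF L(1)] segC(2)[OF L(1)] by auto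
        next
          case False
          then show ?thesis using empty 2 by auto
        qed
      qed
      then show ?thesis
        using openin_segs_above[of "{}"] openin_segs_below[of "seg P"] PQ by (simp add: openin_Int)
    next
      case 3
      have "{A\<in>segs. (Q, of_seg A, P) \<in> \<O>} = {A\<in>segs. seg Q \<subset> A} \<union> {A\<in>segs. A \<subset> seg P}" (is "?l = ?r")
      proof (rule Set.set_eqI)
        fix A show "A \<in> ?l \<longleftrightarrow> A \<in> ?r"
        proof (cases "A \<in> seg ` \<N>")
          case True
          then obtain L where L: "L \<in> \<N>" "A = seg L" by blast
          have "(Q, L, P) \<in> \<O> \<longleftrightarrow> seg Q \<subset> seg L \<or> seg L \<subset> seg P" using iff[OF L(1)] 3(1) by blast
          then show ?thesis using L of_seg_seg[OF L(1)] by auto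
        next
          case False
          then show ?thesis using empty 3 \<open>seg P \<noteq> {}\<close> by auto
        qed
      qed
      then show ?thesis
        using openin_segs_above[of "seg Q"] openin_segs_below[of "seg P"] PQ by (simp add: openin_Un)
    qed
  qed
  fix U assume "U \<in> {\<N> - circ_closed \<O> P Q |P Q. P \<in> \<N> \<and> Q \<in> \<N>} \<union> {\<N>}"
  then consider P where "P \<in> \<N>" "U = \<N> - circ_closed \<O> P P"
    | P Q where "P \<in> \<N>" "Q \<in> \<N>" "P \<noteq> Q" "U = \<N> - circ_closed \<O> P Q" | "U = \<N>"
    by blast
  then show "openin ?T (of_seg -` U \<inter> topspace ?T)"
  proof cases
    case 1
    have "circ_closed \<O> P P = {P}"
      using N.R_distinct unfolding circ_closed_def circ_open_def by blast
    then have "of_seg -` U \<inter> segs = {A\<in>segs. of_seg A \<noteq> P}" using 1 of_seg_image by auto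
    then show ?thesis using point[OF 1(1)] S.topspace_lin by simp
  next
    case 2
    have "U = circ_open \<O> Q P" using N.circ_open_eq_compl[of Q P] 2 by auto
    then have "of_seg -` U \<inter> segs = {A\<in>segs. (Q, of_seg A, P) \<in> \<O>}" by (auto simp: circ_open_def)
    then show ?thesis using interval[OF 2(1-3)] S.topspace_lin by simp
  next
    case 3
    then have "of_seg -` U \<inter> segs = segs" using of_seg_image by auto
    moreover have "openin ?T segs" using openin_topspace[of ?T] unfolding S.topspace_lin .
    ultimately show ?thesis unfolding S.topspace_lin by simp
  qed
next
  show "of_seg ` topspace (lin_topology segs segs_order) \<subseteq>
      \<Union>({\<N> - circ_closed \<O> P Q |P Q. P \<in> \<N> \<and> Q \<in> \<N>} \<union> {\<N>})"
    unfolding S.topspace_lin of_seg_image by blast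
qed

lemma compact_novak_pointed: "compact_space (novak_topology C R)"
proof -
  interpret N: circular_order_set "\<N>" "\<O>"
    using circular_novak_pointed by unfold_locales
  have "compactin (lin_topology segs segs_order) segs"
    using compact_segs S.topspace_lin by (simp add: compact_space_def)
  then have "compactin (novak_topology C R) (of_seg ` segs)"
    by (rule image_compactin[OF _ of_seg_continuous])
  then show ?thesis
    unfolding of_seg_image compact_space_def novak_topology_def N.topspace_circ by simp
qed

end

section \<open>The Novak completion without a base point\<close>

context circular_order_set
begin

text \<open>The empty relation is a gap of the empty circle, so the completion has a point although
  \<open>C\<close> has none.\<close>

lemma novak_points_empty: "C = {} \<Longrightarrow> \<N> = {{}}"
  unfolding novak_points_def circ_gap_def circ_cut_def linear_order_on_def partial_order_on_def
    preorder_on_def by (auto simp: refl_on_def trans_def antisym_def)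

lemma circular_novak: "circular_order \<N> \<O>"
proof (cases "C = {}")
  case True
  have "False" if "(a, b, c) \<in> \<O>" for a b c
    using novak_order_points[OF that] novak_points_empty[OF True] by simp
  then have "\<O> = {}" by auto
  then show ?thesis unfolding circular_order_def using novak_points_empty[OF True] by simp
next
  case False
  then obtain p where "p \<in> C" by blast
  then interpret pointed_circular_order C R p by unfold_locales
  show ?thesis by (rule circular_novak_pointed)
qed

lemma compact_novak: "compact_space (novak_topology C R)"
proof (cases "C = {}")
  case True
  interpret N: circular_order_set "\<N>" "\<O>"
    using circular_novak by unfold_locales
  have "finite (topspace (novak_topology C R))"
    unfolding novak_topology_def N.topspace_circ using novak_points_empty[OF True] by simp
  then show ?thesis unfolding compact_space_def by (simp add: finite_imp_compactin)
next
  case False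
  then obtain p where "p \<in> C" by blast
  then interpret pointed_circular_order C R p by unfold_locales
  show ?thesis by (rule compact_novak_pointed)
qed

lemma novak_between:
  assumes "L \<in> \<N>" "L' \<in> \<N>" "L \<noteq> L'"
  shows "(\<exists>x\<in>C. (L, \<nu> x, L') \<in> \<O>) \<or> L \<in> \<nu> ` C \<and> L' \<in> \<nu> ` C"
proof (cases "C = {}")
  case True
  then show ?thesis using novak_points_empty assms by auto
next
  case False
  then obtain p where "p \<in> C" by blast
  then interpret pointed_circular_order C R p by unfold_locales
  show ?thesis
    using novak_between_pointed[OF assms] assms(1,2) unfolding novak_points_def by blast
qed

lemma lower_cut_novak: "x \<in> C \<Longrightarrow> \<nu> x \<in> \<N>"
  unfolding novak_points_def by blast

text \<open>The direction not yet known follows from totality on Novak points: the opposite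
  arrangement of the three point-cuts would give \<open>[a,c,b]\<close>.\<close>

lemma novak_order_lower_cut_iff:
  assumes "a \<in> C" "b \<in> C" "c \<in> C"
  shows "(\<nu> a, \<nu> b, \<nu> c) \<in> \<O> \<longleftrightarrow> (a, b, c) \<in> R"
proof
  interpret N: circular_order_set "\<N>" "\<O>"
    using circular_novak by unfold_locales
  assume abc: "(a, b, c) \<in> R"
  then have "a \<noteq> b" "b \<noteq> c" "a \<noteq> c" using R_distinct by blast+
  then have "\<nu> a \<noteq> \<nu> b" "\<nu> b \<noteq> \<nu> c" "\<nu> a \<noteq> \<nu> c"
    using inj_lower_cut assms unfolding inj_on_def by blast+
  then have "(\<nu> a, \<nu> b, \<nu> c) \<in> \<O> \<or> (\<nu> a, \<nu> c, \<nu> b) \<in> \<O>"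
    using N.R_total lower_cut_novak assms by blast
  moreover have "(a, c, b) \<notin> R" using abc R_asym R_cyc by blast
  ultimately show "(\<nu> a, \<nu> b, \<nu> c) \<in> \<O>"
    using novak_order_lower_cut_imp assms by blast
qed (rule novak_order_lower_cut_imp[OF _ assms])

end

subsection \<open>Circular automorphisms\<close>

context circular_order_set
begin

lemma cop_mem: "cop C R g \<Longrightarrow> x \<in> C \<Longrightarrow> g x \<in> C"
  unfolding cop_def bij_betw_def by blast

lemma cop_inj: "cop C R g \<Longrightarrow> x \<in> C \<Longrightarrow> y \<in> C \<Longrightarrow> g x = g y \<longleftrightarrow> x = y"
  unfolding cop_def bij_betw_def inj_on_def by blast

lemma cop_preimage:
  assumes "cop C R g" "y \<in> C"
  obtains x where "x \<in> C" "y = g x"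
  using assms unfolding cop_def bij_betw_def by blast

lemma cop_inverse:
  assumes "cop C R f"
  shows "cop C R (\<lambda>x\<in>C. inv_into C f x)"
  unfolding cop_def
proof (intro conjI allI impI)
  have bij: "bij_betw f C C" using assms by (simp add: cop_def)
  have "bij_betw (inv_into C f) C C" by (rule bij_betw_inv_into[OF bij])
  then show "bij_betw (\<lambda>x\<in>C. inv_into C f x) C C" by (simp add: bij_betw_def inj_on_def)
  have inv: "inv_into C f x \<in> C \<and> f (inv_into C f x) = x" if "x \<in> C" for x
    using bij that by (auto simp: bij_betw_def inv_into_into f_inv_into_f)
  fix a b c assume abc: "(a, b, c) \<in> R"
  have "a \<in> C" "b \<in> C" "c \<in> C" using R_mem[OF abc] .
  then show "((\<lambda>x\<in>C. inv_into C f x) a, (\<lambda>x\<in>C. inv_into C f x) b, (\<lambda>x\<in>C. inv_into C f x) c) \<in> R"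
    using inv[of a] inv[of b] inv[of c] abc
      cop_iff[OF assms, of "inv_into C f a" "inv_into C f b" "inv_into C f c"] by simp
qed

lemma subgroup_cop: "subgroup {f \<in> Bij C. cop C R f} (BijGroup C)"
proof (rule group.subgroupI[OF group_BijGroup])
  have "((\<lambda>x\<in>C. x) a, (\<lambda>x\<in>C. x) b, (\<lambda>x\<in>C. x) c) \<in> R" if "(a, b, c) \<in> R" for a b c
    using that R_mem[OF that] by simp
  then have "cop C R (\<lambda>x\<in>C. x)"
    unfolding cop_def using id_Bij[of C] unfolding Bij_def by blast
  then show "{f \<in> Bij C. cop C R f} \<noteq> {}" using id_Bij by blast
  fix f assume f: "f \<in> {f \<in> Bij C. cop C R f}"
  then show "inv\<^bsub>BijGroup C\<^esub> f \<in> {f \<in> Bij C. cop C R f}"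
    using cop_inverse[of f] restrict_inv_into_Bij[of f C] inv_BijGroup[of f C] by auto
  fix g assume g: "g \<in> {f \<in> Bij C. cop C R f}"
  have fg: "compose C f g \<in> Bij C" using f g compose_Bij by blast
  have "(compose C f g a, compose C f g b, compose C f g c) \<in> R" if "(a, b, c) \<in> R" for a b c
    using f g that R_mem[OF that] by (simp add: compose_def cop_def)
  then have "cop C R (compose C f g)" unfolding cop_def using fg unfolding Bij_def by blast
  then show "f \<otimes>\<^bsub>BijGroup C\<^esub> g \<in> {f \<in> Bij C. cop C R f}"
    using f g fg by (simp add: BijGroup_def)
qed (auto simp: BijGroup_def)

lemma subgroup_cop_BijGroup:
  assumes "subgroup G (cop_group C R)"
  shows "subgroup G (BijGroup C)"
  by (rule group.incl_subgroup[OF group_BijGroup subgroup_cop])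
    (use assms in \<open>simp add: cop_group_def\<close>)

end

section \<open>Transport of linear orders, ordinal sums and cuts along bijections\<close>

lemma linear_order_on_image:
  assumes lin: "linear_order_on A r" and inj: "inj_on g A"
  shows "linear_order_on (g ` A) (map_prod g g ` r)"
proof -
  interpret r: linear_order_set A r using lin by unfold_locales
  have inj': "x = y" if "g x = g y" "x \<in> A" "y \<in> A" for x y
    using inj that unfolding inj_on_def by blast
  show ?thesis
    unfolding linear_order_on_def partial_order_on_def preorder_on_def
  proof (intro conjI)
    show "map_prod g g ` r \<subseteq> g ` A \<times> g ` A" using r.s_mem by auto
    show "refl_on (g ` A) (map_prod g g ` r)" using r.s_refl by (intro refl_onI) auto
    show "trans (map_prod g g ` r)"
    proof (rule transI)
      fix x y z assume "(x, y) \<in> map_prod g g ` r" "(y, z) \<in> map_prod g g ` r"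
      then obtain a b b' c where *: "(a, b) \<in> r" "(b', c) \<in> r" "x = g a" "y = g b" "y = g b'" "z = g c"
        by auto
      then have "b = b'" using inj' r.s_mem by metis
      then show "(x, z) \<in> map_prod g g ` r" using * r.s_trans by (intro image_eqI[of _ _ "(a, c)"]) auto
    qed
    show "antisym (map_prod g g ` r)"
    proof (rule antisymI)
      fix x y assume "(x, y) \<in> map_prod g g ` r" "(y, x) \<in> map_prod g g ` r"
      then obtain a b b' a' where *: "(a, b) \<in> r" "(b', a') \<in> r" "x = g a" "y = g b" "y = g b'" "x = g a'"
        by auto
      then have "b = b'" "a = a'" using inj' r.s_mem by metis+
      then show "x = y" using * r.s_antisym by blast
    qed
    show "total_on (g ` A) (map_prod g g ` r)"
      unfolding total_on_def
    proof (intro ballI impI)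
      fix x y assume "x \<in> g ` A" "y \<in> g ` A"
      then obtain a b where "a \<in> A" "b \<in> A" "x = g a" "y = g b" by blast
      then show "(x, y) \<in> map_prod g g ` r \<or> (y, x) \<in> map_prod g g ` r"
        using r.s_total[of a b] by (auto intro: rev_image_eqI)
    qed
  qed
qed

lemma Field_map_prod: "Field (map_prod g g ` r) = g ` Field r"
  unfolding Field_def Domain_fst Range_snd by (force simp: image_iff)

lemma ordinal_sum3_image:
  "map_prod g g ` ordinal_sum3 r s t =
     ordinal_sum3 (map_prod g g ` r) (map_prod g g ` s) (map_prod g g ` t)"
proof -
  have "map_prod g g ` (A \<times> B) = (g ` A) \<times> (g ` B)" for A B by auto
  then show ?thesis unfolding ordinal_sum3_def Field_map_prod image_Un by (simp only:)
qed

context circular_order_set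
begin

lemma mem_image_cut:
  assumes "cop C R g" "circ_cut C R L" "a \<in> C" "b \<in> C"
  shows "(g a, g b) \<in> map_prod g g ` L \<longleftrightarrow> (a, b) \<in> L"
proof
  assume "(g a, g b) \<in> map_prod g g ` L"
  then obtain a' b' where "(a', b') \<in> L" "g a = g a'" "g b = g b'" by auto
  then show "(a, b) \<in> L" using cop_inj[OF assms(1)] cut_mem[OF assms(2)] assms(3,4) by metis
qed force

lemma circ_cut_image:
  assumes g: "cop C R g" and L: "circ_cut C R L"
  shows "circ_cut C R (map_prod g g ` L)"
  unfolding circ_cut_def
proof (intro conjI allI impI)
  have "bij_betw g C C" using g by (simp add: cop_def)
  then show "linear_order_on C (map_prod g g ` L)"
    using linear_order_on_image[of C L g] L by (simp add: circ_cut_def bij_betw_def)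
  fix x y z
  assume *: "(x, y) \<in> map_prod g g ` L \<and> x \<noteq> y \<and> (y, z) \<in> map_prod g g ` L \<and> y \<noteq> z"
  then obtain a b b' c where ab: "(a, b) \<in> L" "(b', c) \<in> L" "x = g a" "y = g b" "y = g b'" "z = g c"
    by auto
  then have "b = b'" using cop_inj[OF g] cut_mem[OF L] by metis
  then have "(a, b, c) \<in> R" using L * ab unfolding circ_cut_def by metis
  then show "(x, y, z) \<in> R" using g ab unfolding cop_def by blast
qed

text \<open>The image is a cut with least element \<open>g x\<close>, and a cut is determined by its
  least element.\<close>

lemma lower_cut_image:
  assumes g: "cop C R g" and x: "x \<in> C"
  shows "map_prod g g ` \<nu> x = \<nu> (g x)"
proof (rule circ_cut_with_least)
  show "circ_cut C R (map_prod g g ` \<nu> x)" by (rule circ_cut_image[OF g circ_cut_lower_cut[OF x]])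
  show "g x \<in> C" by (rule cop_mem[OF g x])
  show "\<forall>y\<in>C. (g x, y) \<in> map_prod g g ` \<nu> x"
  proof
    fix y assume "y \<in> C"
    then obtain z where "z \<in> C" "y = g z" by (rule cop_preimage[OF g])
    then show "(g x, y) \<in> map_prod g g ` \<nu> x"
      using lower_cut_least[OF x] by force
  qed
qed

lemma circ_gap_image:
  assumes g: "cop C R g" and L: "circ_gap C R L"
  shows "circ_gap C R (map_prod g g ` L)"
  unfolding circ_gap_def
proof (intro conjI notI)
  have cut: "circ_cut C R L" using L unfolding circ_gap_def by blast
  show "circ_cut C R (map_prod g g ` L)" by (rule circ_cut_image[OF g cut])
  note iff = mem_image_cut[OF g cut]
  show False if ex: "\<exists>x\<in>C. \<forall>y\<in>C. (x, y) \<in> map_prod g g ` L"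
  proof -
    obtain x where x: "x \<in> C" "\<forall>y\<in>C. (x, y) \<in> map_prod g g ` L" using ex by blast
    obtain a where a: "a \<in> C" "x = g a" using cop_preimage[OF g x(1)] by blast
    have "(a, b) \<in> L" if b: "b \<in> C" for b
      using bspec[OF x(2) cop_mem[OF g b]] unfolding a(2) iff[OF a(1) b] .
    then show False using L a(1) unfolding circ_gap_def by blast
  qed
  show False if ex: "\<exists>x\<in>C. \<forall>y\<in>C. (y, x) \<in> map_prod g g ` L"
  proof -
    obtain x where x: "x \<in> C" "\<forall>y\<in>C. (y, x) \<in> map_prod g g ` L" using ex by blast
    obtain a where a: "a \<in> C" "x = g a" using cop_preimage[OF g x(1)] by blast
    have "(b, a) \<in> L" if b: "b \<in> C" for b
      using bspec[OF x(2) cop_mem[OF g b]] unfolding a(2) iff[OF b a(1)] .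
    then show False using L a(1) unfolding circ_gap_def by blast
  qed
qed

lemma novak_image:
  assumes g: "cop C R g" and L: "L \<in> \<N>"
  shows "map_prod g g ` L \<in> \<N>"
  using L
proof (cases rule: novak_cases)
  case (1 z)
  then show ?thesis using lower_cut_image[OF g] lower_cut_novak cop_mem[OF g] by simp
next
  case 2
  then show ?thesis using circ_gap_image[OF g] unfolding novak_points_def by blast
qed

lemma novak_action_apply: "L \<in> \<N> \<Longrightarrow> novak_action C R g L = map_prod g g ` L"
  unfolding novak_action_def by force

lemma novak_action_lower_cut:
  "cop C R g \<Longrightarrow> x \<in> C \<Longrightarrow> novak_action C R g (\<nu> x) = \<nu> (g x)"
  using novak_action_apply[OF lower_cut_novak] lower_cut_image by simp

lemma novak_action_inverse:
  assumes g: "cop C R g" and L: "L \<in> \<N>" and h: "\<And>x. x \<in> C \<Longrightarrow> h (g x) = x" "cop C R h"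
  shows "novak_action C R h (novak_action C R g L) = L"
proof -
  have "map_prod h h (map_prod g g p) = p" if "p \<in> L" for p
    using cut_mem[OF novak_cut[OF L]] that h(1) by (cases p) auto
  then have "map_prod h h ` map_prod g g ` L = L" unfolding image_image by simp
  then show ?thesis using novak_action_apply novak_image[OF g L] L by simp
qed

lemma novak_action_bij:
  assumes g: "cop C R g"
  shows "bij_betw (novak_action C R g) \<N> \<N>"
proof (rule bij_betw_byWitness[of _ "novak_action C R (\<lambda>x\<in>C. inv_into C g x)"])
  note inv = cop_inverse[OF g]
  have bij: "inj_on g C" "g ` C = C" using g by (auto simp: cop_def bij_betw_def)
  show "novak_action C R g ` \<N> \<subseteq> \<N>" "novak_action C R (\<lambda>x\<in>C. inv_into C g x) ` \<N> \<subseteq> \<N>"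
    using novak_image[OF g] novak_image[OF inv] novak_action_apply by auto
  have 1: "(\<lambda>x\<in>C. inv_into C g x) (g x) = x" if "x \<in> C" for x
    using that bij inv_into_f_f[of g C x] by auto
  have 2: "g ((\<lambda>x\<in>C. inv_into C g x) x) = x" if "x \<in> C" for x
    using that bij f_inv_into_f[of x g C] by auto
  show "\<forall>L\<in>\<N>. novak_action C R (\<lambda>x\<in>C. inv_into C g x) (novak_action C R g L) = L"
    using novak_action_inverse[OF g _ 1 inv] by blast
  show "\<forall>L\<in>\<N>. novak_action C R g (novak_action C R (\<lambda>x\<in>C. inv_into C g x) L) = L"
    using novak_action_inverse[OF inv _ 2 g] by blast
qed

text \<open>Apply \<open>g\<close> to the three blocks of the partition: transport of relations
  commutes with ordinal sums.\<close>

lemma novak_action_cop: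
  assumes g: "cop C R g"
  shows "cop \<N> \<O> (novak_action C R g)"
  unfolding cop_def
proof (intro conjI allI impI)
  show bij: "bij_betw (novak_action C R g) \<N> \<N>" by (rule novak_action_bij[OF g])
  fix L1 L2 L3 assume O: "(L1, L2, L3) \<in> \<O>"
  note m = novak_order_points[OF O]
  obtain A B D r s t where *: "A \<noteq> {}" "B \<noteq> {}" "D \<noteq> {}" "A \<inter> B = {}" "B \<inter> D = {}" "A \<inter> D = {}"
      "A \<union> B \<union> D = C" "linear_order_on A r" "linear_order_on B s" "linear_order_on D t"
      "L1 = ordinal_sum3 r s t" "L2 = ordinal_sum3 s t r" "L3 = ordinal_sum3 t r s"
    using O by (rule novak_orderE)
  have gC: "inj_on g C" "g ` C = C" using g by (auto simp: cop_def bij_betw_def)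
  have sub: "A \<subseteq> C" "B \<subseteq> C" "D \<subseteq> C" using *(7) by blast+
  note inj = inj_on_subset[OF gC(1)]
  have disj: "g ` S \<inter> g ` T = {}" if "S \<inter> T = {}" "S \<subseteq> C" "T \<subseteq> C" for S T
    using inj_on_image_Int[OF gC(1) that(2,3)] that(1) by simp
  have ne: "novak_action C R g L \<noteq> novak_action C R g L'" if "L \<noteq> L'" "L \<in> \<N>" "L' \<in> \<N>" for L L'
    using bij that unfolding bij_betw_def inj_on_def by blast
  have mem: "novak_action C R g L \<in> \<N>" if "L \<in> \<N>" for L
    using bij that unfolding bij_betw_def by blast
  show "(novak_action C R g L1, novak_action C R g L2, novak_action C R g L3) \<in> \<O>"
  proof (rule novak_orderI[where A = "g ` A" and B = "g ` B" and D = "g ` D"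
        and r = "map_prod g g ` r" and s = "map_prod g g ` s" and t = "map_prod g g ` t"])
    show "g ` A \<union> g ` B \<union> g ` D = C" using *(7) gC(2) by blast
    show "linear_order_on (g ` A) (map_prod g g ` r)" by (rule linear_order_on_image[OF *(8) inj[OF sub(1)]])
    show "linear_order_on (g ` B) (map_prod g g ` s)" by (rule linear_order_on_image[OF *(9) inj[OF sub(2)]])
    show "linear_order_on (g ` D) (map_prod g g ` t)" by (rule linear_order_on_image[OF *(10) inj[OF sub(3)]])
    show "novak_action C R g L1 = ordinal_sum3 (map_prod g g ` r) (map_prod g g ` s) (map_prod g g ` t)"
      by (simp only: novak_action_apply[OF m(1), unfolded *(11)] *(11) ordinal_sum3_image)
    show "novak_action C R g L2 = ordinal_sum3 (map_prod g g ` s) (map_prod g g ` t) (map_prod g g ` r)"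
      by (simp only: novak_action_apply[OF m(2), unfolded *(12)] *(12) ordinal_sum3_image)
    show "novak_action C R g L3 = ordinal_sum3 (map_prod g g ` t) (map_prod g g ` r) (map_prod g g ` s)"
      by (simp only: novak_action_apply[OF m(3), unfolded *(13)] *(13) ordinal_sum3_image)
  qed (use * disj sub ne mem m in auto)
qed

lemma cop_continuous:
  assumes f: "cop C R f"
  shows "continuous_map (circ_topology C R) (circ_topology C R) f"
proof -
  have bij: "bij_betw f C C" using f by (simp add: cop_def)
  show ?thesis
    unfolding circ_topology_def[of C R] continuous_on_generated_topo_iff
    unfolding circ_topology_def[of C R, symmetric] topspace_circ
  proof (intro conjI allI impI)
    fix U assume "U \<in> {C - circ_closed R a b |a b. a \<in> C \<and> b \<in> C} \<union> {C}"
    then consider a b where "a \<in> C" "b \<in> C" "U = C - circ_closed R a b" | "U = C" by blast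
    then show "openin (circ_topology C R) (f -` U \<inter> C)"
    proof cases
      case 1
      then obtain a' b' where ab: "a' \<in> C" "b' \<in> C" "a = f a'" "b = f b'"
        using cop_preimage[OF f] by metis
      have "f -` U \<inter> C = C - circ_closed R a' b'"
        unfolding 1(3) circ_closed_def circ_open_def ab(3,4)
        using cop_iff[OF f ab(1) _ ab(2)] cop_inj[OF f] cop_mem[OF f] ab(1,2) by auto
      then show ?thesis using openin_compl_closed[OF ab(1,2)] by simp
    next
      case 2
      then have "f -` U \<inter> C = topspace (circ_topology C R)"
        using cop_mem[OF f] unfolding topspace_circ by blast
      then show ?thesis by simp
    qed
  qed (use bij in \<open>auto simp: bij_betw_def\<close>)
qed

end

locale cop_subgroup = circular_order_set X R for X :: "'a set" and R +
  fixes G :: "('a \<Rightarrow> 'a) set"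
  assumes G: "subgroup G (cop_group X R)"
begin

lemma G_cop: "g \<in> G \<Longrightarrow> g \<in> Bij X \<and> cop X R g"
  using subgroup.subset[OF G] by (auto simp: cop_group_def)

lemma G_BijGroup: "subgroup G (BijGroup X)"
  by (rule subgroup_cop_BijGroup[OF G])

lemma one_mem_G: "(\<lambda>x\<in>X. x) \<in> G"
  using subgroup.one_closed[OF G_BijGroup] by (simp add: BijGroup_def)

interpretation N: circular_order_set "novak_points X R" "novak_order X R"
  using circular_novak by unfold_locales

lemma action_novak: "group_action (BijGroup X\<lparr>carrier := G\<rparr>) \<N> (novak_action X R)"
proof -
  have Bij: "novak_action X R g \<in> Bij \<N>" if "g \<in> G" for g
    using novak_action_bij G_cop[OF that] unfolding Bij_def novak_action_def by auto
  have "novak_action X R (compose X g h) = compose \<N> (novak_action X R g) (novak_action X R h)"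
    if "g \<in> G" "h \<in> G" for g h
  proof
    fix L
    show "novak_action X R (compose X g h) L = compose \<N> (novak_action X R g) (novak_action X R h) L"
    proof (cases "L \<in> \<N>")
      case True
      have "map_prod (compose X g h) (compose X g h) p = map_prod g g (map_prod h h p)" if "p \<in> L" for p
        using cut_mem[OF novak_cut[OF True]] that by (cases p) (auto simp: compose_def)
      then have "map_prod (compose X g h) (compose X g h) ` L = map_prod g g ` map_prod h h ` L"
        unfolding image_image by (rule image_cong[OF refl])
      then show ?thesis
        using True novak_image G_cop[OF that(2)] by (simp add: novak_action_apply compose_def)
    qed (simp add: novak_action_def compose_def)
  qed
  then have "novak_action X R \<in> hom (BijGroup X\<lparr>carrier := G\<rparr>) (BijGroup \<N>)"
    using Bij G_cop by (simp add: hom_def BijGroup_def)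
  then show ?thesis
    unfolding group_action_def group_hom_def group_hom_axioms_def
    using group.subgroup_imp_group[OF group_BijGroup G_BijGroup] group_BijGroup by blast
qed

end

subsection \<open>The circular interval uniformity\<close>

context circular_order_set
begin

lemma circ_cycle_nth:
  assumes "circ_cycle C R as" "i < k" "k < l" "l < length as"
  shows "(as ! i, as ! k, as ! l) \<in> R"
  using assms unfolding circ_cycle_def by blast

text \<open>Cut the circle at \<open>as ! 0\<close>. A point \<open>y\<close> other than
  \<open>as ! 0\<close> has a last cycle point \<open>as ! i\<close> before it, and lies strictly
  before the point two places further on, which may be reached by passing \<open>as ! 0\<close>. The
  point \<open>as ! 0\<close> lies in the member that starts at the last index.\<close>

lemma cycle_cover_covers:
  assumes as: "circ_cycle C R as"
  shows "\<Union>(cycle_cover R as) = C"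
proof
  show "\<Union>(cycle_cover R as) \<subseteq> C" unfolding cycle_cover_def using circ_open_subset by blast
  let ?n = "length as"
  have n: "3 \<le> ?n" using as by (simp add: circ_cycle_def)
  have wrap: "(?n + 1) mod ?n = 1" using n unfolding mod_add_self1 by (intro mod_less) linarith
  have mem: "as ! k \<in> C" if "k < ?n" for k
    using as that nth_mem unfolding circ_cycle_def by blast
  have dist: "as ! i \<noteq> as ! k" if "i < ?n" "k < ?n" "i \<noteq> k" for i k
    using as that nth_eq_iff_index_eq unfolding circ_cycle_def by blast
  show "C \<subseteq> \<Union>(cycle_cover R as)"
  proof
    fix y assume y: "y \<in> C"
    have "as ! 0 \<in> C" by (rule mem) (use n in linarith)
    then interpret L: linear_order_set C "\<nu> (as ! 0)"
      using linear_lower_cut by unfold_locales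
    let ?less = "lin_less (\<nu> (as ! 0))"
    note less_iff = lower_cut_less_iff[OF \<open>as ! 0 \<in> C\<close>]
    note cut = circ_cut_lower_cut[OF \<open>as ! 0 \<in> C\<close>]
    have sorted: "?less (as ! i) (as ! k)" if "i < k" "k < ?n" for i k
      using that mem[of k] dist[of i k] dist[of 0 k] circ_cycle_nth[OF as, of 0 i k] unfolding less_iff
      by (cases "i = 0") force+
    have chain: "(u, v, w) \<in> R" if "?less u v" "?less v w" for u v w
      using cut that unfolding circ_cut_def lin_less_def by blast
    have "\<exists>i<?n. (as ! i, y, as ! ((i + 2) mod ?n)) \<in> R"
    proof (cases "y = as ! 0")
      case True
      have "(as ! 0, as ! 1, as ! (?n - 1)) \<in> R"
        using circ_cycle_nth[OF as, of 0 1 "?n - 1"] n by simp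
      then have "(as ! (?n - 1), as ! 0, as ! 1) \<in> R" using R_cyc by blast
      moreover have "?n - 1 + 2 = ?n + 1" using n by linarith
      then have "(?n - 1 + 2) mod ?n = 1" using wrap by (simp only:)
      ultimately show ?thesis using True n by (intro exI[of _ "?n - 1"]) auto
    next
      case False
      let ?I = "{i. i < ?n \<and> ?less (as ! i) y}"
      have "0 \<in> ?I" using False y n unfolding less_iff by auto
      then have fin: "finite ?I" "?I \<noteq> {}" by auto
      define i where "i = Max ?I"
      have i: "i < ?n" "?less (as ! i) y" using Max_in[OF fin] unfolding i_def by auto
      have next_ge: "(y, as ! (i + 1)) \<in> \<nu> (as ! 0)" if "i + 1 < ?n"
      proof -
        have "i + 1 \<notin> ?I"
        proof
          assume "i + 1 \<in> ?I"
          from Max_ge[OF fin(1) this] show False unfolding i_def[symmetric] by simp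
        qed
        then show ?thesis using that L.not_lt[OF mem[OF that] y] by blast
      qed
      consider "i + 2 < ?n" | "i + 2 = ?n" | "i + 1 = ?n" using i(1) by linarith
      then show ?thesis
      proof cases
        case 1
        then have "?less y (as ! (i + 2))"
          using L.le_lt_trans[OF next_ge sorted[of "i + 1" "i + 2"]] by simp
        then show ?thesis using chain[OF i(2)] i(1) 1 by (intro exI[of _ i]) simp
      next
        case 2
        \<comment> \<open>The arc ends at \<open>as ! 0\<close>, so a third cycle point is needed to
          make \<open>as ! i\<close> different from it; likewise with \<open>as ! 1\<close> in the
          next case.\<close>
        then have "?less (as ! 0) (as ! i)" using sorted[of 0 i] n by simp
        then have "(as ! i, y, as ! 0) \<in> R" using chain[OF _ i(2)] R_cyc by blast
        then show ?thesis using i(1) 2 by (intro exI[of _ i]) simp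
      next
        case 3
        then have "?less (as ! 1) (as ! i)" using sorted[of 1 i] n by simp
        then have "(as ! i, y, as ! 1) \<in> R" using chain[OF _ i(2)] R_cyc by blast
        moreover have "i + 2 = ?n + 1" using 3 by linarith
        then have "(i + 2) mod ?n = 1" using wrap by (simp only:)
        ultimately show ?thesis using i(1) by (intro exI[of _ i]) simp
      qed
    qed
    then obtain i where "i < ?n" "(as ! i, y, as ! ((i + 2) mod ?n)) \<in> R" by blast
    then show "y \<in> \<Union>(cycle_cover R as)"
      unfolding cycle_cover_def by (intro UnionI[of "circ_open R (as ! i) (as ! ((i + 2) mod ?n))"])
        (auto simp: circ_open_def)
  qed
qed

end

text \<open>With fewer than three points every open arc is empty, so arcs with ends in
  \<open>X\<close> can form a base only from three points on.\<close>

locale large_circular_order = circular_order_set X R for X :: "'a set" and R +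
  assumes large: "\<exists>a\<in>X. \<exists>b\<in>X. \<exists>c\<in>X. a \<noteq> b \<and> b \<noteq> c \<and> a \<noteq> c"
begin

interpretation N: circular_order_set \<N> \<O>
  using circular_novak by unfold_locales

abbreviation "K \<equiv> novak_topology X R"

lemma topspace_novak: "topspace K = \<N>"
  unfolding novak_topology_def by (rule N.topspace_circ)

lemma openin_novak_interval: "P \<noteq> Q \<Longrightarrow> openin K (circ_open \<O> P Q)"
  unfolding novak_topology_def by (rule N.openin_circ_open)

text \<open>Either a point of \<open>X\<close> lies between \<open>P\<close> and \<open>L\<close>,
  or \<open>L\<close> is itself such a point.\<close>

lemma novak_interval_point:
  assumes "(P, L, Q) \<in> \<O>"
  shows "\<exists>x\<in>X. (P, \<nu> x, Q) \<in> \<O>"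
proof -
  have "P \<in> \<N>" "L \<in> \<N>" "P \<noteq> L" using N.R_mem[OF assms] N.R_distinct[OF assms] by blast+
  then show ?thesis using novak_between[of P L] N.R_trans[OF _ assms] assms by blast
qed

text \<open>Each end is moved toward \<open>L\<close> to a point of \<open>X\<close>; where no point
  lies in between, \<open>novak_between\<close> says that the end is already one.\<close>

lemma shrink_interval:
  assumes PQ: "(P, L, Q) \<in> \<O>"
  obtains a b where "a \<in> X" "b \<in> X" "(\<nu> a, L, \<nu> b) \<in> \<O>" "circ_open \<O> (\<nu> a) (\<nu> b) \<subseteq> circ_open \<O> P Q"
proof -
  have m: "P \<in> \<N>" "L \<in> \<N>" "Q \<in> \<N>" "P \<noteq> L" "L \<noteq> Q"
    using N.R_mem[OF PQ] N.R_distinct[OF PQ] by blast+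
  have "\<exists>a\<in>X. (\<nu> a, L, Q) \<in> \<O> \<and> circ_open \<O> (\<nu> a) Q \<subseteq> circ_open \<O> P Q"
  proof (cases "\<exists>x\<in>X. (P, \<nu> x, L) \<in> \<O>")
    case True
    then obtain a where a: "a \<in> X" "(P, \<nu> a, L) \<in> \<O>" by blast
    have "(\<nu> a, L, Q) \<in> \<O>" using N.R_mid[OF a(2) PQ] .
    moreover have "circ_open \<O> (\<nu> a) Q \<subseteq> circ_open \<O> P Q"
      unfolding circ_open_def using N.R_between(2)[OF N.R_trans[OF a(2) PQ]] by blast
    ultimately show ?thesis using a(1) by blast
  next
    case False
    then show ?thesis using novak_between[OF m(1,2,4)] PQ by blast
  qed
  then obtain a where a: "a \<in> X" "(\<nu> a, L, Q) \<in> \<O>" "circ_open \<O> (\<nu> a) Q \<subseteq> circ_open \<O> P Q" by blast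
  have "\<exists>b\<in>X. (\<nu> a, L, \<nu> b) \<in> \<O> \<and> circ_open \<O> (\<nu> a) (\<nu> b) \<subseteq> circ_open \<O> (\<nu> a) Q"
  proof (cases "\<exists>x\<in>X. (L, \<nu> x, Q) \<in> \<O>")
    case True
    then obtain b where b: "b \<in> X" "(L, \<nu> b, Q) \<in> \<O>" by blast
    have "(\<nu> a, \<nu> b, Q) \<in> \<O>" "(\<nu> a, L, \<nu> b) \<in> \<O>" using N.R_between[OF a(2) b(2)] by blast+
    moreover have "circ_open \<O> (\<nu> a) (\<nu> b) \<subseteq> circ_open \<O> (\<nu> a) Q"
      unfolding circ_open_def using N.R_trans[OF _ calculation(1)] by blast
    ultimately show ?thesis using b(1) by blast
  next
    case False
    then show ?thesis using novak_between[OF m(2,3,5)] a(2) by blast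
  qed
  then show ?thesis using that a by blast
qed

lemma novak_interval_base:
  assumes "openin K W" "L \<in> W"
  obtains a b where "a \<in> X" "b \<in> X" "(\<nu> a, L, \<nu> b) \<in> \<O>" "circ_open \<O> (\<nu> a) (\<nu> b) \<subseteq> W"
proof -
  have LN: "L \<in> \<N>" using openin_subset[OF assms(1)] assms(2) topspace_novak by blast
  define B where "B W \<longleftrightarrow> (\<exists>a\<in>X. \<exists>b\<in>X. (\<nu> a, L, \<nu> b) \<in> \<O> \<and> circ_open \<O> (\<nu> a) (\<nu> b) \<subseteq> W)" for W
  have interval: "B W" if "(P, L, Q) \<in> \<O>" "circ_open \<O> P Q \<subseteq> W" for P Q W
    using shrink_interval[OF that(1)] that(2) unfolding B_def by (metis order_trans)
  have compl: "B (\<N> - {P})" if P: "P \<in> \<N>" "P \<noteq> L" for P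
  proof -
    obtain z where z: "z \<in> X" "\<nu> z \<noteq> P" "\<nu> z \<noteq> L"
      using large inj_lower_cut unfolding inj_on_def by metis
    have no: "circ_open \<O> P S \<subseteq> \<N> - {P}" "circ_open \<O> S P \<subseteq> \<N> - {P}" for S
      using N.circ_open_subset N.R_distinct unfolding circ_open_def by blast+
    \<comment> \<open>The complement of a point \<open>P\<close> is not an arc with distinct ends; a
      third point \<open>z\<close> supplies the other end of an arc that contains \<open>L\<close>
      and omits \<open>P\<close>.\<close>
    have "(P, L, \<nu> z) \<in> \<O> \<or> (P, \<nu> z, L) \<in> \<O>"
      using N.R_total[of P L "\<nu> z"] P LN lower_cut_novak z by blast
    then have "(P, L, \<nu> z) \<in> \<O> \<or> (\<nu> z, L, P) \<in> \<O>" using N.R_cyc by blast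
    then show ?thesis using interval no by blast
  qed
  have mono: "B V" if "B U" "U \<subseteq> V" for U V using that unfolding B_def by blast
  have "B W"
  proof (rule openin_generated_local[of _ W L B, OF assms(1)[unfolded novak_topology_def circ_topology_def] assms(2)])
    fix W assume "W \<in> {\<N> - circ_closed \<O> P Q |P Q. P \<in> \<N> \<and> Q \<in> \<N>} \<union> {\<N>}" and LW: "L \<in> W"
    then consider P Q where "P \<in> \<N>" "Q \<in> \<N>" "P \<noteq> Q" "W = \<N> - circ_closed \<O> P Q"
      | P where "P \<in> \<N>" "W = \<N> - circ_closed \<O> P P" | "W = \<N>"
      by blast
    then show "B W"
    proof cases
      case 1
      then have "W = circ_open \<O> Q P" using N.circ_open_eq_compl[of Q P] by auto
      then show ?thesis using interval[of Q P W] LW by (simp add: circ_open_def)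
    next
      case 2
      then have "W = \<N> - {P}" using N.R_distinct unfolding circ_closed_def circ_open_def by blast
      then show ?thesis using compl[OF 2(1)] LW by blast
    next
      case 3
      obtain z where "z \<in> X" "\<nu> z \<noteq> L" using large inj_lower_cut unfolding inj_on_def by metis
      then show ?thesis using mono[OF compl[OF lower_cut_novak, of z]] 3 by blast
    qed
  next
    fix U V assume "B U" "B V"
    then obtain a b a' b' where ab: "a \<in> X" "b \<in> X" "(\<nu> a, L, \<nu> b) \<in> \<O>" "circ_open \<O> (\<nu> a) (\<nu> b) \<subseteq> U"
      "a' \<in> X" "b' \<in> X" "(\<nu> a', L, \<nu> b') \<in> \<O>" "circ_open \<O> (\<nu> a') (\<nu> b') \<subseteq> V"
      unfolding B_def by (elim bexE conjE) (rule that)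
    obtain P Q where "(P, L, Q) \<in> \<O>"
        "circ_open \<O> P Q \<subseteq> circ_open \<O> (\<nu> a) (\<nu> b) \<inter> circ_open \<O> (\<nu> a') (\<nu> b')"
      by (rule N.circ_interval_Int[OF ab(3,7)]) (rule that)
    moreover have "circ_open \<O> P Q \<subseteq> U \<inter> V" using calculation(2) ab(4,8) by blast
    ultimately show "B (U \<inter> V)" using interval by blast
  next
    fix U V assume "B U" "U \<subseteq> V"
    then show "B V" by (rule mono)
  qed
  then show ?thesis using that unfolding B_def by blast
qed

lemma lower_cut_mem_interval:
  "a \<in> X \<Longrightarrow> b \<in> X \<Longrightarrow> {x\<in>X. \<nu> x \<in> circ_open \<O> (\<nu> a) (\<nu> b)} = circ_open R a b"
  using novak_order_lower_cut_iff R_mem unfolding circ_open_def by blast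

text \<open>Neighbourhoods in \<open>K\<close> contain arcs with ends in \<open>X\<close>, and these
  trace exactly the arcs of \<open>X\<close>. Conversely each basic open set of \<open>X\<close> is
  the trace of the basic open set with the same ends.\<close>

lemma circ_topology_eq_pullback: "circ_topology X R = pullback_topology X \<nu> K"
proof -
  have 1: "openin (circ_topology X R) U" if U: "openin (pullback_topology X \<nu> K) U" for U
  proof -
    obtain W where W: "openin K W" "U = {x\<in>X. \<nu> x \<in> W}" using U unfolding openin_pullback_iff by blast
    show ?thesis
    proof (subst openin_subopen, intro ballI)
      fix x assume x: "x \<in> U"
      then have "\<nu> x \<in> W" "x \<in> X" using W(2) by auto
      then obtain a b where ab: "a \<in> X" "b \<in> X" "(\<nu> a, \<nu> x, \<nu> b) \<in> \<O>" "circ_open \<O> (\<nu> a) (\<nu> b) \<subseteq> W"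
        using novak_interval_base[OF W(1)] by blast
      have "a \<noteq> b" using N.R_distinct[OF ab(3)] by blast
      moreover have "x \<in> circ_open R a b"
        using lower_cut_mem_interval[OF ab(1,2)] ab(3) \<open>x \<in> X\<close> unfolding circ_open_def by blast
      moreover have "circ_open R a b \<subseteq> U"
        using lower_cut_mem_interval[OF ab(1,2)] ab(4) W(2) by blast
      ultimately show "\<exists>T. openin (circ_topology X R) T \<and> x \<in> T \<and> T \<subseteq> U"
        using openin_circ_open by blast
    qed
  qed
  have 2: "openin (pullback_topology X \<nu> K) U" if U: "openin (circ_topology X R) U" for U
  proof -
    have "generate_topology_on ({X - circ_closed R a b |a b. a \<in> X \<and> b \<in> X} \<union> {X}) U"
      using U unfolding circ_topology_def by (rule openin_topology_generated_by)
    then show ?thesis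
    proof induction
      case (Basis U)
      then consider a b where "a \<in> X" "b \<in> X" "U = X - circ_closed R a b" | "U = X" by blast
      then show ?case
        unfolding openin_pullback_iff
      proof cases
        case 1
        have "x \<in> circ_closed R a b \<longleftrightarrow> \<nu> x \<in> circ_closed \<O> (\<nu> a) (\<nu> b)" if "x \<in> X" for x
          using novak_order_lower_cut_iff[OF 1(1) that 1(2)] inj_lower_cut 1(1,2) that
          unfolding circ_closed_def circ_open_def inj_on_def by blast
        then have "U = {x\<in>X. \<nu> x \<in> \<N> - circ_closed \<O> (\<nu> a) (\<nu> b)}"
          using 1(3) lower_cut_novak by blast
        moreover have "openin K (\<N> - circ_closed \<O> (\<nu> a) (\<nu> b))"
          unfolding novak_topology_def using N.openin_compl_closed lower_cut_novak 1 by blast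
        ultimately show "\<exists>W. openin K W \<and> U = {x\<in>X. \<nu> x \<in> W}" by blast
      next
        case 2
        then have "U = {x\<in>X. \<nu> x \<in> topspace K}" using lower_cut_novak topspace_novak by auto
        then show "\<exists>W. openin K W \<and> U = {x\<in>X. \<nu> x \<in> W}" using openin_topspace by blast
      qed
    qed auto
  qed
  show ?thesis unfolding topology_eq using 1 2 by blast
qed

section \<open>The circular interval uniformity as a trace of open covers\<close>

lemma not_small: "\<not> (finite X \<and> card X \<le> 2)"
proof
  assume *: "finite X \<and> card X \<le> 2"
  obtain a b c where abc: "a \<in> X" "b \<in> X" "c \<in> X" "a \<noteq> b" "b \<noteq> c" "a \<noteq> c" using large by blast
  then have "card {a, b, c} \<le> card X" using * by (intro card_mono) auto
  then show False using * abc by simp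
qed

lemma circ_cycle_lower_cut:
  assumes "circ_cycle X R as"
  shows "circ_cycle \<N> \<O> (map \<nu> as)"
  unfolding circ_cycle_def
proof (intro conjI allI impI)
  have as: "3 \<le> length as" "distinct as" "set as \<subseteq> X" using assms by (simp_all add: circ_cycle_def)
  show "3 \<le> length (map \<nu> as)" using as by simp
  show "distinct (map \<nu> as)" using as inj_on_subset[OF inj_lower_cut] by (simp add: distinct_map)
  show "set (map \<nu> as) \<subseteq> \<N>" using as lower_cut_novak by auto
  fix i j k assume ijk: "i < j \<and> j < k \<and> k < length (map \<nu> as)"
  then have "as ! i \<in> X" "as ! j \<in> X" "as ! k \<in> X" using as(3) nth_mem[of _ as] by auto
  then show "(map \<nu> as ! i, map \<nu> as ! j, map \<nu> as ! k) \<in> \<O>"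
    using ijk circ_cycle_nth[OF assms, of i j k] novak_order_lower_cut_iff by simp
qed

lemma cycle_cover_eq_trace:
  assumes "circ_cycle X R as"
  shows "cycle_cover R as = trace_cover X \<nu> (cycle_cover \<O> (map \<nu> as))"
proof -
  have as: "3 \<le> length as" "set as \<subseteq> X" using assms by (simp_all add: circ_cycle_def)
  have "circ_open R (as ! i) (as ! ((i + 2) mod length as)) =
      {x\<in>X. \<nu> x \<in> circ_open \<O> (map \<nu> as ! i) (map \<nu> as ! ((i + 2) mod length (map \<nu> as)))}"
    if i: "i < length as" for i
  proof -
    have l: "(i + 2) mod length as < length as" using as(1) by (intro mod_less_divisor) linarith
    then have "as ! i \<in> X" "as ! ((i + 2) mod length as) \<in> X" using i as(2) nth_mem by blast+
    then show ?thesis using lower_cut_mem_interval i l by simp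
  qed
  then have "(\<lambda>i. circ_open R (as ! i) (as ! ((i + 2) mod length as))) ` {i. i < length as} =
      (\<lambda>W. {x\<in>X. \<nu> x \<in> W}) ` (\<lambda>i. circ_open \<O> (map \<nu> as ! i) (map \<nu> as ! ((i + 2) mod length (map \<nu> as)))) `
        {i. i < length as}"
    unfolding image_image by (intro image_cong) auto
  moreover have "cycle_cover R as = (\<lambda>i. circ_open R (as ! i) (as ! ((i + 2) mod length as))) ` {i. i < length as}"
    unfolding cycle_cover_def by (rule setcompr_eq_image)
  moreover have "cycle_cover \<O> (map \<nu> as) =
      (\<lambda>i. circ_open \<O> (map \<nu> as ! i) (map \<nu> as ! ((i + 2) mod length (map \<nu> as)))) ` {i. i < length as}"
    unfolding cycle_cover_def length_map by (rule setcompr_eq_image)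
  ultimately show ?thesis unfolding trace_cover_def by (simp only:)
qed

lemma open_cover_cycle:
  assumes as: "circ_cycle \<N> \<O> as"
  shows "open_cover K (cycle_cover \<O> as)"
  unfolding open_cover_def topspace_novak
proof
  show "\<Union>(cycle_cover \<O> as) = \<N>" by (rule N.cycle_cover_covers[OF as])
  have "as ! i \<noteq> as ! ((i + 2) mod length as)" if i: "i < length as" for i
  proof -
    have "3 \<le> length as" "distinct as" using as by (simp_all add: circ_cycle_def)
    moreover have "(i + 2) mod length as \<noteq> i" "(i + 2) mod length as < length as"
      using i calculation(1) by (auto simp: mod_if intro!: mod_less_divisor)
    ultimately show ?thesis using i nth_eq_iff_index_eq by metis
  qed
  then show "\<forall>W\<in>cycle_cover \<O> as. openin K W"
    unfolding cycle_cover_def using openin_novak_interval by blast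
qed

text \<open>As in the linear case, compactness gives finitely many arcs with ends in
  \<open>X\<close> that refine \<open>\<W>\<close>; all their ends are arranged in one cycle, and
  \<open>cycle_cover_refines\<close> applies.\<close>

lemma cycle_cover_refines_trace:
  assumes W: "open_cover K \<W>"
  obtains as where "circ_cycle X R as" "refines (cycle_cover R as) (trace_cover X \<nu> \<W>)"
proof -
  have "\<forall>L\<in>\<N>. \<exists>p. fst p \<in> X \<and> snd p \<in> X \<and> (\<nu> (fst p), L, \<nu> (snd p)) \<in> \<O> \<and>
      (\<exists>W\<in>\<W>. circ_open \<O> (\<nu> (fst p)) (\<nu> (snd p)) \<subseteq> W)"
  proof
    fix L assume "L \<in> \<N>"
    then obtain W where W': "W \<in> \<W>" "openin K W" "L \<in> W"
      using W topspace_novak unfolding open_cover_def by blast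
    obtain a b where "a \<in> X" "b \<in> X" "(\<nu> a, L, \<nu> b) \<in> \<O>" "circ_open \<O> (\<nu> a) (\<nu> b) \<subseteq> W"
      using novak_interval_base[OF W'(2,3)] by blast
    then show "\<exists>p. fst p \<in> X \<and> snd p \<in> X \<and> (\<nu> (fst p), L, \<nu> (snd p)) \<in> \<O> \<and>
      (\<exists>W\<in>\<W>. circ_open \<O> (\<nu> (fst p)) (\<nu> (snd p)) \<subseteq> W)"
      using W'(1) by (intro exI[of _ "(a, b)"]) auto
  qed
  from bchoice[OF this] obtain p where p: "\<And>L. L \<in> \<N> \<Longrightarrow> fst (p L) \<in> X \<and> snd (p L) \<in> X \<and>
      (\<nu> (fst (p L)), L, \<nu> (snd (p L))) \<in> \<O> \<and>
      (\<exists>W\<in>\<W>. circ_open \<O> (\<nu> (fst (p L))) (\<nu> (snd (p L))) \<subseteq> W)"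
    by blast
  define I where "I L = circ_open \<O> (\<nu> (fst (p L))) (\<nu> (snd (p L)))" for L
  have "compactin K \<N>" using compact_novak by (simp add: compact_space_def topspace_novak)
  moreover have "openin K (I L)" if "L \<in> \<N>" for L
    unfolding I_def using p[OF that] by (intro openin_novak_interval) (use N.R_distinct in blast)
  then have "\<forall>U\<in>I ` \<N>. openin K U" by blast
  moreover have "\<N> \<subseteq> \<Union>(I ` \<N>)" using p unfolding I_def circ_open_def by auto
  ultimately have "\<exists>\<F>. finite \<F> \<and> \<F> \<subseteq> I ` \<N> \<and> \<N> \<subseteq> \<Union>\<F>"
    unfolding compactin_def by blast
  then obtain S where S: "finite S" "S \<subseteq> \<N>" "\<N> \<subseteq> \<Union>(I ` S)"
    by (metis finite_subset_image)
  obtain x y z where xyz: "x \<in> X" "y \<in> X" "z \<in> X" "x \<noteq> y" "y \<noteq> z" "x \<noteq> z" using large by blast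
  \<comment> \<open>The three extra points guarantee the length that a cycle must have.\<close>
  define F where "F = {x, y, z} \<union> (fst \<circ> p) ` S \<union> (snd \<circ> p) ` S"
  have F: "finite F" "F \<subseteq> X" unfolding F_def using S p xyz by auto
  obtain as where as: "set as = F" "distinct as"
    "\<And>i k l. i < length as \<Longrightarrow> k < length as \<Longrightarrow> l < length as \<Longrightarrow>
       (as ! i, as ! k, as ! l) \<in> R \<longleftrightarrow> cyc_lt (int i) (int k) (int l)"
    using finite_cyclic_list[OF F] by blast
  have "card {x, y, z} \<le> card F" by (rule card_mono[OF F(1)]) (auto simp: F_def)
  then have len: "3 \<le> length as" using distinct_card[OF as(2)] as(1) xyz by simp
  have cyc: "circ_cycle X R as"
    unfolding circ_cycle_def using len as F(2) by (auto simp: cyc_lt_def)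
  let ?E = "p ` S"
  have "refines (cycle_cover R as) ((\<lambda>(a, b). circ_open R a b) ` ?E)"
  proof (rule cycle_cover_refines[OF as(2) len _ as(3)])
    show "set as \<subseteq> X" using as(1) F(2) by simp
    show "a \<in> set as \<and> b \<in> set as" if "(a, b) \<in> ?E" for a b
    proof -
      obtain L where "L \<in> S" "p L = (a, b)" using \<open>(a, b) \<in> ?E\<close> by auto
      then show ?thesis unfolding as(1) F_def by (metis UnI1 UnI2 comp_apply fst_conv image_eqI snd_conv)
    qed
    fix u assume "u \<in> set as"
    then have u: "u \<in> X" using as(1) F(2) by blast
    then obtain L where L: "L \<in> S" "\<nu> u \<in> I L" using S(3) lower_cut_novak by blast
    then have "(fst (p L), u, snd (p L)) \<in> R"
      using novak_order_lower_cut_iff[of "fst (p L)" u "snd (p L)"] p[of L] S(2) u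
      unfolding I_def circ_open_def by blast
    then show "\<exists>(a, b)\<in>?E. (a, u, b) \<in> R" using L(1) by (intro bexI[of _ "p L"]) (auto simp: case_prod_beta)
  qed
  moreover have "refines ((\<lambda>(a, b). circ_open R a b) ` ?E) (trace_cover X \<nu> \<W>)"
    unfolding refines_def
  proof
    fix A assume "A \<in> (\<lambda>(a, b). circ_open R a b) ` ?E"
    then obtain L where L: "L \<in> S" "A = circ_open R (fst (p L)) (snd (p L))"
      by (auto simp: case_prod_beta)
    then have "L \<in> \<N>" using S(2) by blast
    then obtain W where W': "W \<in> \<W>" "circ_open \<O> (\<nu> (fst (p L))) (\<nu> (snd (p L))) \<subseteq> W"
      and m: "fst (p L) \<in> X" "snd (p L) \<in> X"
      using p by blast
    have "A \<subseteq> {x\<in>X. \<nu> x \<in> W}"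
      unfolding L(2) using lower_cut_mem_interval[OF m] W'(2) by blast
    moreover have "{x\<in>X. \<nu> x \<in> W} \<in> trace_cover X \<nu> \<W>" unfolding trace_cover_def using W'(1) by blast
    ultimately show "\<exists>B\<in>trace_cover X \<nu> \<W>. A \<subseteq> B" by blast
  qed
  ultimately show ?thesis using that[OF cyc] refines_trans by blast
qed

lemma circ_uniformity_eq_induced: "circ_uniformity X R = induced_uniformity X K \<nu>"
proof -
  have eq: "circ_uniformity X R = uniformity_with_base X {cycle_cover R as |as. circ_cycle X R as}"
    unfolding circ_uniformity_def using not_small by (simp only: if_False)
  show ?thesis
  proof (intro Set.set_eqI iffI)
    fix \<C> assume "\<C> \<in> circ_uniformity X R"
    then obtain as where as: "\<Union>\<C> = X" "circ_cycle X R as" "refines (cycle_cover R as) \<C>"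
      unfolding eq uniformity_with_base_def by blast
    have "open_cover K (cycle_cover \<O> (map \<nu> as))"
      by (rule open_cover_cycle[OF circ_cycle_lower_cut[OF as(2)]])
    then show "\<C> \<in> induced_uniformity X K \<nu>"
      unfolding mem_induced_uniformity_iff using as(1,3) cycle_cover_eq_trace[OF as(2)] by metis
  next
    fix \<C> assume "\<C> \<in> induced_uniformity X K \<nu>"
    then obtain \<W> where W: "\<Union>\<C> = X" "open_cover K \<W>" "refines (trace_cover X \<nu> \<W>) \<C>"
      unfolding mem_induced_uniformity_iff by blast
    obtain as where as: "circ_cycle X R as" "refines (cycle_cover R as) (trace_cover X \<nu> \<W>)"
      using cycle_cover_refines_trace[OF W(2)] by blast
    have "refines (cycle_cover R as) \<C>" by (rule refines_trans[OF as(2) W(3)])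
    then show "\<C> \<in> circ_uniformity X R"
      unfolding eq uniformity_with_base_def using W(1) as(1) by blast
  qed
qed

end

subsection \<open>The action on the Novak completion\<close>

context cop_subgroup
begin

abbreviation "G_topology \<equiv> pointwise_topology (circ_topology X R) G"

lemma topspace_G_topology: "topspace G_topology = G"
  using topspace_pointwise[of G "circ_topology X R"] G_cop unfolding topspace_circ by blast

lemma openin_G_eval:
  assumes "q \<in> X" "openin (circ_topology X R) U"
  shows "openin G_topology {g\<in>G. g q \<in> U}"
  using openin_continuous_map_preimage[OF continuous_map_pointwise_eval assms(2), of q G]
    assms(1) topspace_circ topspace_G_topology by simp

interpretation N: circular_order_set \<N> \<O>
  using circular_novak by unfold_locales

lemma topspace_novak_topology: "topspace (novak_topology X R) = \<N>"
  unfolding novak_topology_def by (rule N.topspace_circ)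

text \<open>Isolates the two properties that are proved differently for large circles and for finite
  ones.\<close>

lemma compactified_action_novakI:
  assumes "circ_topology X R = pullback_topology X \<nu> (novak_topology X R)"
    and "\<And>W L. openin (novak_topology X R) W \<Longrightarrow> L \<in> W \<Longrightarrow>
       \<exists>V N. openin G_topology V \<and> (\<lambda>x\<in>X. x) \<in> V \<and> openin (novak_topology X R) N \<and> L \<in> N \<and>
         (\<forall>g\<in>V. \<forall>M\<in>N. novak_action X R g M \<in> W)"
  shows "compactified_action X (circ_topology X R) (novak_topology X R) \<nu> G (novak_action X R)"
proof (rule compactified_action.intro)
  show "compact_space (novak_topology X R)" by (rule compact_novak)
  show "Hausdorff_space (novak_topology X R)" unfolding novak_topology_def by (rule N.Hausdorff_circ)
  show "x \<in> X \<Longrightarrow> \<nu> x \<in> topspace (novak_topology X R)" for x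
    unfolding topspace_novak_topology by (rule lower_cut_novak)
  show "subgroup G (BijGroup X)" by (rule G_BijGroup)
  show "group_action (BijGroup X\<lparr>carrier := G\<rparr>) (topspace (novak_topology X R)) (novak_action X R)"
    unfolding topspace_novak_topology by (rule action_novak)
  show "continuous_map (novak_topology X R) (novak_topology X R) (novak_action X R g)" if "g \<in> G" for g
    unfolding novak_topology_def using N.cop_continuous novak_action_cop G_cop[OF that] by blast
  show "novak_action X R g (\<nu> x) = \<nu> (g x)" if "g \<in> G" "x \<in> X" for g x
    using novak_action_lower_cut G_cop that by blast
qed (use assms in blast)+

end

locale large_cop_subgroup = cop_subgroup X R G + large_circular_order X R
  for X :: "'a set" and R and G
begin

interpretation N: circular_order_set \<N> \<O>
  using circular_novak by unfold_locales

lemma openin_G_interval: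
  assumes "x \<in> X" "P \<noteq> Q"
  shows "openin G_topology {g\<in>G. (P, \<nu> (g x), Q) \<in> \<O>}"
proof -
  have "openin (circ_topology X R) {x\<in>X. \<nu> x \<in> circ_open \<O> P Q}"
    unfolding circ_topology_eq_pullback openin_pullback_iff using openin_novak_interval[OF assms(2)] by blast
  from openin_G_eval[OF assms(1) this]
  have "openin G_topology {g\<in>G. g x \<in> {x\<in>X. \<nu> x \<in> circ_open \<O> P Q}}" .
  moreover have "{g\<in>G. g x \<in> {x\<in>X. \<nu> x \<in> circ_open \<O> P Q}} = {g\<in>G. (P, \<nu> (g x), Q) \<in> \<O>}"
    using cop_mem G_cop assms(1) unfolding circ_open_def by blast
  ultimately show ?thesis by simp
qed

lemma action_order:
  "g \<in> G \<Longrightarrow> (A, B, D) \<in> \<O> \<Longrightarrow> (novak_action X R g A, novak_action X R g B, novak_action X R g D) \<in> \<O>"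
  using novak_action_cop G_cop unfolding cop_def by blast

lemma action_nu: "g \<in> G \<Longrightarrow> x \<in> X \<Longrightarrow> novak_action X R g (\<nu> x) = \<nu> (g x)"
  using novak_action_lower_cut G_cop by blast

text \<open>If there are points of \<open>X\<close> on both sides of \<open>L\<close> inside the interval, their images control the
  image of a neighbourhood. If \<open>L\<close> is isolated on one side, then \<open>L\<close> and the end point on that side
  are points of \<open>X\<close>, and their images are controlled as well.\<close>

lemma local_novak_interval:
  assumes ab: "a \<in> X" "b \<in> X" "(\<nu> a, L, \<nu> b) \<in> \<O>"
  shows "\<exists>V N. openin G_topology V \<and> (\<lambda>x\<in>X. x) \<in> V \<and> openin K N \<and> L \<in> N \<and>
         (\<forall>g\<in>V. \<forall>M\<in>N. (\<nu> a, novak_action X R g M, \<nu> b) \<in> \<O>)"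
proof -
  have LN: "L \<in> \<N>" and ne: "\<nu> a \<noteq> L" "L \<noteq> \<nu> b" "\<nu> a \<noteq> \<nu> b"
    using N.R_mem[OF ab(3)] N.R_distinct[OF ab(3)] by blast+
  note nu = lower_cut_novak
  have ba: "(\<nu> b, \<nu> a, L) \<in> \<O>" "(L, \<nu> b, \<nu> a) \<in> \<O>" using ab(3) N.R_cyc by blast+
  have left: "\<And>M. (\<nu> a, M, L) \<notin> \<O>" "L \<in> \<nu> ` X" if "\<not> (\<exists>c\<in>X. (\<nu> a, \<nu> c, L) \<in> \<O>)"
    using that novak_interval_point novak_between[OF nu[OF ab(1)] LN ne(1)] by blast+
  have right: "\<And>M. (L, M, \<nu> b) \<notin> \<O>" "L \<in> \<nu> ` X" if "\<not> (\<exists>d\<in>X. (L, \<nu> d, \<nu> b) \<in> \<O>)"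
    using that novak_interval_point novak_between[OF LN nu[OF ab(2)] ne(2)] by blast+
  have one: "(\<lambda>x\<in>X. x) \<in> G" by (rule one_mem_G)
  show ?thesis
  proof (cases "\<exists>c\<in>X. (\<nu> a, \<nu> c, L) \<in> \<O>")
    case True
    then obtain c where c: "c \<in> X" "(\<nu> a, \<nu> c, L) \<in> \<O>" by blast
    have cL: "(\<nu> c, L, \<nu> b) \<in> \<O>" by (rule N.R_mid[OF c(2) ab(3)])
    show ?thesis
    proof (cases "\<exists>d\<in>X. (L, \<nu> d, \<nu> b) \<in> \<O>")
      case True
      then obtain d where d: "d \<in> X" "(L, \<nu> d, \<nu> b) \<in> \<O>" by blast
      have cd: "(\<nu> c, L, \<nu> d) \<in> \<O>" by (rule N.R_between(1)[OF cL d(2)])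
      \<comment> \<open>The images of \<open>c\<close> and \<open>d\<close> are kept on their own
        sides of \<open>L\<close>, inside the arc from \<open>a\<close> to \<open>b\<close>.\<close>
      let ?V = "{g\<in>G. (\<nu> a, \<nu> (g c), L) \<in> \<O>} \<inter> {g\<in>G. (L, \<nu> (g d), \<nu> b) \<in> \<O>}"
      let ?N = "circ_open \<O> (\<nu> c) (\<nu> d)"
      have "openin G_topology ?V"
        by (intro openin_Int openin_G_interval c d ne)
      moreover have "(\<lambda>x\<in>X. x) \<in> ?V" using one c d by simp
      moreover have "openin K ?N" "L \<in> ?N"
        using openin_novak_interval N.R_distinct[OF cd] cd unfolding circ_open_def by blast+
      moreover have "(\<nu> a, novak_action X R g M, \<nu> b) \<in> \<O>" if "g \<in> ?V" "M \<in> ?N" for g M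
      proof -
        have g: "g \<in> G" "(\<nu> a, \<nu> (g c), L) \<in> \<O>" "(L, \<nu> (g d), \<nu> b) \<in> \<O>" using that(1) by auto
        have "(\<nu> c, M, \<nu> d) \<in> \<O>" using that(2) unfolding circ_open_def by blast
        from action_order[OF g(1) this]
        show ?thesis
          unfolding action_nu[OF g(1) c(1)] action_nu[OF g(1) d(1)]
          by (rule N.interval_translate[OF ab(3) g(2,3)])
      qed
      ultimately show ?thesis by blast
    next
      case False
      note jump = right[OF False]
      obtain q where q: "q \<in> X" "L = \<nu> q" using jump(2) by blast
      \<comment> \<open>No point between \<open>L\<close> and \<open>b\<close> can mark the right
        side, so \<open>b\<close> does: its image is kept off the arc from \<open>a\<close> to
        \<open>L\<close>, while the image of \<open>L = \<nu> q\<close> stays between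
        \<open>a\<close> and \<open>b\<close>.\<close>
      let ?V = "{g\<in>G. (L, \<nu> (g b), \<nu> a) \<in> \<O>} \<inter> {g\<in>G. (\<nu> a, \<nu> (g q), \<nu> b) \<in> \<O>} \<inter>
          {g\<in>G. (\<nu> a, \<nu> (g c), L) \<in> \<O>}"
      let ?N = "circ_open \<O> (\<nu> c) (\<nu> b)"
      have "openin G_topology ?V"
        using ne by (intro openin_Int openin_G_interval c q ab) auto
      moreover have "(\<lambda>x\<in>X. x) \<in> ?V" using one c ab ba q by simp
      moreover have "openin K ?N" "L \<in> ?N"
        using openin_novak_interval N.R_distinct[OF cL] cL unfolding circ_open_def by blast+
      moreover have "(\<nu> a, novak_action X R g M, \<nu> b) \<in> \<O>" if "g \<in> ?V" "M \<in> ?N" for g M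
      proof -
        have g: "g \<in> G" "(L, \<nu> (g b), \<nu> a) \<in> \<O>" "(\<nu> a, \<nu> (g q), \<nu> b) \<in> \<O>" "(\<nu> a, \<nu> (g c), L) \<in> \<O>"
          using that(1) by auto
        have M: "(\<nu> c, M, \<nu> b) \<in> \<O>" using that(2) unfolding circ_open_def by blast
        note tr = action_nu[OF g(1) c(1)] action_nu[OF g(1) ab(2)] action_nu[OF g(1) q(1)]
        show ?thesis
        proof (rule N.jump_translate_right[OF ab(3) jump(1) c(2) M g(2-4)])
          show "(\<nu> c, L, \<nu> b) \<in> \<O> \<Longrightarrow> (\<nu> (g c), \<nu> (g q), \<nu> (g b)) \<in> \<O>"
            using action_order[OF g(1), of "\<nu> c" L "\<nu> b"] unfolding q(2) tr .
          show "(\<nu> c, M, L) \<in> \<O> \<Longrightarrow> (\<nu> (g c), novak_action X R g M, \<nu> (g q)) \<in> \<O>"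
            using action_order[OF g(1), of "\<nu> c" M L] unfolding q(2) tr .
          show "M = L \<Longrightarrow> novak_action X R g M = \<nu> (g q)" using q(2) tr(3) by simp
        qed
      qed
      ultimately show ?thesis by blast
    qed
  next
    case False
    note jump = left[OF False]
    obtain q where q: "q \<in> X" "L = \<nu> q" using jump(2) by blast
    show ?thesis
    proof (cases "\<exists>d\<in>X. (L, \<nu> d, \<nu> b) \<in> \<O>")
      case True
      then obtain d where d: "d \<in> X" "(L, \<nu> d, \<nu> b) \<in> \<O>" by blast
      have aL: "(\<nu> a, L, \<nu> d) \<in> \<O>" by (rule N.R_between(1)[OF ab(3) d(2)])
      let ?V = "{g\<in>G. (\<nu> b, \<nu> (g a), L) \<in> \<O>} \<inter> {g\<in>G. (\<nu> a, \<nu> (g q), \<nu> b) \<in> \<O>} \<inter>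
          {g\<in>G. (L, \<nu> (g d), \<nu> b) \<in> \<O>}"
      let ?N = "circ_open \<O> (\<nu> a) (\<nu> d)"
      have "openin G_topology ?V"
        using ne by (intro openin_Int openin_G_interval d q ab) auto
      moreover have "(\<lambda>x\<in>X. x) \<in> ?V" using one d ab ba q by simp
      moreover have "openin K ?N" "L \<in> ?N"
        using openin_novak_interval N.R_distinct[OF aL] aL unfolding circ_open_def by blast+
      moreover have "(\<nu> a, novak_action X R g M, \<nu> b) \<in> \<O>" if "g \<in> ?V" "M \<in> ?N" for g M
      proof -
        have g: "g \<in> G" "(\<nu> b, \<nu> (g a), L) \<in> \<O>" "(\<nu> a, \<nu> (g q), \<nu> b) \<in> \<O>" "(L, \<nu> (g d), \<nu> b) \<in> \<O>"
          using that(1) by auto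
        have M: "(\<nu> a, M, \<nu> d) \<in> \<O>" using that(2) unfolding circ_open_def by blast
        note tr = action_nu[OF g(1) d(1)] action_nu[OF g(1) ab(1)] action_nu[OF g(1) q(1)]
        show ?thesis
        proof (rule N.jump_translate[OF ab(3) jump(1) d(2) M g(2-4)])
          show "(\<nu> a, L, \<nu> d) \<in> \<O> \<Longrightarrow> (\<nu> (g a), \<nu> (g q), \<nu> (g d)) \<in> \<O>"
            using action_order[OF g(1), of "\<nu> a" L "\<nu> d"] unfolding q(2) tr .
          show "(L, M, \<nu> d) \<in> \<O> \<Longrightarrow> (\<nu> (g q), novak_action X R g M, \<nu> (g d)) \<in> \<O>"
            using action_order[OF g(1), of L M "\<nu> d"] unfolding q(2) tr .
          show "M = L \<Longrightarrow> novak_action X R g M = \<nu> (g q)" using q(2) tr(3) by simp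
        qed
      qed
      ultimately show ?thesis by blast
    next
      case False
      note jump' = right[OF False]
      \<comment> \<open>With jumps on both sides the neighbourhood \<open>?N\<close> is just
        \<open>{L}\<close>, and controlling the image of \<open>q\<close> is enough.\<close>
      let ?V = "{g\<in>G. (\<nu> a, \<nu> (g q), \<nu> b) \<in> \<O>}"
      let ?N = "circ_open \<O> (\<nu> a) (\<nu> b)"
      have "openin G_topology ?V" using ne by (intro openin_G_interval q)
      moreover have "(\<lambda>x\<in>X. x) \<in> ?V" using one ab q by simp
      moreover have "openin K ?N" "L \<in> ?N"
        using openin_novak_interval[OF ne(3)] ab(3) unfolding circ_open_def by blast+
      moreover have "M = L" if "M \<in> ?N" for M
      proof (rule ccontr)
        assume "M \<noteq> L"
        have M: "(\<nu> a, M, \<nu> b) \<in> \<O>" using that unfolding circ_open_def by blast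
        then have "(\<nu> a, M, L) \<in> \<O> \<or> (\<nu> a, L, M) \<in> \<O>"
          using N.R_total[of "\<nu> a" M L] N.R_mem[OF M] LN N.R_distinct[OF M] ne \<open>M \<noteq> L\<close> by blast
        then show False using jump(1) jump'(1) N.R_mid[OF _ M] by blast
      qed
      then have "(\<nu> a, novak_action X R g M, \<nu> b) \<in> \<O>" if "g \<in> ?V" "M \<in> ?N" for g M
        using that action_nu[OF _ q(1)] q(2) by auto
      ultimately show ?thesis by blast
    qed
  qed
qed

lemma compactified_novak:
  "compactified_action X (circ_topology X R) K \<nu> G (novak_action X R)"
proof (rule compactified_action_novakI[OF circ_topology_eq_pullback])
  fix W L assume W: "openin K W" "L \<in> W"
  obtain a b where ab: "a \<in> X" "b \<in> X" "(\<nu> a, L, \<nu> b) \<in> \<O>" "circ_open \<O> (\<nu> a) (\<nu> b) \<subseteq> W"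
    using novak_interval_base[OF W] by blast
  obtain V N where VN: "openin G_topology V" "(\<lambda>x\<in>X. x) \<in> V" "openin K N" "L \<in> N"
      "\<forall>g\<in>V. \<forall>M\<in>N. (\<nu> a, novak_action X R g M, \<nu> b) \<in> \<O>"
    using local_novak_interval[OF ab(1-3)] by blast
  have "\<forall>g\<in>V. \<forall>M\<in>N. novak_action X R g M \<in> W" using VN(5) ab(4) unfolding circ_open_def by blast
  then show "\<exists>V N. openin G_topology V \<and> (\<lambda>x\<in>X. x) \<in> V \<and> openin K N \<and> L \<in> N \<and>
         (\<forall>g\<in>V. \<forall>M\<in>N. novak_action X R g M \<in> W)"
    using VN(1-4) by blast
qed

end

section \<open>Finite circles\<close>

lemma (in circular_order_set) openin_finite_circ:
  assumes "finite C" "U \<subseteq> C"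
  shows "openin (circ_topology C R) U"
proof -
  have "circ_topology C R = discrete_topology C"
    using finite_t1_space_imp_discrete_topology[OF topspace_circ assms(1)]
      Hausdorff_imp_t1_space[OF Hausdorff_circ] by blast
  then show ?thesis using assms(2) by simp
qed

context cop_subgroup
begin

interpretation N: circular_order_set \<N> \<O>
  using circular_novak by unfold_locales

text \<open>A finite nonempty linear order has a least element, so there are no gaps.\<close>

lemma novak_points_finite:
  assumes "finite X" "X \<noteq> {}"
  shows "\<N> = \<nu> ` X"
proof -
  have False if gap: "circ_gap X R L" for L
  proof -
    interpret L: linear_order_set X L
      using gap by unfold_locales (simp add: circ_gap_def circ_cut_def)
    have "\<exists>as. set as = X \<and> sorted_wrt (lin_less L) as"
      by (rule finite_sorted_list_exists[OF assms(1)]) (use L.lt_trans L.lt_total in blast)+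
    then obtain as where as: "set as = X" "sorted_wrt (lin_less L) as" by blast
    obtain x ys where "as = x # ys" using as(1) assms(2) by (cases as) auto
    then have "x \<in> X" "\<forall>y\<in>X. (x, y) \<in> L"
      using as L.s_refl by (auto simp: lin_less_def)
    then show False using gap unfolding circ_gap_def by blast
  qed
  then show ?thesis unfolding novak_points_def by blast
qed

text \<open>All spaces involved are discrete, so it suffices that the stabilizer of \<open>L\<close>
  is open: for \<open>L = \<nu> q\<close> it consists of the \<open>g\<close> fixing
  \<open>q\<close>.\<close>

lemma compactified_novak_finite:
  assumes fin: "finite X"
  shows "compactified_action X (circ_topology X R) (novak_topology X R) \<nu> G (novak_action X R)"
proof (rule compactified_action_novakI)
  have finN: "finite \<N>"
    using novak_points_finite[OF fin] novak_points_empty fin by (cases "X = {}") auto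
  have openN: "openin (novak_topology X R) U" if "U \<subseteq> \<N>" for U
    unfolding novak_topology_def by (rule N.openin_finite_circ[OF finN that])
  have "openin (pullback_topology X \<nu> (novak_topology X R)) U \<longleftrightarrow> U \<subseteq> X" for U
  proof
    assume "U \<subseteq> X"
    then have "U = {x\<in>X. \<nu> x \<in> \<nu> ` U}" using inj_lower_cut unfolding inj_on_def by blast
    moreover have "\<nu> ` U \<subseteq> \<N>" using \<open>U \<subseteq> X\<close> lower_cut_novak by blast
    ultimately show "openin (pullback_topology X \<nu> (novak_topology X R)) U"
      unfolding openin_pullback_iff using openN by (intro exI[of _ "\<nu> ` U"] conjI)
  qed (auto simp: openin_pullback_iff)
  moreover have "openin (circ_topology X R) U \<longleftrightarrow> U \<subseteq> X" for U
    using openin_finite_circ[OF fin] openin_subset topspace_circ by blast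
  ultimately show "circ_topology X R = pullback_topology X \<nu> (novak_topology X R)"
    unfolding topology_eq by blast
  fix W L assume W: "openin (novak_topology X R) W" "L \<in> W"
  then have LN: "L \<in> \<N>" using openin_subset topspace_novak_topology by blast
  have "openin G_topology {g\<in>G. novak_action X R g L = L}"
  proof (cases "X = {}")
    case True
    have "novak_action X R g L = L" for g
      using LN novak_points_empty[OF True] novak_action_apply[OF LN] by simp
    then show ?thesis using openin_topspace[of G_topology] topspace_G_topology by simp
  next
    case False
    then obtain q where q: "q \<in> X" "L = \<nu> q" using LN novak_points_finite[OF fin] by blast
    have "novak_action X R g L = L \<longleftrightarrow> g q \<in> {q}" if "g \<in> G" for g
      unfolding q(2) using novak_action_lower_cut[OF _ q(1)] inj_lower_cut cop_mem G_cop[OF that] q(1)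
      unfolding inj_on_def by force
    then have "{g\<in>G. novak_action X R g L = L} = {g\<in>G. g q \<in> {q}}" by blast
    then show ?thesis using openin_G_eval[OF q(1) openin_finite_circ[OF fin, of "{q}"]] q(1) by simp
  qed
  moreover have "novak_action X R (\<lambda>x\<in>X. x) L = L"
  proof -
    have "map_prod (\<lambda>x\<in>X. x) (\<lambda>x\<in>X. x) p = p" if "p \<in> L" for p
      using cut_mem[OF novak_cut[OF LN]] that by (cases p) auto
    then show ?thesis using novak_action_apply[OF LN] by simp
  qed
  moreover have "openin (novak_topology X R) {L}" using openN LN by blast
  ultimately show "\<exists>V N. openin G_topology V \<and> (\<lambda>x\<in>X. x) \<in> V \<and> openin (novak_topology X R) N \<and> L \<in> N \<and>
         (\<forall>g\<in>V. \<forall>M\<in>N. novak_action X R g M \<in> W)"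
    using W(2) one_mem_G
    by (intro exI[of _ "{g\<in>G. novak_action X R g L = L}"] exI[of _ "{L}"]) auto
qed

text \<open>For \<open>X = {}\<close> the Novak completion is a single point, and the empty cover of \<open>X\<close> is not the
  trace of a cover of it. Therefore the finite space \<open>X\<close> is used as its own compactification.\<close>

lemma compactified_self_finite:
  assumes fin: "finite X"
  shows "compactified_action X (circ_topology X R) (circ_topology X R) (\<lambda>x. x) G (\<lambda>g. g)"
proof (rule compactified_action.intro)
  interpret act: compactified_action X "circ_topology X R" "novak_topology X R" \<nu> G "novak_action X R"
    by (rule compactified_novak_finite[OF fin])
  show "compact_space (circ_topology X R)"
    using fin topspace_circ by (simp add: compact_space_def finite_imp_compactin)
  show "Hausdorff_space (circ_topology X R)" by (rule Hausdorff_circ)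
  show "x \<in> X \<Longrightarrow> x \<in> topspace (circ_topology X R)" for x by (simp add: topspace_circ)
  have "{x\<in>X. x \<in> W} = W" if "openin (circ_topology X R) W" for W
    using openin_subset[OF that] topspace_circ by blast
  then show "circ_topology X R = pullback_topology X (\<lambda>x. x) (circ_topology X R)"
    unfolding topology_eq openin_pullback_iff by metis
  show "subgroup G (BijGroup X)" by (rule G_BijGroup)
  show "group_action (BijGroup X\<lparr>carrier := G\<rparr>) (topspace (circ_topology X R)) (\<lambda>g. g)"
    unfolding topspace_circ by (rule act.action_X)
  show "continuous_map (circ_topology X R) (circ_topology X R) g" if "g \<in> G" for g
    using cop_continuous G_cop[OF that] by blast
  fix W y assume W: "openin (circ_topology X R) W" "y \<in> W"
  then have y: "y \<in> X" using openin_subset topspace_circ by blast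
  have y': "openin (circ_topology X R) {y}" using y by (intro openin_finite_circ[OF fin]) simp
  have "openin G_topology {g\<in>G. g y \<in> {y}}" by (rule openin_G_eval[OF y y'])
  then show "\<exists>V N. openin G_topology V \<and> (\<lambda>x\<in>X. x) \<in> V \<and> openin (circ_topology X R) N \<and> y \<in> N \<and>
         (\<forall>g\<in>V. \<forall>z\<in>N. g z \<in> W)"
    using W(2) one_mem_G y y' by (intro exI[of _ "{g\<in>G. g y \<in> {y}}"] exI[of _ "{y}"]) auto
qed simp

text \<open>The singletons form an open cover of the discrete space, and they refine every
  cover.\<close>

lemma circ_uniformity_small:
  assumes small: "finite X" "card X \<le> 2"
  shows "circ_uniformity X R = induced_uniformity X (circ_topology X R) (\<lambda>x. x)"
proof -
  have "\<C> \<in> induced_uniformity X (circ_topology X R) (\<lambda>x. x) \<longleftrightarrow> \<Union>\<C> = X" for \<C>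
  proof
    assume C: "\<Union>\<C> = X"
    have "open_cover (circ_topology X R) ((\<lambda>x. {x}) ` X)"
      unfolding open_cover_def topspace_circ using openin_finite_circ[OF small(1)] by auto
    moreover have "refines (trace_cover X (\<lambda>x. x) ((\<lambda>x. {x}) ` X)) \<C>"
      unfolding refines_def trace_cover_def using C by fastforce
    ultimately show "\<C> \<in> induced_uniformity X (circ_topology X R) (\<lambda>x. x)"
      unfolding mem_induced_uniformity_iff using C by (intro conjI exI[of _ "(\<lambda>x. {x}) ` X"])
  qed (simp add: mem_induced_uniformity_iff)
  then have "induced_uniformity X (circ_topology X R) (\<lambda>x. x) = {\<C>. \<Union>\<C> = X}" by blast
  moreover have "circ_uniformity X R = {\<C>. \<Union>\<C> = X}"
    unfolding circ_uniformity_def using small by (simp only: simp_thms if_True)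
  ultimately show ?thesis by (simp only:)
qed

theorem cop_group_actions:
  "equiuniform (cop_group X R\<lparr>carrier := G\<rparr>) (pointwise_topology (circ_topology X R) G)
     X (circ_uniformity X R) (\<lambda>g. g) \<and>
   continuous_action (cop_group X R\<lparr>carrier := G\<rparr>) (pointwise_topology (circ_topology X R) G)
     (novak_topology X R) (novak_action X R) \<and>
   (\<forall>g\<in>G. cop (novak_points X R) (novak_order X R) (novak_action X R g)) \<and>
   (\<forall>g\<in>G. \<forall>x\<in>X. novak_action X R g (lower_cut X R x) = lower_cut X R (g x)) \<and>
   topological_group (cop_group X R\<lparr>carrier := G\<rparr>) (pointwise_topology (circ_topology X R) G) \<and>
   continuous_action (cop_group X R\<lparr>carrier := G\<rparr>) (pointwise_topology (circ_topology X R) G)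
     (circ_topology X R) (\<lambda>g. g)"
proof -
  have grp: "cop_group X R\<lparr>carrier := G\<rparr> = BijGroup X\<lparr>carrier := G\<rparr>"
    by (simp add: cop_group_def)
  have "compactified_action X (circ_topology X R) (novak_topology X R) \<nu> G (novak_action X R) \<and>
      equiuniform (BijGroup X\<lparr>carrier := G\<rparr>) G_topology X (circ_uniformity X R) (\<lambda>g. g)"
  \<comment> \<open>For small \<open>X\<close> the action is still the one on the Novak completion,
    but the uniformity is induced from \<open>X\<close> as its own compactification.\<close>
  proof (cases "finite X \<and> card X \<le> 2")
    case True
    then show ?thesis
      using compactified_novak_finite circ_uniformity_small
        compactified_action.equiuniform_induced[OF compactified_self_finite] by simp
  next
    case False
    then have "\<exists>A\<subseteq>X. card A = 3"
    proof (cases "finite X")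
      case True
      then have "3 \<le> card X" using False by simp
      then show ?thesis by (rule obtain_subset_with_card_n) blast
    next
      case inf: False
      show ?thesis using infinite_arbitrarily_large[OF inf, of 3] by blast
    qed
    then obtain A where "A \<subseteq> X" "card A = 3" by blast
    then have "\<exists>a\<in>X. \<exists>b\<in>X. \<exists>c\<in>X. a \<noteq> b \<and> b \<noteq> c \<and> a \<noteq> c"
      unfolding card_3_iff by blast
    then interpret large_cop_subgroup X R G by unfold_locales
    show ?thesis
      using compactified_novak circ_uniformity_eq_induced
        compactified_action.equiuniform_induced[OF compactified_novak] by simp
  qed
  then interpret act: compactified_action X "circ_topology X R" "novak_topology X R" \<nu> G "novak_action X R"
    by blast
  show ?thesis
    unfolding grp
    using \<open>compactified_action X (circ_topology X R) (novak_topology X R) \<nu> G (novak_action X R) \<and>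
      equiuniform (BijGroup X\<lparr>carrier := G\<rparr>) G_topology X (circ_uniformity X R) (\<lambda>g. g)\<close>
      act.continuous_action_compactification act.topological act.continuous_action_X
      novak_action_cop G_cop novak_action_lower_cut by blast
qed

end

theorem theorem10p1:
  fixes X :: "'a set" and R :: "('a \<times> 'a \<times> 'a) set" and G :: "('a \<Rightarrow> 'a) set"
  assumes "circular_order X R"
    and "subgroup G (cop_group X R)"
  shows
    "equiuniform (cop_group X R\<lparr>carrier := G\<rparr>) (pointwise_topology (circ_topology X R) G)
       X (circ_uniformity X R) (\<lambda>g. g)
     \<and>
     continuous_action (cop_group X R\<lparr>carrier := G\<rparr>) (pointwise_topology (circ_topology X R) G)
       (novak_topology X R) (novak_action X R) \<and>
     (\<forall>g\<in>G. cop (novak_points X R) (novak_order X R) (novak_action X R g)) \<and>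
     (\<forall>g\<in>G. \<forall>x\<in>X. novak_action X R g (lower_cut X R x) = lower_cut X R (g x))
     \<and>
     topological_group (cop_group X R\<lparr>carrier := G\<rparr>) (pointwise_topology (circ_topology X R) G) \<and>
     continuous_action (cop_group X R\<lparr>carrier := G\<rparr>) (pointwise_topology (circ_topology X R) G)
       (circ_topology X R) (\<lambda>g. g)
     \<and>
     (\<forall>(Y :: 'b set) (r :: 'b rel) (H :: ('b \<Rightarrow> 'b) set).
        linear_order_on Y r \<and> subgroup H (lop_group Y r) \<longrightarrow>
        equiuniform (lop_group Y r\<lparr>carrier := H\<rparr>) (pointwise_topology (lin_topology Y r) H)
          Y (lin_uniformity Y r) (\<lambda>g. g) \<and>
        compact_completion Y (lin_uniformity Y r) (dedekind_topology Y r) (lin_embed r) \<and>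
        (\<exists>\<psi>. continuous_action (lop_group Y r\<lparr>carrier := H\<rparr>)
               (pointwise_topology (lin_topology Y r) H) (dedekind_topology Y r) \<psi> \<and>
             (\<forall>g\<in>H. lop (dedekind_points Y r) (dedekind_order Y r) (\<psi> g)) \<and>
             (\<forall>g\<in>H. \<forall>y\<in>Y. \<psi> g (lin_embed r y) = lin_embed r (g y))) \<and>
        topological_group (lop_group Y r\<lparr>carrier := H\<rparr>) (pointwise_topology (lin_topology Y r) H) \<and>
        continuous_action (lop_group Y r\<lparr>carrier := H\<rparr>) (pointwise_topology (lin_topology Y r) H)
          (lin_topology Y r) (\<lambda>g. g))"
proof (intro conjI)
  interpret cop_subgroup X R G
    using assms by (simp add: cop_subgroup_def circular_order_set_def cop_subgroup_axioms_def)
  note circ = cop_group_actions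
  show "equiuniform (cop_group X R\<lparr>carrier := G\<rparr>) (pointwise_topology (circ_topology X R) G)
      X (circ_uniformity X R) (\<lambda>g. g)"
    using circ by blast
  show "continuous_action (cop_group X R\<lparr>carrier := G\<rparr>) (pointwise_topology (circ_topology X R) G)
      (novak_topology X R) (novak_action X R)"
    using circ by blast
  show "\<forall>g\<in>G. cop (novak_points X R) (novak_order X R) (novak_action X R g)"
    using circ by blast
  show "\<forall>g\<in>G. \<forall>x\<in>X. novak_action X R g (lower_cut X R x) = lower_cut X R (g x)"
    using circ by blast
  show "topological_group (cop_group X R\<lparr>carrier := G\<rparr>) (pointwise_topology (circ_topology X R) G)"
    using circ by blast
  show "continuous_action (cop_group X R\<lparr>carrier := G\<rparr>) (pointwise_topology (circ_topology X R) G)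
      (circ_topology X R) (\<lambda>g. g)"
    using circ by blast
qed (intro allI impI, rule lop_subgroup.lop_group_actions,
    simp add: lop_subgroup_def linear_order_set_def lop_subgroup_axioms_def)

end
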